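(* Let $\vec\beta$ be in the high temperature (sub-critical) phase. Then the spectral gap $\gamma=\gamma_n$ of the Glauber dynamics for $\mathrm{ERGM}(\vec\beta)$ on $n$ vertices satisfies $\gamma=\Theta(n^{-2})$ as $n\to\infty$ (i.e. there are constants $0<c_1\le c_2$, independent of $n$, with $c_1n^{-2}\le\gamma_n\le c_2n^{-2}$ for all sufficiently large $n$). Thus there exists a constant $C>0$, independent of $n$, such that for all sufficiently large $n$ and every $f\in L^2(\pi)$ (i.e. every $f:\mathcal G_n\to\mathbb R$), $$\mathrm{Var}_\pi(f)\le C n^2\,\mathcal E(f,f).$$
   Context: Configurations. $\mathcal G_n$ is the set of simple graphs on vertex set $\{1,\dots,n\}$, identified with $\{0,1\}^M$, $M=n(n-1)/2$, with coordinates indexed by the edges of the complete graph $K_n$: $x=(x_e)_{e\in E(K_n)}$, $x_e=1$ iff $e$ is present. For an edge $e$, $x_{e+}$ and $x_{e-}$ are $x$ with the $e$-coordinate set to $1$, resp. $0$, and $x^e$ is $x$ with the $e$-coordinate flipped. For $\varphi:\mathcal G_n\to\mathbb R$, $\partial_e\varphi(x)=\varphi(x_{e+})-\varphi(x_{e-})$. ERGM. Fix $s\ge1$, finite simple graphs $G_1,\dots,G_s$ with $|V_i|$ vertices and $|E_i|$ edges, and $\vec\beta=(\beta_1,\dots,\beta_s)$ with all $\beta_i>0$ (all independent of $n$). For a graph $G$, $N_G(x)=\sum_{\psi}\prod_{(v,w)\in E(G)}x_{(\psi(v),\psi(w))}$, the sum over all injective $\psi:V(G)\to\{1,\dots,n\}$.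 The Hamiltonian is $H(x)=\sum_{i=1}^s\beta_i N_{G_i}(x)/n^{|V_i|-2}$, and $\mathrm{ERGM}(\vec\beta)$ is the probability measure $\pi=\pi_n$ on $\mathcal G_n$ with $\pi(x)\propto e^{H(x)}$. High temperature phase. Let $\Phi(u)=e^u/(1+e^u)$ and, for $p>0$, $\Psi_{\vec\beta}(p)=\sum_{i=1}^s2\beta_i|E_i|p^{|E_i|-1}$ and $\varphi_{\vec\beta}(p)=\Phi(\Psi_{\vec\beta}(p))$. $\vec\beta$ is in the high temperature (sub-critical) phase if $\varphi_{\vec\beta}(p)=p$ has a unique solution $p^*$ and $\varphi_{\vec\beta}'(p^* )<1$. Glauber dynamics (discrete time heat bath). Given state $x$, a uniformly random edge $e$ is chosen and $x_e$ is resampled from its $\pi$-conditional law given the other coordinates: given $e$ is chosen, the new state is $x_{e+}$ with probability $\Phi(\partial_eH(x))$ and $x_{e-}$ with probability $1-\Phi(\partial_eH(x))$. Let $c(x,e)$ be the probability that, given $e$ is chosen, the new state is $x^e$. The generator is $\mathcal Lf(x)=\frac1M\sum_ec(x,e)(f(x^e)-f(x))$, and the Dirichlet form is $$\mathcal E(f,g)=\frac1M\sum_{x\in\mathcal G_n}\sum_ec(x,e)(f(x^e)-f(x))(g(x^e)-g(x))\pi(x).$$ $\gamma$ denotes the spectral gap of $\mathcal L$, given by the variational characterization $\gamma=\inf\{\mathcal E(f,f): \mathbb E_\pi f=0,\ \mathbb E_\pi f^2=1\}$. *)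

theory Defs
  imports "HOL-Probability.Probability"
begin

text \<open>
  A graph on the vertex set \<open>{1..n}\<close> is encoded by its set of edges, each edge being a
  two-element set of vertices; the coordinate $x_e$ of a configuration \<open>x\<close> is
  \<open>of_bool (e \<in> x)\<close>.
\<close>

definition complete_edges :: "nat \<Rightarrow> nat set set" where
  "complete_edges n = {e. e \<subseteq> {1..n} \<and> card e = 2}"

definition configs :: "nat \<Rightarrow> nat set set set" where
  "configs n = Pow (complete_edges n)"

definition edge_on :: "nat set set \<Rightarrow> nat set \<Rightarrow> nat set set" where
  "edge_on x e = insert e x"

definition edge_off :: "nat set set \<Rightarrow> nat set \<Rightarrow> nat set set" where
  "edge_off x e = x - {e}"

definition edge_flip :: "nat set set \<Rightarrow> nat set \<Rightarrow> nat set set" where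
  "edge_flip x e = (if e \<in> x then edge_off x e else edge_on x e)"

definition edge_deriv :: "nat set \<Rightarrow> (nat set set \<Rightarrow> real) \<Rightarrow> nat set set \<Rightarrow> real" where
  "edge_deriv e \<phi> x = \<phi> (edge_on x e) - \<phi> (edge_off x e)"

type_synonym 'v graph = "'v set \<times> 'v set set"

abbreviation verts :: "'v graph \<Rightarrow> 'v set" where "verts \<equiv> fst"
abbreviation edges :: "'v graph \<Rightarrow> 'v set set" where "edges \<equiv> snd"

definition finite_simple_graph :: "'v graph \<Rightarrow> bool" where
  "finite_simple_graph G \<longleftrightarrow>
     finite (verts G) \<and> (\<forall>e\<in>edges G. e \<subseteq> verts G \<and> card e = 2)"

text \<open>
  The injections range over the extensional function space, so that each injective map defined
  on \<open>verts G\<close> is counted exactly once.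
\<close>

definition hom_count :: "nat \<Rightarrow> 'v graph \<Rightarrow> nat set set \<Rightarrow> real" where
  "hom_count n G x =
     (\<Sum>\<psi> | \<psi> \<in> verts G \<rightarrow>\<^sub>E {1..n} \<and> inj_on \<psi> (verts G).
        \<Prod>e\<in>edges G. of_bool (\<psi> ` e \<in> x))"

text \<open>The exponent is an integer because a graph may have fewer than two vertices.\<close>

definition hamiltonian ::
  "nat \<Rightarrow> (nat \<Rightarrow> 'v graph) \<Rightarrow> (nat \<Rightarrow> real) \<Rightarrow> nat \<Rightarrow> nat set set \<Rightarrow> real" where
  "hamiltonian s G \<beta> n x =
     (\<Sum>i=1..s. \<beta> i * hom_count n (G i) x / real n powi (int (card (verts (G i))) - 2))"

definition partition_fun :: "nat \<Rightarrow> (nat \<Rightarrow> 'v graph) \<Rightarrow> (nat \<Rightarrow> real) \<Rightarrow> nat \<Rightarrow> real" where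
  "partition_fun s G \<beta> n = (\<Sum>x\<in>configs n. exp (hamiltonian s G \<beta> n x))"

definition ergm ::
  "nat \<Rightarrow> (nat \<Rightarrow> 'v graph) \<Rightarrow> (nat \<Rightarrow> real) \<Rightarrow> nat \<Rightarrow> nat set set pmf" where
  "ergm s G \<beta> n = embed_pmf (\<lambda>x.
     if x \<in> configs n then exp (hamiltonian s G \<beta> n x) / partition_fun s G \<beta> n else 0)"

lemma finite_configs: "finite (configs n)"
proof -
  have "complete_edges n \<subseteq> Pow {1..n}"
    by (auto simp: complete_edges_def)
  then have "finite (complete_edges n)"
    using finite_subset by blast
  then show ?thesis
    by (simp add: configs_def)
qed

lemma partition_fun_pos: "partition_fun s G \<beta> n > 0"
  unfolding partition_fun_def
  by (rule sum_pos) (auto simp: finite_configs, auto simp: configs_def)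

lemma pmf_ergm:
  "pmf (ergm s G \<beta> n) x =
     (if x \<in> configs n then exp (hamiltonian s G \<beta> n x) / partition_fun s G \<beta> n else 0)"
  unfolding ergm_def
proof (rule pmf_embed_pmf)
  let ?g = "\<lambda>x. exp (hamiltonian s G \<beta> n x) / partition_fun s G \<beta> n"
  show "0 \<le> (if x \<in> configs n then ?g x else 0)" for x
    using partition_fun_pos[of s G \<beta> n] by simp
  have "(\<integral>\<^sup>+x. ennreal (if x \<in> configs n then ?g x else 0) \<partial>count_space UNIV)
      = (\<Sum>x\<in>configs n. ennreal (if x \<in> configs n then ?g x else 0))"
    by (rule nn_integral_count_space'[OF finite_configs]) auto
  also have "\<dots> = (\<Sum>x\<in>configs n. ennreal (?g x))"
    by simp
  also have "\<dots> = ennreal (\<Sum>x\<in>configs n. ?g x)"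
    using partition_fun_pos[of s G \<beta> n] by (intro sum_ennreal) simp
  also have "(\<Sum>x\<in>configs n. ?g x) = 1"
    using partition_fun_pos[of s G \<beta> n]
    by (simp add: sum_divide_distrib[symmetric] partition_fun_def[symmetric])
  finally show "(\<integral>\<^sup>+x. ennreal (if x \<in> configs n then ?g x else 0) \<partial>count_space UNIV) = 1"
    by simp
qed

definition logistic :: "real \<Rightarrow> real" where
  "logistic u = exp u / (1 + exp u)"

text \<open>
  For an edgeless graph the summand vanishes, so the truncated exponent is harmless.
\<close>

definition mean_field_Psi :: "nat \<Rightarrow> (nat \<Rightarrow> 'v graph) \<Rightarrow> (nat \<Rightarrow> real) \<Rightarrow> real \<Rightarrow> real" where
  "mean_field_Psi s G \<beta> p =
     (\<Sum>i=1..s. 2 * \<beta> i * real (card (edges (G i))) * p ^ (card (edges (G i)) - 1))"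

definition mean_field_phi :: "nat \<Rightarrow> (nat \<Rightarrow> 'v graph) \<Rightarrow> (nat \<Rightarrow> real) \<Rightarrow> real \<Rightarrow> real" where
  "mean_field_phi s G \<beta> p = logistic (mean_field_Psi s G \<beta> p)"

definition high_temperature :: "nat \<Rightarrow> (nat \<Rightarrow> 'v graph) \<Rightarrow> (nat \<Rightarrow> real) \<Rightarrow> bool" where
  "high_temperature s G \<beta> \<longleftrightarrow>
     (\<exists>p>0. mean_field_phi s G \<beta> p = p
        \<and> (\<forall>q>0. mean_field_phi s G \<beta> q = q \<longrightarrow> q = p)
        \<and> deriv (mean_field_phi s G \<beta>) p < 1)"

text \<open>The law of the new state, given the current state \<open>x\<close> and the chosen edge \<open>e\<close>.\<close>

definition glauber_update ::
  "nat \<Rightarrow> (nat \<Rightarrow> 'v graph) \<Rightarrow> (nat \<Rightarrow> real) \<Rightarrow> nat \<Rightarrow>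
     nat set set \<Rightarrow> nat set \<Rightarrow> nat set set pmf" where
  "glauber_update s G \<beta> n x e =
     map_pmf (\<lambda>b. if b then edge_on x e else edge_off x e)
       (bernoulli_pmf (logistic (edge_deriv e (hamiltonian s G \<beta> n) x)))"

definition flip_prob ::
  "nat \<Rightarrow> (nat \<Rightarrow> 'v graph) \<Rightarrow> (nat \<Rightarrow> real) \<Rightarrow> nat \<Rightarrow> nat set set \<Rightarrow> nat set \<Rightarrow> real" where
  "flip_prob s G \<beta> n x e = pmf (glauber_update s G \<beta> n x e) (edge_flip x e)"

text \<open>
  There is no factor 1/2 in front of the double sum: this form equals
  $-2\,\mathbb{E}_\pi[f \mathcal{L} g]$ for the generator $\mathcal{L}$ of the dynamics, so
  \<open>spectral_gap\<close> below is twice the smallest positive eigenvalue of $-\mathcal{L}$.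
\<close>

definition dirichlet_form ::
  "nat \<Rightarrow> (nat \<Rightarrow> 'v graph) \<Rightarrow> (nat \<Rightarrow> real) \<Rightarrow> nat \<Rightarrow>
     (nat set set \<Rightarrow> real) \<Rightarrow> (nat set set \<Rightarrow> real) \<Rightarrow> real" where
  "dirichlet_form s G \<beta> n f g =
     1 / (real n * (real n - 1) / 2) *
     (\<Sum>x\<in>configs n. \<Sum>e\<in>complete_edges n.
        flip_prob s G \<beta> n x e * (f (edge_flip x e) - f x) * (g (edge_flip x e) - g x)
          * pmf (ergm s G \<beta> n) x)"

definition spectral_gap :: "nat \<Rightarrow> (nat \<Rightarrow> 'v graph) \<Rightarrow> (nat \<Rightarrow> real) \<Rightarrow> nat \<Rightarrow> real" where
  "spectral_gap s G \<beta> n =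
     Inf {dirichlet_form s G \<beta> n f f | f.
            measure_pmf.expectation (ergm s G \<beta> n) f = 0
          \<and> measure_pmf.expectation (ergm s G \<beta> n) (\<lambda>x. (f x)\<^sup>2) = 1}"

end

(*
  Let P be the heat bath operator on functions of the configuration, M the number of edges and |x|
  the number of edges of x. P preserves increasing functions, and everything is deduced from this
  without couplings.

  (1) Functions with small gradients (each coordinate O(1/n), total O(1)) keep this property for
      O(M) steps, so the exponential moments of f(X_t) - E f(X_t) are controlled. In particular the
      fields D_e H(X_t) concentrate at scale n^(-1/2). Feeding this into the exact one-step
      recursion for the moments E[prod_(e in S) X_t(e)] shows, by a Gronwall argument, that from the
      full and from the empty graph the moments follow p_t^|S|, where p_(t+1) = p_t +
      (phi(p_t) - p_t)/M. Uniqueness of the fixed point q brings p_t close to q in O(M) steps.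
  (2) By monotonicity, after O(M) steps every starting point is, up to a probability
      exp(-c sqrt n), in the set of configurations where all fields are at least about Psi(q) and
      all total influences at most about Psi'(q). There the expected change of |x| contracts at
      rate 1 - phi'(q) > 0. Hence the gradient of P^T |x| is at most 1/2 for some T = O(M).
  (3) If f has gradient at most l then l|x| + f and l|x| - f are increasing, so P^T halves the
      gradient of every f. Reversibility makes the norms of P^k f log-convex in k, and their
      exponential decay along multiples of T gives Var f <= T E(f, f).

  The upper bound on the gap uses the indicator of one edge.
*)
theory Submission
  imports Defs "HOL-Real_Asymp.Real_Asymp"
begin

section \<open>Elementary inequalities\<close>

text \<open>Contraction cannot be asked of a single step from every configuration: from a bad start
  a gradient may grow by a factor 1 + O(1/M) per step. Over O(M) steps this costs only a constant,
  so it is enough that bad configurations are rare after a burn-in of O(M) steps. The notion of good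
  is one-sided. As every \<open>\<beta> i\<close> is positive, all fields are nonnegative, and the
  logistic function is concave there; so a lower bound on the fields and an upper bound on the total
  influences already bound the slope of the drift. The first event is increasing and the second
  decreasing, hence each is least likely from one of the two extreme graphs, and from these the
  moments have the product form p^|S| at time 0. The scale sqrt n comes from gradients with maximum
  a = O(1/n) and sum b = O(1): l^2 a b stays bounded for l = sqrt n. The resulting probability
  exp(-c sqrt n) beats the factor M^2, one M from the union bound over edges and one from the
  accumulation of errors over the contraction time M/(1-\<kappa>).\<close>

lemma prod_of_bool:
  "finite A \<Longrightarrow> (\<Prod>a\<in>A. of_bool (P a)) = (of_bool (\<forall>a\<in>A. P a) :: real)"
  by (induction A rule: finite_induct) auto

text \<open>For negative \<open>d\<close> the claim is multiplied by \<open>exp (- d)\<close>, which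
  its quadratic Taylor polynomial bounds below; the product of the two polynomials is at least
  1.\<close>

lemma exp_le_quadratic:
  fixes d :: real
  assumes "\<bar>d\<bar> \<le> 1"
  shows "exp d \<le> 1 + d + d\<^sup>2"
proof (cases "d \<ge> 0")
  case True
  then show ?thesis
    using exp_bound assms by simp
next
  case False
  have "1 - d + d\<^sup>2 / 2 \<le> exp (- d)"
    using exp_lower_Taylor_quadratic[of "-d"] False by simp
  moreover have "(1 + d + d\<^sup>2) * (1 - d + d\<^sup>2 / 2) = 1 + (d\<^sup>2 / 2) * (1 - d + d\<^sup>2)"
    by (simp add: field_simps power2_eq_square)
  moreover have "1 + d + d\<^sup>2 \<ge> 0" "(d\<^sup>2 / 2) * (1 - d + d\<^sup>2) \<ge> 0"
    using assms False by (auto intro!: add_nonneg_nonneg mult_nonneg_nonneg)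
  ultimately have "1 \<le> (1 + d + d\<^sup>2) * exp (- d)"
    by (smt (verit) mult_left_mono)
  then show ?thesis
    by (simp add: exp_minus field_simps)
qed

text \<open>Log-convexity makes the ratios \<open>B (Suc k) / B k\<close> nondecreasing, so the
  first one is the smallest. The use is in reverse: fast decay of \<open>B\<close> in the long run
  forces the first ratio to be small.\<close>

lemma log_convex_growth:
  fixes B :: "nat \<Rightarrow> real"
  assumes B: "\<And>k. (B (Suc k))\<^sup>2 \<le> B k * B (Suc (Suc k))" "0 < B 0" "0 < B 1"
    and nonneg: "\<And>k. 0 \<le> B k"
  shows "(B 1 / B 0) ^ k * B 0 \<le> B k"
proof -
  have pos: "0 < B k \<and> 0 < B (Suc k)" for k
  proof (induction k)
    case (Suc k)
    then have "0 < B k * B (Suc (Suc k))"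
      using B(1)[of k] by (meson less_le_trans zero_less_power)
    then show ?case
      using Suc by (simp add: zero_less_mult_iff)
  qed (use B in simp)
  have ratio: "B 1 / B 0 \<le> B (Suc k) / B k" for k
  proof (induction k)
    case (Suc k)
    have "B (Suc k) / B k \<le> B (Suc (Suc k)) / B (Suc k)"
      using B(1)[of k] pos[of k] by (simp add: field_simps power2_eq_square)
    with Suc show ?case
      by linarith
  qed simp
  show ?thesis
  proof (induction k)
    case (Suc k)
    have "(B 1 / B 0) ^ Suc k * B 0 \<le> (B 1 / B 0) * B k"
      unfolding power_Suc mult.assoc using Suc B by (intro mult_left_mono) auto
    also have "\<dots> \<le> (B (Suc k) / B k) * B k"
      using ratio pos[of k] by (intro mult_right_mono) (auto intro: less_imp_le)
    finally show ?case
      using pos[of k] by simp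
  qed simp
qed

lemma bounded_powers_le_1:
  fixes q C :: real
  assumes "\<And>j. q ^ j \<le> C"
  shows "q \<le> 1"
proof (rule ccontr)
  assume "\<not> q \<le> 1"
  then obtain j where "C < q ^ j"
    using real_arch_pow[of q C] by auto
  with assms[of j] show False
    by linarith
qed

text \<open>Measures how far p_(t+1)^|S| is from the linear recursion that the moments obey. Both
  points stay in [0,1], so the constant is uniform in them.\<close>

lemma power_first_order_error:
  fixes p d :: real
  assumes "0 \<le> p" "p \<le> 1" "0 \<le> p + d" "p + d \<le> 1"
  shows "\<bar>(p + d) ^ k - p ^ k - real k * p ^ (k - 1) * d\<bar> \<le> (real k)\<^sup>2 * d\<^sup>2"
proof (induction k)
  case (Suc k)
  have "(p + d) ^ Suc k - p ^ Suc k - real (Suc k) * p ^ k * d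
      = (p + d) * ((p + d) ^ k - p ^ k - real k * p ^ (k - 1) * d) + real k * p ^ (k - 1) * d\<^sup>2"
  proof -
    have "real k * p ^ k = real k * p ^ (k - 1) * p"
      by (cases k) auto
    moreover have "(p + d) * Z - p * Y - (1 + real k) * Y * d
        = (p + d) * (Z - Y - real k * X * d) + real k * X * d\<^sup>2"
      if "real k * Y = real k * X * p" for X Y Z
      using that by algebra
    ultimately show ?thesis
      unfolding power_Suc of_nat_Suc by blast
  qed
  also have "\<bar>\<dots>\<bar> \<le> 1 * ((real k)\<^sup>2 * d\<^sup>2) + real k * 1 * d\<^sup>2"
  proof (intro order_trans[OF abs_triangle_ineq] add_mono)
    show "\<bar>(p + d) * ((p + d) ^ k - p ^ k - real k * p ^ (k - 1) * d)\<bar> \<le> 1 * ((real k)\<^sup>2 * d\<^sup>2)"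
      unfolding abs_mult[of "p + d"] using assms Suc by (intro mult_mono) auto
    have "p ^ (k - 1) \<le> 1" "0 \<le> p ^ (k - 1)"
      using assms by (auto intro: power_le_one)
    then show "\<bar>real k * p ^ (k - 1) * d\<^sup>2\<bar> \<le> real k * 1 * d\<^sup>2"
      unfolding abs_mult by (intro mult_mono) auto
  qed
  also have "\<dots> = ((real k)\<^sup>2 + real k) * d\<^sup>2"
    by (simp add: algebra_simps)
  also have "\<dots> \<le> (real (Suc k))\<^sup>2 * d\<^sup>2"
    by (intro mult_right_mono) (auto simp: power2_eq_square algebra_simps)
  finally show ?case
    by simp
qed simp

lemma card_pinned_PiE:
  fixes F :: "'a \<Rightarrow> nat set"
  assumes "D \<subseteq> V" "finite V" "\<And>v. v \<in> V - D \<Longrightarrow> F v = {1..n}"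
  shows "card (Pi\<^sub>E V F) = (\<Prod>v\<in>D. card (F v)) * n ^ (card V - card D)"
proof -
  have "card (Pi\<^sub>E V F) = (\<Prod>v\<in>V. card (F v))"
    using assms by (simp add: card_PiE)
  also have "\<dots> = (\<Prod>v\<in>V - D. card (F v)) * (\<Prod>v\<in>D. card (F v))"
    by (rule prod.subset_diff[OF assms(1,2)])
  also have "(\<Prod>v\<in>V - D. card (F v)) = n ^ (card V - card D)"
    using assms by (simp add: card_Diff_subset finite_subset)
  finally show ?thesis
    by (simp add: mult.commute)
qed

section \<open>The logistic function\<close>

lemma logistic_pos: "0 < logistic u" and logistic_less_1: "logistic u < 1"
proof -
  have "0 < 1 + exp u"
    by (simp add: add_pos_pos)
  then show "0 < logistic u" "logistic u < 1"
    unfolding logistic_def by (simp_all add: divide_less_eq)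
qed

lemma logistic_deriv: "(logistic has_real_derivative logistic u * (1 - logistic u)) (at u)"
proof -
  have nz: "1 + exp u \<noteq> 0"
    using exp_gt_zero[of u] by linarith
  have "((\<lambda>u. exp u / (1 + exp u)) has_real_derivative
      (exp u * (1 + exp u) - exp u * exp u) / ((1 + exp u) * (1 + exp u))) (at u)"
    using nz by (auto intro!: derivative_eq_intros)
  moreover have "(exp u * (1 + exp u) - exp u * exp u) / ((1 + exp u) * (1 + exp u))
      = logistic u * (1 - logistic u)"
    using nz unfolding logistic_def by (simp add: field_simps)
  ultimately show ?thesis
    by (simp add: logistic_def[abs_def])
qed

lemma logistic_mono: "u \<le> v \<Longrightarrow> logistic u \<le> logistic v"
  by (rule DERIV_nonneg_imp_nondecreasing[of u v])
    (use logistic_deriv logistic_pos logistic_less_1 in \<open>auto intro!: exI mult_nonneg_nonneg less_imp_le\<close>)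

lemma logistic_MVT:
  assumes "u < v"
  shows "\<exists>z>u. z < v \<and> logistic v - logistic u = (v - u) * (logistic z * (1 - logistic z))"
  using MVT2[of u v logistic "\<lambda>u. logistic u * (1 - logistic u)"] assms logistic_deriv by blast

lemma logistic_slope_le_1: "logistic u * (1 - logistic u) \<le> 1"
  using logistic_pos[of u] logistic_less_1[of u] by (intro mult_le_one) auto

lemma logistic_lipschitz: "\<bar>logistic u - logistic v\<bar> \<le> \<bar>u - v\<bar>"
proof -
  have le: "logistic v - logistic u \<le> v - u" if uv: "u < v" for u v
  proof -
    obtain z where z: "logistic v - logistic u = (v - u) * (logistic z * (1 - logistic z))"
      using logistic_MVT[OF uv] by blast
    have "(v - u) * (logistic z * (1 - logistic z)) \<le> (v - u) * 1"
      using uv logistic_slope_le_1 by (intro mult_left_mono) auto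
    then show ?thesis
      using z by simp
  qed
  show ?thesis
    using le[of u v] le[of v u] logistic_mono[of u v] logistic_mono[of v u]
    by (cases u v rule: linorder_cases) auto
qed

text \<open>To the right of 0 the values are at least 1/2, where z (1 - z) decreases in z, so the
  slope at \<open>a\<close> dominates every slope further right.\<close>

lemma logistic_concave:
  assumes "0 \<le> a" "a \<le> u" "u \<le> v"
  shows "logistic v - logistic u \<le> logistic a * (1 - logistic a) * (v - u)"
proof (cases "u = v")
  case False
  then obtain z where z: "u < z" "logistic v - logistic u = (v - u) * (logistic z * (1 - logistic z))"
    using assms logistic_MVT[of u v] by auto
  have half: "1 / 2 \<le> logistic a"
    using logistic_mono[OF assms(1)] by (simp add: logistic_def)
  have "logistic a \<le> logistic z"
    using z assms by (intro logistic_mono) auto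
  \<comment> \<open>The product equals the slope at \<open>a\<close> minus the slope at
    \<open>z\<close>.\<close>
  then have "0 \<le> (logistic z - logistic a) * (logistic z + logistic a - 1)"
    using half by (intro mult_nonneg_nonneg) auto
  then have "logistic z * (1 - logistic z) \<le> logistic a * (1 - logistic a)"
    by (simp add: algebra_simps)
  then show ?thesis
    unfolding z(2) using assms by (simp add: mult.commute mult_left_mono)
qed simp

section \<open>Heat bath dynamics\<close>

text \<open>\<open>r e x\<close> is the probability that \<open>e\<close> is present after being
  resampled. \<open>r_insert\<close> says that it depends on the other coordinates only, and
  \<open>r_mono\<close> is attractiveness.\<close>

locale heat_bath =
  fixes E :: "'e set" and r :: "'e \<Rightarrow> 'e set \<Rightarrow> real"
  assumes finite_E: "finite E" and E_nonempty: "E \<noteq> {}"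
    and r_nonneg: "0 \<le> r e x" and r_le_1: "r e x \<le> 1"
    and r_insert: "r e (insert e x) = r e x"
    and r_mono: "e \<in> E \<Longrightarrow> x \<subseteq> y \<Longrightarrow> y \<subseteq> E \<Longrightarrow> r e x \<le> r e y"
begin

abbreviation M :: real where "M \<equiv> real (card E)"

lemma M_ge_1: "M \<ge> 1"
  using finite_E E_nonempty by (simp add: Suc_leI card_gt_0_iff)

lemma M_pos: "M > 0"
  using M_ge_1 by linarith

lemma r_remove: "r e (x - {e}) = r e x"
  by (metis insert_Diff_single r_insert)

definition step :: "('e set \<Rightarrow> real) \<Rightarrow> 'e set \<Rightarrow> real" where
  "step f x = (\<Sum>e\<in>E. r e x * f (insert e x) + (1 - r e x) * f (x - {e})) / M"

abbreviation iter :: "nat \<Rightarrow> ('e set \<Rightarrow> real) \<Rightarrow> 'e set \<Rightarrow> real" where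
  "iter t \<equiv> step ^^ t"

lemma iter_Suc: "iter (Suc t) f = iter t (step f)"
  by (simp add: funpow_swap1)

lemma step_mono:
  assumes "\<And>x. x \<subseteq> E \<Longrightarrow> f x \<le> g x" "x \<subseteq> E"
  shows "step f x \<le> step g x"
  unfolding step_def using assms M_pos r_nonneg r_le_1
  by (intro divide_right_mono sum_mono add_mono mult_left_mono) (auto simp: subset_iff)

lemma iter_mono:
  assumes "\<And>x. x \<subseteq> E \<Longrightarrow> f x \<le> g x" "x \<subseteq> E"
  shows "iter t f x \<le> iter t g x"
  using assms(2) by (induction t arbitrary: x) (auto intro: assms(1) step_mono)

lemma iter_cong:
  assumes "\<And>x. x \<subseteq> E \<Longrightarrow> f x = g x" "x \<subseteq> E"
  shows "iter t f x = iter t g x"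
  using iter_mono[of f g x t] iter_mono[of g f x t] assms by force

lemma step_add: "step (\<lambda>x. f x + g x) = (\<lambda>x. step f x + step g x)"
  unfolding step_def by (simp add: algebra_simps sum.distrib add_divide_distrib sum_subtractf
      diff_divide_distrib fun_eq_iff)

lemma step_cmult: "step (\<lambda>x. c * f x) = (\<lambda>x. c * step f x)"
  unfolding step_def by (simp add: algebra_simps sum_distrib_left fun_eq_iff)

lemma step_const: "step (\<lambda>x. c) = (\<lambda>x. c)"
  unfolding step_def using M_pos by (simp add: algebra_simps fun_eq_iff)

lemma iter_add: "iter t (\<lambda>x. f x + g x) = (\<lambda>x. iter t f x + iter t g x)"
  by (induction t) (auto simp: step_add)

lemma iter_cmult: "iter t (\<lambda>x. c * f x) = (\<lambda>x. c * iter t f x)"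
  by (induction t) (auto simp: step_cmult)

lemma iter_divide: "iter t (\<lambda>x. f x / c) = (\<lambda>x. iter t f x / c)"
  using iter_cmult[of t "1 / c" f] by simp

lemma iter_const: "iter t (\<lambda>x. c) = (\<lambda>x. c)"
  by (induction t) (auto simp: step_const)

lemma iter_diff: "iter t (\<lambda>x. f x - g x) = (\<lambda>x. iter t f x - iter t g x)"
  using iter_add[of t f "\<lambda>x. (-1) * g x"] iter_cmult[of t "-1" g] by simp

lemma iter_sum: "iter t (\<lambda>x. \<Sum>i\<in>I. f i x) = (\<lambda>x. \<Sum>i\<in>I. iter t (f i) x)"
proof (cases "finite I")
  case True
  then show ?thesis
    by (induction I rule: finite_induct) (auto simp: iter_const iter_add)
qed (simp add: iter_const)

lemma iter_nonneg:
  assumes "\<And>x. x \<subseteq> E \<Longrightarrow> 0 \<le> f x" "x \<subseteq> E"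
  shows "0 \<le> iter t f x"
  using iter_mono[of "\<lambda>x. 0" f x t] assms by (simp add: iter_const)

lemma iter_abs_le:
  assumes "\<And>x. x \<subseteq> E \<Longrightarrow> \<bar>f x\<bar> \<le> g x" "x \<subseteq> E"
  shows "\<bar>iter t f x\<bar> \<le> iter t g x"
proof -
  have 1: "f x \<le> g x" "(-1) * f x \<le> g x" if "x \<subseteq> E" for x
    using assms(1)[OF that] by auto
  have "iter t f x \<le> iter t g x"
    using 1(1) assms(2) by (rule iter_mono)
  moreover have "iter t (\<lambda>x. (-1) * f x) x \<le> iter t g x"
    using 1(2) assms(2) by (rule iter_mono)
  ultimately show ?thesis
    unfolding iter_cmult by linarith
qed

section \<open>Monotone functions and moment recursions\<close>

definition increasing :: "('e set \<Rightarrow> real) \<Rightarrow> bool" where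
  "increasing f \<longleftrightarrow> (\<forall>x y. x \<subseteq> y \<longrightarrow> y \<subseteq> E \<longrightarrow> f x \<le> f y)"

text \<open>For each chosen edge the passage from \<open>x\<close> to \<open>y\<close> is made in
  two moves: the arguments of \<open>f\<close> grow with the weight \<open>r e x\<close> kept, then
  the weight grows, which favours the larger of the two values.\<close>

lemma increasing_step:
  assumes f: "increasing f"
  shows "increasing (step f)"
  unfolding increasing_def
proof (intro allI impI)
  fix x y assume xy: "x \<subseteq> y" "y \<subseteq> E"
  have "r e x * f (insert e x) + (1 - r e x) * f (x - {e})
      \<le> r e y * f (insert e y) + (1 - r e y) * f (y - {e})" if e: "e \<in> E" for e
  proof -
    have "insert e x \<subseteq> insert e y" "insert e y \<subseteq> E" "x - {e} \<subseteq> y - {e}" "y - {e} \<subseteq> E"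
        "y - {e} \<subseteq> insert e y"
      using xy e by auto
    then have "f (insert e x) \<le> f (insert e y)" "f (x - {e}) \<le> f (y - {e})"
        "f (y - {e}) \<le> f (insert e y)"
      using f unfolding increasing_def by blast+
    moreover have "r e x \<le> r e y"
      using r_mono xy e by blast
    ultimately have "r e x * f (insert e x) + (1 - r e x) * f (x - {e})
        \<le> r e x * f (insert e y) + (1 - r e x) * f (y - {e})"
      using r_nonneg[of e x] r_le_1[of e x] by (intro add_mono mult_left_mono) auto
    also have "\<dots> = f (y - {e}) + r e x * (f (insert e y) - f (y - {e}))"
      by (simp add: algebra_simps)
    also have "\<dots> \<le> f (y - {e}) + r e y * (f (insert e y) - f (y - {e}))"
      using \<open>r e x \<le> r e y\<close> \<open>f (y - {e}) \<le> f (insert e y)\<close>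
      by (intro add_left_mono mult_right_mono) auto
    finally show ?thesis
      by (simp add: algebra_simps)
  qed
  then show "step f x \<le> step f y"
    unfolding step_def using M_pos by (intro divide_right_mono sum_mono) auto
qed

lemma increasing_iter: "increasing f \<Longrightarrow> increasing (iter t f)"
  by (induction t) (auto intro: increasing_step)

text \<open>Choosing an edge outside \<open>S\<close> leaves the event alone; choosing
  \<open>e\<close> in \<open>S\<close> makes it hold with probability \<open>r e x\<close> if the
  rest of \<open>S\<close> is present. The factor \<open>r e x\<close> inside the expectation keeps
  the system from closing, until it is replaced by a constant.\<close>

lemma iter_indicator_subset_Suc:
  assumes S: "S \<subseteq> E"
  shows "iter (Suc t) (\<lambda>x. of_bool (S \<subseteq> x)) x =
    (1 - card S / M) * iter t (\<lambda>x. of_bool (S \<subseteq> x)) x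
    + (\<Sum>e\<in>S. iter t (\<lambda>x. r e x * of_bool (S - {e} \<subseteq> x)) x) / M"
proof -
  have fin: "finite S"
    using S finite_E finite_subset by blast
  have "step (\<lambda>x. of_bool (S \<subseteq> x)) x =
      (1 - card S / M) * of_bool (S \<subseteq> x) + (1 / M) * (\<Sum>e\<in>S. r e x * of_bool (S - {e} \<subseteq> x))" for x
  proof -
    let ?g = "\<lambda>e. r e x * of_bool (S \<subseteq> insert e x) + (1 - r e x) * of_bool (S \<subseteq> x - {e})"
    have "(\<Sum>e\<in>E. ?g e) = (\<Sum>e\<in>E - S. ?g e) + (\<Sum>e\<in>S. ?g e)"
      using sum.subset_diff[OF S finite_E] by blast
    also have "(\<Sum>e\<in>S. ?g e) = (\<Sum>e\<in>S. r e x * of_bool (S - {e} \<subseteq> x))"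
      by (intro sum.cong) (auto simp: subset_insert_iff)
    also have "(\<Sum>e\<in>E - S. ?g e) = (\<Sum>e\<in>E - S. of_bool (S \<subseteq> x))"
      by (intro sum.cong) auto
    also have "\<dots> = (M - card S) * of_bool (S \<subseteq> x)"
      using S fin finite_E card_mono[OF finite_E S]
      by (simp add: card_Diff_subset of_nat_diff algebra_simps)
    finally show ?thesis
      unfolding step_def using M_pos by (simp add: field_simps)
  qed
  then have "step (\<lambda>x. of_bool (S \<subseteq> x)) = (\<lambda>x. (1 - card S / M) * of_bool (S \<subseteq> x)
      + (1 / M) * (\<Sum>e\<in>S. r e x * of_bool (S - {e} \<subseteq> x)))"
    by blast
  then show ?thesis
    by (simp add: iter_Suc iter_add iter_cmult iter_divide iter_sum del: funpow.simps)
qed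

text \<open>The configuration enters the drift of \<open>card\<close> only through the sum of the
  resampling probabilities, so gradients of later iterates are governed by increments of that
  sum.\<close>

lemma step_card:
  assumes "x \<subseteq> E"
  shows "step (\<lambda>x. real (card x)) x = (1 - 1 / M) * card x + (1 / M) * (\<Sum>e\<in>E. r e x)"
proof -
  have fin: "finite x"
    using assms finite_E finite_subset by blast
  have "r e x * real (card (insert e x)) + (1 - r e x) * real (card (x - {e}))
      = real (card x) - of_bool (e \<in> x) + r e x" for e
  proof (cases "e \<in> x")
    case True
    have *: "real (card (x - {e})) = real (card x) - 1"
      using card_Suc_Diff1[OF fin True] by linarith
    show ?thesis
      unfolding insert_absorb[OF True] * using True by (simp add: algebra_simps)
  qed (use fin in \<open>simp add: algebra_simps\<close>)
  moreover have "(\<Sum>e\<in>E. of_bool (e \<in> x)) = real (card x)"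
    using assms finite_E by (simp add: sum.If_cases of_bool_def Int_absorb1)
  ultimately have "(\<Sum>e\<in>E. r e x * real (card (insert e x)) + (1 - r e x) * real (card (x - {e})))
      = M * card x - card x + (\<Sum>e\<in>E. r e x)"
    by (simp add: sum.distrib sum_subtractf)
  then show ?thesis
    unfolding step_def using M_pos by (simp add: field_simps)
qed

end

section \<open>Influence bounds, Lipschitz functions and exponential moments\<close>

text \<open>\<open>A e' e\<close> bounds the influence of the coordinate \<open>e\<close> on the resampling law of \<open>e'\<close>.\<close>

locale heat_bath_influence = heat_bath +
  fixes A :: "'a \<Rightarrow> 'a \<Rightarrow> real" and c :: real
  assumes A_nonneg: "0 \<le> A e' e"
    and r_influence: "e' \<in> E \<Longrightarrow> e \<in> E \<Longrightarrow> x \<subseteq> E \<Longrightarrow>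
      \<bar>r e' (insert e x) - r e' (x - {e})\<bar> \<le> A e' e"
    and A_row: "e' \<in> E \<Longrightarrow> (\<Sum>e\<in>E. A e' e) \<le> c"
    and A_col: "e \<in> E \<Longrightarrow> (\<Sum>e'\<in>E. A e' e) \<le> c"
begin

lemma c_nonneg: "0 \<le> c"
  using A_row E_nonempty A_nonneg by (meson all_not_in_conv order_trans sum_nonneg)

text \<open>\<open>L e\<close> bounds the gradient in direction \<open>e\<close>. Maximum and sum
  are both carried because the variance proxy is their product; column sums of \<open>A\<close>
  propagate the maximum and row sums the total.\<close>

definition lip_bounded :: "('a set \<Rightarrow> real) \<Rightarrow> real \<Rightarrow> real \<Rightarrow> bool" where
  "lip_bounded f a b \<longleftrightarrow> (\<exists>L. (\<forall>e\<in>E. 0 \<le> L e \<and> L e \<le> a) \<and> (\<Sum>e\<in>E. L e) \<le> b \<and>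
     (\<forall>x e. x \<subseteq> E \<longrightarrow> e \<in> E \<longrightarrow> \<bar>f (insert e x) - f (x - {e})\<bar> \<le> L e))"

lemma lip_bounded_nonneg:
  assumes "lip_bounded f a b"
  shows "0 \<le> a" "0 \<le> b"
proof -
  obtain L where L: "\<forall>e\<in>E. 0 \<le> L e \<and> L e \<le> a" "(\<Sum>e\<in>E. L e) \<le> b"
    using assms unfolding lip_bounded_def by blast
  obtain e where "e \<in> E"
    using E_nonempty by blast
  then show "0 \<le> a"
    using L by force
  show "0 \<le> b"
    using L sum_nonneg[of E L] by force
qed

lemma lip_bounded_cmult:
  assumes "lip_bounded f a b"
  shows "lip_bounded (\<lambda>x. k * f x) (\<bar>k\<bar> * a) (\<bar>k\<bar> * b)"
proof -
  obtain L where L: "\<forall>e\<in>E. 0 \<le> L e \<and> L e \<le> a" "(\<Sum>e\<in>E. L e) \<le> b"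
      "\<And>x e. x \<subseteq> E \<Longrightarrow> e \<in> E \<Longrightarrow> \<bar>f (insert e x) - f (x - {e})\<bar> \<le> L e"
    using assms unfolding lip_bounded_def by blast
  have "\<bar>k * f (insert e x) - k * f (x - {e})\<bar> \<le> \<bar>k\<bar> * L e" if "x \<subseteq> E" "e \<in> E" for x e
    using L(3)[OF that] by (simp add: right_diff_distrib[symmetric] abs_mult mult_left_mono)
  then show ?thesis
    unfolding lip_bounded_def using L(1,2)
    by (intro exI[of _ "\<lambda>e. \<bar>k\<bar> * L e"]) (auto simp: mult_left_mono sum_distrib_left[symmetric])
qed

lemma lip_bounded_sum:
  assumes "finite I" "\<And>i. i \<in> I \<Longrightarrow> lip_bounded (f i) (a i) (b i)"
  shows "lip_bounded (\<lambda>x. \<Sum>i\<in>I. f i x) (\<Sum>i\<in>I. a i) (\<Sum>i\<in>I. b i)"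
proof -
  obtain L where L: "\<And>i e. i \<in> I \<Longrightarrow> e \<in> E \<Longrightarrow> 0 \<le> L i e \<and> L i e \<le> a i"
      "\<And>i. i \<in> I \<Longrightarrow> (\<Sum>e\<in>E. L i e) \<le> b i"
      "\<And>i x e. i \<in> I \<Longrightarrow> x \<subseteq> E \<Longrightarrow> e \<in> E \<Longrightarrow> \<bar>f i (insert e x) - f i (x - {e})\<bar> \<le> L i e"
    using assms(2) unfolding lip_bounded_def by metis
  have "(\<Sum>e\<in>E. \<Sum>i\<in>I. L i e) = (\<Sum>i\<in>I. \<Sum>e\<in>E. L i e)"
    by (rule sum.swap)
  also have "\<dots> \<le> (\<Sum>i\<in>I. b i)"
    using L(2) by (intro sum_mono)
  finally have 1: "(\<Sum>e\<in>E. \<Sum>i\<in>I. L i e) \<le> (\<Sum>i\<in>I. b i)" .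
  have 2: "\<bar>(\<Sum>i\<in>I. f i (insert e x)) - (\<Sum>i\<in>I. f i (x - {e}))\<bar> \<le> (\<Sum>i\<in>I. L i e)"
    if "x \<subseteq> E" "e \<in> E" for x e
    unfolding sum_subtractf[symmetric]
    by (rule order_trans[OF sum_abs]) (use L(3) that in \<open>auto intro: sum_mono\<close>)
  show ?thesis
    unfolding lip_bounded_def using L(1) 1 2
    by (intro exI[of _ "\<lambda>e. \<Sum>i\<in>I. L i e"]) (auto intro: sum_nonneg sum_mono)
qed

lemma lip_bounded_mono: "lip_bounded f a b \<Longrightarrow> a \<le> a' \<Longrightarrow> b \<le> b' \<Longrightarrow> lip_bounded f a' b'"
  unfolding lip_bounded_def by (meson order_trans)

text \<open>When \<open>e'\<close> is resampled from two configurations that differ at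
  \<open>e\<close>, the outcomes differ by an average of gradients in direction \<open>e\<close>,
  plus the change of the resampling probability, at most \<open>A e' e\<close>, times a gradient in
  direction \<open>e'\<close>.\<close>

lemma lip_bounded_step:
  assumes "lip_bounded f a b"
  shows "lip_bounded (step f) ((1 + c / M) * a) ((1 + c / M) * b)"
proof -
  obtain L where L: "\<And>e. e \<in> E \<Longrightarrow> 0 \<le> L e" "\<And>e. e \<in> E \<Longrightarrow> L e \<le> a" "(\<Sum>e\<in>E. L e) \<le> b"
      "\<And>x e. x \<subseteq> E \<Longrightarrow> e \<in> E \<Longrightarrow> \<bar>f (insert e x) - f (x - {e})\<bar> \<le> L e"
    using assms unfolding lip_bounded_def by blast
  note ab = lip_bounded_nonneg[OF assms]
  let ?L = "\<lambda>e. L e + (\<Sum>e'\<in>E. A e' e * L e') / M"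
  have S0: "0 \<le> (\<Sum>e'\<in>E. A e' e * L e')" for e
    using L(1) A_nonneg by (intro sum_nonneg) auto
  have S1: "(\<Sum>e'\<in>E. A e' e * L e') \<le> c * a" if "e \<in> E" for e
  proof -
    have "(\<Sum>e'\<in>E. A e' e * L e') \<le> (\<Sum>e'\<in>E. A e' e * a)"
      using L(2) A_nonneg by (intro sum_mono mult_left_mono) auto
    also have "\<dots> \<le> c * a"
      using A_col[OF that] ab by (simp add: sum_distrib_right[symmetric] mult_right_mono)
    finally show ?thesis .
  qed
  have 1: "0 \<le> ?L e \<and> ?L e \<le> (1 + c / M) * a" if "e \<in> E" for e
  proof -
    have "(\<Sum>e'\<in>E. A e' e * L e') / M \<le> c * a / M"
      using S1[OF that] M_pos by (intro divide_right_mono) auto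
    then show ?thesis
      using divide_nonneg_pos[OF S0[of e] M_pos] L(1,2)[OF that]
      by (simp add: distrib_right)
  qed
  have "(\<Sum>e\<in>E. \<Sum>e'\<in>E. A e' e * L e') = (\<Sum>e'\<in>E. (\<Sum>e\<in>E. A e' e) * L e')"
    by (subst sum.swap) (simp add: sum_distrib_right)
  also have "\<dots> \<le> (\<Sum>e'\<in>E. c * L e')"
    using A_row L(1) by (intro sum_mono mult_right_mono) auto
  also have "\<dots> \<le> c * b"
    using L(3) c_nonneg by (simp add: sum_distrib_left[symmetric] mult_left_mono)
  finally have "(\<Sum>e\<in>E. \<Sum>e'\<in>E. A e' e * L e') / M \<le> c * b / M"
    using M_pos by (intro divide_right_mono) auto
  then have 2: "(\<Sum>e\<in>E. ?L e) \<le> (1 + c / M) * b"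
    using L(3) by (simp add: sum.distrib sum_divide_distrib[symmetric] algebra_simps)
  have 3: "\<bar>step f (insert e x) - step f (x - {e})\<bar> \<le> ?L e" if x: "x \<subseteq> E" and e: "e \<in> E" for x e
  proof -
    let ?y = "insert e x" and ?z = "x - {e}"
    let ?t = "\<lambda>e' x. r e' x * f (insert e' x) + (1 - r e' x) * f (x - {e'})"
    have "\<bar>?t e' ?y - ?t e' ?z\<bar> \<le> L e + A e' e * L e'" if e': "e' \<in> E" for e'
    proof (cases "e' = e")
      case True
      \<comment> \<open>Resampling \<open>e\<close> itself erases the discrepancy; the bound
        \<open>L e\<close> is kept all the same, so only growth by 1 + c / M is claimed.\<close>
      have "?t e ?y = ?t e ?z"
        by (simp add: r_insert r_remove)
      then show ?thesis
        using True L(1)[OF e] A_nonneg by simp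
    next
      case False
      have c1: "insert e' ?y = insert e (insert e' x)" "insert e' ?z = insert e' x - {e}"
          "?y - {e'} = insert e (x - {e'})" "?z - {e'} = (x - {e'}) - {e}"
        using False by auto
      have d1: "\<bar>f (insert e' ?y) - f (insert e' ?z)\<bar> \<le> L e"
        unfolding c1 using x e e' by (intro L(4)) auto
      have d2: "\<bar>f (?y - {e'}) - f (?z - {e'})\<bar> \<le> L e"
        unfolding c1 using x e e' by (intro L(4)) auto
      have d3: "\<bar>f (insert e' ?z) - f (?z - {e'})\<bar> \<le> L e'"
        using x e' by (intro L(4)) auto
      have d4: "\<bar>r e' ?y - r e' ?z\<bar> \<le> A e' e"
        using r_influence[OF e' e x] .
      have "?t e' ?y - ?t e' ?z = r e' ?y * (f (insert e' ?y) - f (insert e' ?z))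
          + (1 - r e' ?y) * (f (?y - {e'}) - f (?z - {e'}))
          + (r e' ?y - r e' ?z) * (f (insert e' ?z) - f (?z - {e'}))"
        by (simp only: algebra_simps)
      also have "\<bar>\<dots>\<bar> \<le> r e' ?y * L e + (1 - r e' ?y) * L e + A e' e * L e'"
      proof -
        have "\<bar>r e' ?y * (f (insert e' ?y) - f (insert e' ?z))\<bar> \<le> r e' ?y * L e"
          using d1 r_nonneg by (simp add: abs_mult mult_left_mono)
        moreover have "\<bar>(1 - r e' ?y) * (f (?y - {e'}) - f (?z - {e'}))\<bar> \<le> (1 - r e' ?y) * L e"
          using d2 r_le_1[of e' ?y] by (simp add: abs_mult mult_left_mono)
        moreover have "\<bar>(r e' ?y - r e' ?z) * (f (insert e' ?z) - f (?z - {e'}))\<bar> \<le> A e' e * L e'"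
          unfolding abs_mult using d3 d4 A_nonneg by (intro mult_mono) auto
        ultimately show ?thesis
          by linarith
      qed
      finally show ?thesis
        by (simp add: algebra_simps)
    qed
    then have "\<bar>\<Sum>e'\<in>E. ?t e' ?y - ?t e' ?z\<bar> \<le> (\<Sum>e'\<in>E. L e + A e' e * L e')"
      by (intro order_trans[OF sum_abs] sum_mono)
    then have "\<bar>(\<Sum>e'\<in>E. ?t e' ?y - ?t e' ?z) / M\<bar> \<le> (M * L e + (\<Sum>e'\<in>E. A e' e * L e')) / M"
      using M_pos by (simp add: sum.distrib divide_right_mono)
    then show ?thesis
      unfolding step_def using M_pos
      by (simp only: diff_divide_distrib[symmetric] sum_subtractf[symmetric])
        (simp add: add_divide_distrib)
  qed
  show ?thesis
    unfolding lip_bounded_def by (rule exI[of _ ?L]) (use 1 2 3 in blast)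
qed

lemma lip_bounded_iter:
  assumes "lip_bounded f a b"
  shows "lip_bounded (iter t f) ((1 + c / M) ^ t * a) ((1 + c / M) ^ t * b)"
  by (induction t) (use assms lip_bounded_step in \<open>auto simp: mult.assoc\<close>)

text \<open>By \<open>exp_le_quadratic\<close> the second-order term of an increment along
  \<open>e\<close> is at most \<open>a * L e\<close>, and these sum to at most \<open>a * b\<close>.
  The first-order terms reproduce \<open>step g\<close> exactly.\<close>

lemma step_exp_le:
  assumes "lip_bounded g a b" "a \<le> 1" "x \<subseteq> E"
  shows "step (\<lambda>x. exp (g x)) x \<le> exp (step g x + a * b / M)"
proof -
  obtain L where L: "\<And>e. e \<in> E \<Longrightarrow> 0 \<le> L e" "\<And>e. e \<in> E \<Longrightarrow> L e \<le> a" "(\<Sum>e\<in>E. L e) \<le> b"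
      "\<And>x e. x \<subseteq> E \<Longrightarrow> e \<in> E \<Longrightarrow> \<bar>g (insert e x) - g (x - {e})\<bar> \<le> L e"
    using assms(1) unfolding lip_bounded_def by blast
  note ab = lip_bounded_nonneg[OF assms(1)]
  have ub: "exp (g y) \<le> exp (g x) * (1 + (g y - g x) + a * L e)"
    if e: "e \<in> E" and y: "y = insert e x \<or> y = x - {e}" for e y
  proof -
    have "\<bar>g y - g x\<bar> \<le> L e"
    proof (cases "e \<in> x")
      case True
      then have *: "insert e x = x" by blast
      show ?thesis
        using y L(4)[OF assms(3) e] L(1)[OF e] unfolding * by (elim disjE) simp_all
    next
      case False
      then have *: "x - {e} = x" by blast
      show ?thesis
        using y L(4)[OF assms(3) e] L(1)[OF e] unfolding * by (elim disjE) simp_all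
    qed
    then have d: "\<bar>g y - g x\<bar> \<le> a" "\<bar>g y - g x\<bar> \<le> L e"
      using L(2)[OF e] by linarith+
    have "\<bar>g y - g x\<bar> * \<bar>g y - g x\<bar> \<le> a * L e"
      using d ab by (intro mult_mono) auto
    then have "(g y - g x)\<^sup>2 \<le> a * L e" "\<bar>g y - g x\<bar> \<le> 1"
      using d(1) assms(2) by (simp_all add: power2_eq_square)
    then have "exp (g y - g x) \<le> 1 + (g y - g x) + a * L e"
      using exp_le_quadratic[of "g y - g x"] by linarith
    then have "exp (g x) * exp (g y - g x) \<le> exp (g x) * (1 + (g y - g x) + a * L e)"
      by (intro mult_left_mono) auto
    then show ?thesis
      by (simp add: exp_add[symmetric])
  qed
  have "step (\<lambda>x. exp (g x)) x \<le> (\<Sum>e\<in>E. r e x * (exp (g x) * (1 + (g (insert e x) - g x) + a * L e))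
      + (1 - r e x) * (exp (g x) * (1 + (g (x - {e}) - g x) + a * L e))) / M"
    unfolding step_def using M_pos r_nonneg r_le_1 ub
    by (intro divide_right_mono sum_mono add_mono mult_left_mono) auto
  also have "\<dots> = exp (g x) * (\<Sum>e\<in>E. (1 - g x) + (r e x * g (insert e x) + (1 - r e x) * g (x - {e})) + a * L e) / M"
    by (simp add: sum_distrib_left algebra_simps)
  also have "\<dots> = exp (g x) * (1 + (step g x - g x) + a * (\<Sum>e\<in>E. L e) / M)"
    unfolding step_def sum.distrib using M_pos
    by (simp add: sum_distrib_left[symmetric] field_simps)
  also have "\<dots> \<le> exp (g x) * (1 + ((step g x - g x) + a * b / M))"
    using L(3) ab M_pos by (auto intro!: divide_right_mono mult_left_mono)
  also have "\<dots> \<le> exp (g x) * exp ((step g x - g x) + a * b / M)"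
    by (intro mult_left_mono exp_ge_add_one_self) auto
  also have "\<dots> = exp (step g x + a * b / M)"
    by (simp add: exp_add[symmetric])
  finally show ?thesis .
qed

text \<open>One step at a time is moved into the exponent, replacing \<open>g\<close> by
  \<open>step g\<close> with gradient bounds larger by 1 + c / M. Each of the \<open>t\<close> moves
  costs at most \<open>a * b / M\<close> times the square of the final growth factor.\<close>

lemma iter_exp_le:
  assumes "lip_bounded g a b" "(1 + c / M) ^ t * a \<le> 1" "x \<subseteq> E"
  shows "iter t (\<lambda>x. exp (g x)) x \<le> exp (iter t g x + real t / M * ((1 + c / M) ^ t)\<^sup>2 * a * b)"
  using assms
proof (induction t arbitrary: g a b)
  case (Suc t)
  let ?q = "1 + c / M"
  have q: "?q \<ge> 1"
    using c_nonneg M_pos by simp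
  note ab = lip_bounded_nonneg[OF Suc.prems(1)]
  have qt: "?q ^ t \<ge> 1"
    using q by (rule one_le_power)
  have "1 * a \<le> ?q ^ Suc t * a"
    using ab one_le_power[OF q, of "Suc t"] by (intro mult_right_mono) auto
  then have a1: "a \<le> 1"
    using Suc.prems by linarith
  have IH: "iter t (\<lambda>x. exp (step g x)) x
      \<le> exp (iter t (step g) x + real t / M * (?q ^ t)\<^sup>2 * (?q * a) * (?q * b))"
    by (rule Suc.IH[OF lip_bounded_step[OF Suc.prems(1)] _ Suc.prems(3)])
       (use Suc.prems(2) in \<open>simp add: mult_ac\<close>)
  have "iter (Suc t) (\<lambda>x. exp (g x)) x = iter t (step (\<lambda>x. exp (g x))) x"
    by (simp add: iter_Suc del: funpow.simps)
  also have "\<dots> \<le> iter t (\<lambda>x. exp (a * b / M) * exp (step g x)) x"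
    by (rule iter_mono)
       (use step_exp_le[OF Suc.prems(1) a1] Suc.prems(3) in \<open>auto simp: exp_add[symmetric] add.commute\<close>)
  also have "\<dots> = exp (a * b / M) * iter t (\<lambda>x. exp (step g x)) x"
    by (simp add: iter_cmult)
  also have "\<dots> \<le> exp (a * b / M) * exp (iter t (step g) x + real t / M * (?q ^ t)\<^sup>2 * (?q * a) * (?q * b))"
    using IH by (intro mult_left_mono) auto
  also have "real t / M * (?q ^ t)\<^sup>2 * (?q * a) * (?q * b) = real t / M * (?q ^ Suc t)\<^sup>2 * a * b"
    unfolding power_Suc power_mult_distrib power2_eq_square by (simp only: mult_ac)
  also have "exp (a * b / M) * exp (iter t (step g) x + real t / M * (?q ^ Suc t)\<^sup>2 * a * b)
      = exp (iter (Suc t) g x + (a * b / M + real t / M * (?q ^ Suc t)\<^sup>2 * a * b))"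
    unfolding iter_Suc exp_add by (simp only: mult_ac)
  also have "\<dots> \<le> exp (iter (Suc t) g x + real (Suc t) / M * (?q ^ Suc t)\<^sup>2 * a * b)"
  proof -
    have "1 * (a * b / M) \<le> (?q ^ Suc t)\<^sup>2 * (a * b / M)"
      using ab M_pos one_le_power[OF q, of "Suc t"] by (intro mult_right_mono) (auto intro: one_le_power)
    then show ?thesis
      by (simp add: add_divide_distrib algebra_simps)
  qed
  finally show ?case .
qed simp

lemma growth_le_exp:
  assumes "real t \<le> K * M"
  shows "(1 + c / M) ^ t \<le> exp (c * K)"
proof -
  have "(1 + c / M) ^ t \<le> exp (c / M) ^ t"
    using exp_ge_add_one_self[of "c / M"] divide_nonneg_pos[OF c_nonneg M_pos]
    by (intro power_mono) linarith+
  also have "\<dots> = exp (real t * (c / M))"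
    by (rule exp_of_nat_mult[symmetric])
  also have "\<dots> \<le> exp (c * K)"
    using mult_left_mono[OF assms c_nonneg] M_pos by (simp add: field_simps)
  finally show ?thesis .
qed

text \<open>Within K M steps every growth factor is at most exp (c K), so the variance proxy is l^2
  a b up to a constant. Either sign of \<open>l\<close> is allowed, which later yields both
  tails.\<close>

lemma concentration:
  assumes f: "lip_bounded f a b" and t: "real t \<le> K * M" and x: "x \<subseteq> E"
    and l: "\<bar>l\<bar> * a * exp (c * K) \<le> 1"
  shows "iter t (\<lambda>y. exp (l * (f y - iter t f x))) x \<le> exp (K * exp (2 * c * K) * (l\<^sup>2 * a * b))"
proof -
  note ab = lip_bounded_nonneg[OF f]
  let ?q = "(1 + c / M) ^ t"
  have q: "?q \<le> exp (c * K)" "0 \<le> ?q"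
    using growth_le_exp[OF t] c_nonneg by simp_all
  have g: "lip_bounded (\<lambda>x. l * f x) (\<bar>l\<bar> * a) (\<bar>l\<bar> * b)"
    by (rule lip_bounded_cmult[OF f])
  have "?q * (\<bar>l\<bar> * a) \<le> exp (c * K) * (\<bar>l\<bar> * a)"
    using q ab by (intro mult_right_mono) auto
  then have "?q * (\<bar>l\<bar> * a) \<le> 1"
    using l by (simp add: mult_ac)
  from iter_exp_le[OF g this x]
  have main: "iter t (\<lambda>x. exp (l * f x)) x \<le> exp (l * iter t f x + real t / M * ?q\<^sup>2 * (\<bar>l\<bar> * a) * (\<bar>l\<bar> * b))"
    by (simp add: iter_cmult)
  have "real t / M * ?q\<^sup>2 \<le> K * (exp (c * K))\<^sup>2"
    using t M_pos q by (intro mult_mono power_mono) (auto simp: field_simps intro: order_trans[of 0 "real t / M"])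
  then have "(real t / M * ?q\<^sup>2) * (l\<^sup>2 * a * b) \<le> K * (exp (c * K))\<^sup>2 * (l\<^sup>2 * a * b)"
    using ab by (intro mult_right_mono) auto
  moreover have "(exp (c * K))\<^sup>2 = exp (2 * c * K)"
    by (simp add: exp_double[symmetric] mult.assoc)
  moreover have "real t / M * ?q\<^sup>2 * (\<bar>l\<bar> * a) * (\<bar>l\<bar> * b) = (real t / M * ?q\<^sup>2) * (l\<^sup>2 * a * b)"
    unfolding power2_eq_square[of l] abs_mult_self_eq[of l, symmetric] by (simp only: mult_ac)
  ultimately have "l * iter t f x + real t / M * ?q\<^sup>2 * (\<bar>l\<bar> * a) * (\<bar>l\<bar> * b)
      \<le> l * iter t f x + K * exp (2 * c * K) * (l\<^sup>2 * a * b)"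
    by (simp only: add_le_cancel_left)
  then have "iter t (\<lambda>x. exp (l * f x)) x \<le> exp (l * iter t f x + K * exp (2 * c * K) * (l\<^sup>2 * a * b))"
    using main by (meson exp_le_cancel_iff order_trans)
  then have "exp (- l * iter t f x) * iter t (\<lambda>x. exp (l * f x)) x
      \<le> exp (- l * iter t f x) * exp (l * iter t f x + K * exp (2 * c * K) * (l\<^sup>2 * a * b))"
    by (intro mult_left_mono) auto
  also have "\<dots> = exp (K * exp (2 * c * K) * (l\<^sup>2 * a * b))"
    by (simp add: exp_add[symmetric])
  moreover have "(\<lambda>y. exp (l * (f y - iter t f x))) = (\<lambda>y. exp (- l * iter t f x) * exp (l * f y))"
    by (simp add: exp_add[symmetric] algebra_simps)
  ultimately show ?thesis
    by (simp only: iter_cmult)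
qed

end

context heat_bath_influence
begin

text \<open>Rests on |u| \<le> exp u + exp (- u). A good choice of \<open>l\<close> is of the order
  of 1 / sqrt (a b), which gives a deviation of the order of sqrt (a b).\<close>

lemma mean_abs_deviation:
  assumes f: "lip_bounded f a b" and t: "real t \<le> K * M" and x: "x \<subseteq> E"
    and l: "0 < l" "l * a * exp (c * K) \<le> 1"
  shows "iter t (\<lambda>y. \<bar>f y - iter t f x\<bar>) x \<le> 2 * exp (K * exp (2 * c * K) * (l\<^sup>2 * a * b)) / l"
proof -
  let ?X = "\<lambda>y. f y - iter t f x" and ?B = "exp (K * exp (2 * c * K) * (l\<^sup>2 * a * b))"
  have le: "l * \<bar>?X y\<bar> \<le> exp (l * ?X y) + exp (- l * ?X y)" for y
  proof -
    have "\<bar>l * ?X y\<bar> \<le> exp (l * ?X y) + exp (- (l * ?X y))"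
      using exp_ge_add_one_self[of "l * ?X y"] exp_ge_add_one_self[of "- (l * ?X y)"]
        exp_gt_zero[of "l * ?X y"] exp_gt_zero[of "- (l * ?X y)"]
      unfolding abs_le_iff by linarith
    then show ?thesis
      using l by (simp add: abs_mult)
  qed
  have "iter t (\<lambda>y. l * \<bar>?X y\<bar>) x \<le> iter t (\<lambda>y. exp (l * ?X y) + exp (- l * ?X y)) x"
    by (rule iter_mono) (use le x in auto)
  also have "\<dots> = iter t (\<lambda>y. exp (l * ?X y)) x + iter t (\<lambda>y. exp (- l * ?X y)) x"
    by (simp only: iter_add)
  also have "\<dots> \<le> ?B + ?B"
    using concentration[OF f t x, of l] concentration[OF f t x, of "- l"] l by simp
  finally have "l * iter t (\<lambda>y. \<bar>?X y\<bar>) x \<le> 2 * ?B"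
    by (simp add: iter_cmult)
  then show ?thesis
    using l by (simp add: field_simps)
qed

lemma tail_bounds:
  assumes f: "lip_bounded f a b" and t: "real t \<le> K * M" and x: "x \<subseteq> E"
    and l: "0 < l" "l * a * exp (c * K) \<le> 1"
  shows "iter t (\<lambda>y. of_bool (iter t f x + \<epsilon> < f y)) x
      \<le> exp (K * exp (2 * c * K) * (l\<^sup>2 * a * b) - l * \<epsilon>)"
    and "iter t (\<lambda>y. of_bool (f y < iter t f x - \<epsilon>)) x
      \<le> exp (K * exp (2 * c * K) * (l\<^sup>2 * a * b) - l * \<epsilon>)"
proof -
  let ?X = "\<lambda>y. f y - iter t f x" and ?B = "K * exp (2 * c * K) * (l\<^sup>2 * a * b)"
  have tail: "iter t (\<lambda>y. of_bool (l * \<epsilon> < k * ?X y)) x \<le> exp (?B - l * \<epsilon>)"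
    if k: "k = l \<or> k = - l" for k
  proof -
    have "iter t (\<lambda>y. of_bool (l * \<epsilon> < k * ?X y)) x \<le> iter t (\<lambda>y. exp (- l * \<epsilon>) * exp (k * ?X y)) x"
      by (rule iter_mono) (use x in \<open>auto simp: exp_add[symmetric]\<close>)
    also have "\<dots> = exp (- l * \<epsilon>) * iter t (\<lambda>y. exp (k * ?X y)) x"
      by (simp only: iter_cmult)
    also have "\<dots> \<le> exp (- l * \<epsilon>) * exp ?B"
      using concentration[OF f t x, of k] l k by (intro mult_left_mono) auto
    also have "\<dots> = exp (?B - l * \<epsilon>)"
      by (simp add: exp_add[symmetric])
    finally show ?thesis .
  qed
  have "iter t f x + \<epsilon> < f y \<longleftrightarrow> l * \<epsilon> < l * ?X y"
      "f y < iter t f x - \<epsilon> \<longleftrightarrow> l * \<epsilon> < - l * ?X y" for y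
  proof -
    have "- l * ?X y = l * (- ?X y)"
      by (simp add: algebra_simps)
    then show "iter t f x + \<epsilon> < f y \<longleftrightarrow> l * \<epsilon> < l * ?X y"
        "f y < iter t f x - \<epsilon> \<longleftrightarrow> l * \<epsilon> < - l * ?X y"
      using l by (simp_all only: mult_less_cancel_left_pos) auto
  qed
  then show "iter t (\<lambda>y. of_bool (iter t f x + \<epsilon> < f y)) x \<le> exp (?B - l * \<epsilon>)"
      "iter t (\<lambda>y. of_bool (f y < iter t f x - \<epsilon>)) x \<le> exp (?B - l * \<epsilon>)"
    using tail[of l] tail[of "- l"] by simp_all
qed

end

section \<open>Contraction and the Poincare inequality\<close>

context heat_bath
begin

lemma increasing_edgeI:
  assumes "\<And>x e. x \<subseteq> E \<Longrightarrow> e \<in> E \<Longrightarrow> f (x - {e}) \<le> f (insert e x)"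
  shows "increasing f"
  unfolding increasing_def
proof (intro allI impI)
  fix x y assume xy: "x \<subseteq> y" "y \<subseteq> E"
  have "f x \<le> f (x \<union> D)" if "finite D" "D \<subseteq> E - x" for D
    using that
  proof (induction D rule: finite_induct)
    case (insert e D)
    have "f ((x \<union> D) - {e}) \<le> f (insert e (x \<union> D))"
      using insert xy by (intro assms) auto
    moreover have "(x \<union> D) - {e} = x \<union> D"
      using insert by auto
    ultimately show ?case
      using insert by simp
  qed simp
  from this[of "y - x"] xy finite_E show "f x \<le> f y"
    by (simp add: Un_absorb1 finite_subset Diff_mono)
qed

text \<open>
  Good configurations need not be closed under single flips. The function
  \<open>sum r - \<kappa> card\<close> is decreasing along ordered pairs of good configurations, and it is
  extended to a decreasing function of all configurations.
\<close>

lemma gradient_step: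
  fixes good :: "'e set \<Rightarrow> bool"
  assumes kappa: "0 \<le> \<kappa>" "\<kappa> \<le> 1"
    and good: "\<And>x y. x \<subseteq> y \<Longrightarrow> y \<subseteq> E \<Longrightarrow> good x \<Longrightarrow> good y \<Longrightarrow>
      (\<Sum>e\<in>E. r e y) - (\<Sum>e\<in>E. r e x) \<le> \<kappa> * (real (card y) - real (card x))"
    and bad: "\<And>x. x \<subseteq> E \<Longrightarrow> iter t (\<lambda>x. of_bool (\<not> good x)) x \<le> b"
    and d: "\<And>x e. x \<subseteq> E \<Longrightarrow> e \<in> E \<Longrightarrow>
      iter t (\<lambda>x. real (card x)) (insert e x) - iter t (\<lambda>x. real (card x)) (x - {e}) \<le> d"
    and x: "x \<subseteq> E" and e: "e \<in> E"
  shows "iter (Suc t) (\<lambda>x. real (card x)) (insert e x) - iter (Suc t) (\<lambda>x. real (card x)) (x - {e})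
    \<le> (1 - (1 - \<kappa>) / M) * d + 6 * b"
proof -
  define N :: "'e set \<Rightarrow> real" where "N = (\<lambda>x. real (card x))"
  define q where "q = (\<lambda>x. \<Sum>e\<in>E. r e x)"
  define g where "g = (\<lambda>x. q x - \<kappa> * N x)"
  define G where "G = (\<lambda>x. {z. x \<subseteq> z \<and> z \<subseteq> E \<and> good z})"
  \<comment> \<open>Largest value of \<open>g\<close> over the good configurations above
    \<open>x\<close>. The default \<open>- M\<close> lies below all values of \<open>g\<close>: it
    makes the maximum exist if there is no such configuration and does no harm if \<open>x\<close>
    is good. As \<open>x\<close> grows, \<open>G x\<close> shrinks, so \<open>h\<close>
    decreases.\<close>
  define h where "h = (\<lambda>x. Max (insert (- M) (g ` G x)))"
  let ?y = "insert e x" and ?z = "x - {e}"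
  have yz: "?y \<subseteq> E" "?z \<subseteq> E" "?z \<subseteq> ?y"
    using x e by auto
  have finG: "finite (G x)" for x
    unfolding G_def using finite_E by (auto intro: finite_subset[of _ "Pow E"])
  have g_bounds: "- M \<le> g x" "g x \<le> M" if "x \<subseteq> E" for x
  proof -
    have "0 \<le> q x" "q x \<le> M"
      unfolding q_def using sum_mono[of E "\<lambda>e. r e x" "\<lambda>e. 1"] r_nonneg r_le_1
      by (auto intro: sum_nonneg)
    moreover have "\<kappa> * N x \<le> 1 * M"
      unfolding N_def using that kappa card_mono[OF finite_E] by (intro mult_mono) auto
    moreover have "0 \<le> \<kappa> * N x"
      unfolding N_def using kappa by simp
    ultimately show "- M \<le> g x" "g x \<le> M"
      unfolding g_def by linarith+
  qed
  have h_bounds: "- M \<le> h x" "h x \<le> M" for x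
    unfolding h_def using finG g_bounds(2) M_pos
    by (auto simp: G_def)
  have h_good: "h x = g x" if "x \<subseteq> E" "good x" for x
  proof -
    have "g z \<le> g x" if z: "z \<in> G x" for z
      using good[of x z] z \<open>good x\<close> unfolding G_def g_def q_def N_def
      by (auto simp: algebra_simps)
    then show ?thesis
      unfolding h_def using that finG g_bounds[of x]
      by (intro Max_eqI) (auto simp: G_def)
  qed
  have "increasing (\<lambda>x. (-1) * h x)"
    unfolding increasing_def
  proof (intro allI impI)
    fix x y assume "x \<subseteq> y" "y \<subseteq> E"
    then have "insert (- M) (g ` G y) \<subseteq> insert (- M) (g ` G x)"
      unfolding G_def by blast
    then have "h y \<le> h x"
      unfolding h_def using finG by (intro Max_mono) auto
    then show "(-1) * h x \<le> (-1) * h y"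
      by simp
  qed
  then have dec: "iter t h ?y \<le> iter t h ?z"
    using increasing_iter[of "\<lambda>x. (-1) * h x" t] yz unfolding iter_cmult increasing_def
    by (smt (verit))
  have close: "\<bar>iter t g x - iter t h x\<bar> \<le> 3 * M * b" if "x \<subseteq> E" for x
  proof -
    \<comment> \<open>\<open>g\<close> and \<open>h\<close> agree on good configurations and both
      take values between \<open>- M\<close> and \<open>M\<close>.\<close>
    have "\<bar>g x - h x\<bar> \<le> (3 * M) * of_bool (\<not> good x)" if "x \<subseteq> E" for x
      using h_good[OF that] g_bounds[OF that] h_bounds[of x] M_pos
      by (cases "good x") (auto simp: abs_le_iff)
    from iter_abs_le[of "\<lambda>x. g x - h x" "\<lambda>x. (3 * M) * of_bool (\<not> good x)", OF this \<open>x \<subseteq> E\<close>, of t]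
    have "\<bar>iter t g x - iter t h x\<bar> \<le> (3 * M) * iter t (\<lambda>x. of_bool (\<not> good x)) x"
      by (simp only: iter_diff iter_cmult)
    also have "\<dots> \<le> 3 * M * b"
      using bad[OF that] M_pos by (intro mult_left_mono) auto
    finally show ?thesis .
  qed
  have "q = (\<lambda>x. g x + \<kappa> * N x)"
    unfolding g_def by simp
  \<comment> \<open>The iterate of \<open>h\<close> does not increase from \<open>?z\<close> to
    \<open>?y\<close>, so only \<open>\<kappa> * N\<close> and the two replacement errors of
    \<open>3 * M * b\<close> contribute.\<close>
  then have "iter t q ?y - iter t q ?z
      = (iter t g ?y - iter t g ?z) + \<kappa> * (iter t N ?y - iter t N ?z)"
    by (simp add: iter_add iter_cmult right_diff_distrib)
  also have "\<dots> \<le> 6 * M * b + \<kappa> * d"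
    using dec close[OF yz(1)] close[OF yz(2)] mult_left_mono[OF d[OF x e] kappa(1)]
    unfolding N_def by linarith
  finally have q: "iter t q ?y - iter t q ?z \<le> 6 * M * b + \<kappa> * d" .
  have S: "iter (Suc t) N x = (1 - 1 / M) * iter t N x + (1 / M) * iter t q x" if "x \<subseteq> E" for x
  proof -
    have "iter (Suc t) N x = iter t (step N) x"
      by (simp add: iter_Suc del: funpow.simps)
    also have "\<dots> = iter t (\<lambda>x. (1 - 1 / M) * N x + (1 / M) * q x) x"
      using step_card that unfolding N_def q_def by (intro iter_cong) auto
    finally show ?thesis
      by (simp only: iter_add iter_cmult)
  qed
  have "iter (Suc t) N ?y - iter (Suc t) N ?z
      = (1 - 1 / M) * (iter t N ?y - iter t N ?z) + (1 / M) * (iter t q ?y - iter t q ?z)"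
    by (simp only: S[OF yz(1)] S[OF yz(2)] algebra_simps)
  also have "\<dots> \<le> (1 - 1 / M) * d + (1 / M) * (6 * M * b + \<kappa> * d)"
    using d[OF x e] q M_ge_1 unfolding N_def by (intro add_mono mult_left_mono) auto
  also have "\<dots> = (1 - (1 - \<kappa>) / M) * d + 6 * b"
    using M_pos by (simp add: field_simps)
  finally show ?thesis
    unfolding N_def .
qed

text \<open>Iterates \<open>gradient_step\<close>; the constant
  \<open>6 * b * M / (1 - \<kappa>)\<close> is the fixed point of d \<mapsto> (1 - (1 - \<kappa>) /
  M) d + 6 b. The bound on bad configurations at time \<open>T\<close> holds for every start, hence
  by the Markov property at all later times.\<close>

lemma gradient_bound:
  fixes good :: "'e set \<Rightarrow> bool"
  assumes kappa: "0 \<le> \<kappa>" "\<kappa> < 1"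
    and good: "\<And>x y. x \<subseteq> y \<Longrightarrow> y \<subseteq> E \<Longrightarrow> good x \<Longrightarrow> good y \<Longrightarrow>
      (\<Sum>e\<in>E. r e y) - (\<Sum>e\<in>E. r e x) \<le> \<kappa> * (real (card y) - real (card x))"
    and bad: "\<And>x. x \<subseteq> E \<Longrightarrow> iter T (\<lambda>x. of_bool (\<not> good x)) x \<le> b"
    and d: "\<And>x e. x \<subseteq> E \<Longrightarrow> e \<in> E \<Longrightarrow>
      iter T (\<lambda>x. real (card x)) (insert e x) - iter T (\<lambda>x. real (card x)) (x - {e}) \<le> d"
    and x: "x \<subseteq> E" and e: "e \<in> E"
  shows "iter (s + T) (\<lambda>x. real (card x)) (insert e x) - iter (s + T) (\<lambda>x. real (card x)) (x - {e})
    \<le> (1 - (1 - \<kappa>) / M) ^ s * d + 6 * b * M / (1 - \<kappa>)"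
  using x e
proof (induction s arbitrary: x e)
  case 0
  have "0 \<le> b"
    using bad[of "{}"] iter_nonneg[of "\<lambda>x. of_bool (\<not> good x)" "{}" T] by simp
  then show ?case
    using d[OF 0] M_pos kappa by (simp add: add_increasing2)
next
  case (Suc s)
  have "iter (s + T) (\<lambda>x. of_bool (\<not> good x)) x \<le> b" if "x \<subseteq> E" for x
  proof -
    have "iter (s + T) (\<lambda>x. of_bool (\<not> good x)) x = iter s (iter T (\<lambda>x. of_bool (\<not> good x))) x"
      by (simp add: funpow_add)
    also have "\<dots> \<le> iter s (\<lambda>x. b) x"
      using bad that by (intro iter_mono) auto
    finally show ?thesis
      by (simp add: iter_const)
  qed
  from gradient_step[of \<kappa> good, OF kappa(1) less_imp_le[OF kappa(2)] good this Suc.IH Suc.prems]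
  have "iter (Suc (s + T)) (\<lambda>x. real (card x)) (insert e x)
      - iter (Suc (s + T)) (\<lambda>x. real (card x)) (x - {e})
    \<le> (1 - (1 - \<kappa>) / M) * ((1 - (1 - \<kappa>) / M) ^ s * d + 6 * b * M / (1 - \<kappa>)) + 6 * b"
    by blast
  also have "\<dots> = (1 - (1 - \<kappa>) / M) ^ Suc s * d + 6 * b * M / (1 - \<kappa>)"
    using M_pos kappa by (simp add: field_simps)
  finally show ?case
    by simp
qed

lemma gradient_le_increasing:
  assumes l: "\<And>x e. x \<subseteq> E \<Longrightarrow> e \<in> E \<Longrightarrow> \<bar>f (insert e x) - f (x - {e})\<bar> \<le> l"
  shows "increasing (\<lambda>x. l * real (card x) + f x)" "increasing (\<lambda>x. l * real (card x) + (-1) * f x)"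
proof -
  have *: "l * real (card (insert e x)) = l * real (card (x - {e})) + l" if "x \<subseteq> E" "e \<in> E" for x e
  proof -
    have "finite (x - {e})"
      using that finite_E finite_subset by blast
    then have "card (insert e x) = Suc (card (x - {e}))"
      by (metis DiffE card_insert_disjoint insertI1 insert_Diff_single)
    then show ?thesis
      by (simp only: of_nat_Suc distrib_left mult_1_right add.commute)
  qed
  have **: "l * real (card (x - {e})) + f (x - {e}) \<le> l * real (card (insert e x)) + f (insert e x)"
      "l * real (card (x - {e})) + (-1) * f (x - {e}) \<le> l * real (card (insert e x)) + (-1) * f (insert e x)"
    if "x \<subseteq> E" "e \<in> E" for x e
    using *[OF that] l[OF that] by (simp_all only: abs_le_iff) linarith+
  show "increasing (\<lambda>x. l * real (card x) + f x)" "increasing (\<lambda>x. l * real (card x) + (-1) * f x)"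
    by (rule increasing_edgeI, rule **, assumption+)+
qed

lemma gradient_halving:
  assumes N: "\<And>x e. x \<subseteq> E \<Longrightarrow> e \<in> E \<Longrightarrow>
      iter T (\<lambda>x. real (card x)) (insert e x) - iter T (\<lambda>x. real (card x)) (x - {e}) \<le> 1 / 2"
    and l: "\<And>x e. x \<subseteq> E \<Longrightarrow> e \<in> E \<Longrightarrow> \<bar>f (insert e x) - f (x - {e})\<bar> \<le> l"
    and x: "x \<subseteq> E" "e \<in> E"
  shows "\<bar>iter (j * T) f (insert e x) - iter (j * T) f (x - {e})\<bar> \<le> l / 2 ^ j"
  using x
proof (induction j arbitrary: x e)
  case 0
  then show ?case
    using l by simp
next
  case (Suc j)
  let ?f = "iter (j * T) f" and ?l = "l / 2 ^ j"
  have l0: "0 \<le> l"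
    using l[OF Suc.prems] by linarith
  have inc: "increasing (iter T (\<lambda>x. ?l * real (card x) + ?f x))"
      "increasing (iter T (\<lambda>x. ?l * real (card x) + (-1) * ?f x))"
    by (rule increasing_iter, rule gradient_le_increasing, rule Suc.IH, assumption+)+
  have sub: "x - {e} \<subseteq> insert e x" "insert e x \<subseteq> E"
    using Suc.prems by auto
  have "\<bar>iter T ?f (insert e x) - iter T ?f (x - {e})\<bar>
      \<le> ?l * (iter T (\<lambda>x. real (card x)) (insert e x) - iter T (\<lambda>x. real (card x)) (x - {e}))"
    using inc[unfolded increasing_def, rule_format, OF sub] unfolding iter_add iter_cmult
    by (simp only: right_diff_distrib abs_le_iff) linarith
  also have "\<dots> \<le> ?l * (1 / 2)"
    using N[OF Suc.prems] l0 by (intro mult_left_mono) auto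
  finally show ?case
    by (simp add: funpow_add)
qed

end

section \<open>Reversibility, Dirichlet form and Poincare inequality\<close>

locale heat_bath_reversible = heat_bath +
  fixes \<pi> :: "'a set \<Rightarrow> real"
  assumes pi_pos: "x \<subseteq> E \<Longrightarrow> 0 < \<pi> x"
    and pi_sum: "(\<Sum>x\<in>Pow E. \<pi> x) = 1"
    and detailed_balance: "x \<subseteq> E \<Longrightarrow> e \<in> E \<Longrightarrow> e \<notin> x \<Longrightarrow>
      \<pi> x * r e x = \<pi> (insert e x) * (1 - r e x)"
begin

definition flip :: "'a set \<Rightarrow> 'a \<Rightarrow> 'a set" where
  "flip x e = (if e \<in> x then x - {e} else insert e x)"

definition rate :: "'a \<Rightarrow> 'a set \<Rightarrow> real" where
  "rate e x = (if e \<in> x then 1 - r e x else r e x)"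

definition inner :: "('a set \<Rightarrow> real) \<Rightarrow> ('a set \<Rightarrow> real) \<Rightarrow> real" where
  "inner f g = (\<Sum>x\<in>Pow E. \<pi> x * f x * g x)"

text \<open>Normalised without a factor 1/2 in order to match \<open>dirichlet_form\<close>; this is
  the source of the factor 2 in \<open>dirichlet_eq\<close>.\<close>

definition dirichlet :: "('a set \<Rightarrow> real) \<Rightarrow> real" where
  "dirichlet f = (\<Sum>x\<in>Pow E. \<Sum>e\<in>E. rate e x * (f (flip x e) - f x)\<^sup>2 * \<pi> x) / M"

lemma flip_flip: "flip (flip x e) e = x"
  unfolding flip_def by auto

lemma flip_in: "e \<in> E \<Longrightarrow> x \<in> Pow E \<Longrightarrow> flip x e \<in> Pow E"
  unfolding flip_def by auto

lemma sum_flip: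
  assumes "e \<in> E"
  shows "(\<Sum>x\<in>Pow E. F (flip x e)) = (\<Sum>x\<in>Pow E. F x)"
  by (rule sum.reindex_bij_witness[of _ "\<lambda>x. flip x e" "\<lambda>x. flip x e"])
    (use assms in \<open>auto simp: flip_flip dest: flip_in\<close>)

lemma rate_reversible:
  assumes "e \<in> E" "x \<in> Pow E"
  shows "\<pi> (flip x e) * rate e (flip x e) = \<pi> x * rate e x"
proof (cases "e \<in> x")
  case True
  then have "insert e (x - {e}) = x"
    by blast
  then show ?thesis
    using detailed_balance[of "x - {e}" e] assms True
    unfolding flip_def rate_def by (auto simp: r_remove)
next
  case False
  then show ?thesis
    using detailed_balance[of x e] assms unfolding flip_def rate_def by (auto simp: r_insert)
qed

lemma step_eq_rate: "step f x = f x + (\<Sum>e\<in>E. rate e x * (f (flip x e) - f x)) / M"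
proof -
  have "r e x * f (insert e x) + (1 - r e x) * f (x - {e}) = f x + rate e x * (f (flip x e) - f x)" for e
    unfolding rate_def flip_def
    by (cases "e \<in> x") (auto simp: insert_absorb algebra_simps)
  then show ?thesis
    unfolding step_def using M_pos by (simp add: sum.distrib add_divide_distrib)
qed

lemma inner_step:
  "inner f (step g) = inner f g + (\<Sum>e\<in>E. \<Sum>x\<in>Pow E. \<pi> x * rate e x * (f x * g (flip x e) - f x * g x)) / M"
proof -
  have "inner f (step g) = inner f g
      + (\<Sum>x\<in>Pow E. (\<Sum>e\<in>E. \<pi> x * rate e x * (f x * g (flip x e) - f x * g x)) / M)"
    unfolding inner_def step_eq_rate sum.distrib[symmetric]
    by (intro sum.cong) (auto simp: algebra_simps sum_distrib_left sum_divide_distrib)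
  also have "(\<Sum>x\<in>Pow E. (\<Sum>e\<in>E. \<pi> x * rate e x * (f x * g (flip x e) - f x * g x)) / M)
      = (\<Sum>e\<in>E. \<Sum>x\<in>Pow E. \<pi> x * rate e x * (f x * g (flip x e) - f x * g x)) / M"
    by (simp only: sum_divide_distrib[symmetric] sum.swap[of _ E])
  finally show ?thesis .
qed

text \<open>The stationary flow \<open>\<pi> x * rate e x\<close> is invariant under flipping
  \<open>e\<close>, so the two endpoints of a flip may exchange their roles. Self-adjointness and
  the Dirichlet identity both come from this.\<close>

lemma sum_rate_flip:
  assumes "e \<in> E"
  shows "(\<Sum>x\<in>Pow E. \<pi> x * rate e x * F (flip x e) x) = (\<Sum>x\<in>Pow E. \<pi> x * rate e x * F x (flip x e))"
proof -
  have "(\<Sum>x\<in>Pow E. \<pi> x * rate e x * F x (flip x e))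
      = (\<Sum>x\<in>Pow E. \<pi> (flip x e) * rate e (flip x e) * F (flip x e) (flip (flip x e) e))"
    by (rule sum_flip[OF assms, symmetric])
  also have "\<dots> = (\<Sum>x\<in>Pow E. \<pi> x * rate e x * F (flip x e) x)"
    using rate_reversible[OF assms] by (intro sum.cong) (simp_all add: flip_flip)
  finally show ?thesis
    by simp
qed

lemma inner_commute: "inner f g = inner g f"
  unfolding inner_def by (intro sum.cong refl) (simp only: mult_ac)

lemma inner_step_commute: "inner f (step g) = inner (step f) g"
proof -
  have "(\<Sum>x\<in>Pow E. \<pi> x * rate e x * (f x * g (flip x e) - f x * g x))
      = (\<Sum>x\<in>Pow E. \<pi> x * rate e x * (g x * f (flip x e) - g x * f x))" if "e \<in> E" for e
    using sum_rate_flip[OF that, of "\<lambda>y x. g x * f y"]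
    by (simp add: right_diff_distrib sum_subtractf mult_ac)
  then have "inner f (step g) = inner g (step f)"
    unfolding inner_step using inner_commute[of f g] by simp
  then show ?thesis
    using inner_commute by simp
qed

lemma dirichlet_eq: "dirichlet f = 2 * (inner f f - inner f (step f))"
proof -
  have *: "(\<Sum>x\<in>Pow E. rate e x * (f (flip x e) - f x)\<^sup>2 * \<pi> x)
      = - 2 * (\<Sum>x\<in>Pow E. \<pi> x * rate e x * (f x * f (flip x e) - f x * f x))" if "e \<in> E" for e
  proof -
    have "(\<Sum>x\<in>Pow E. rate e x * (f (flip x e) - f x)\<^sup>2 * \<pi> x)
        = (\<Sum>x\<in>Pow E. \<pi> x * rate e x * (f (flip x e))\<^sup>2)
          + (\<Sum>x\<in>Pow E. \<pi> x * rate e x * (f x * f x - 2 * (f x * f (flip x e))))"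
      unfolding sum.distrib[symmetric]
      by (intro sum.cong) (auto simp: power2_eq_square algebra_simps)
    also have "(\<Sum>x\<in>Pow E. \<pi> x * rate e x * (f (flip x e))\<^sup>2) = (\<Sum>x\<in>Pow E. \<pi> x * rate e x * (f x)\<^sup>2)"
      by (rule sum_rate_flip[OF that, of "\<lambda>y x. (f y)\<^sup>2"])
    finally show ?thesis
      unfolding sum.distrib[symmetric] sum_distrib_left
      by (simp only:) (intro sum.cong refl, simp add: power2_eq_square algebra_simps)
  qed
  have "dirichlet f = (\<Sum>e\<in>E. \<Sum>x\<in>Pow E. rate e x * (f (flip x e) - f x)\<^sup>2 * \<pi> x) / M"
    unfolding dirichlet_def by (subst sum.swap) simp
  also have "\<dots> = (\<Sum>e\<in>E. - 2 * (\<Sum>x\<in>Pow E. \<pi> x * rate e x * (f x * f (flip x e) - f x * f x))) / M"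
    using * by simp
  also have "\<dots> = 2 * (inner f f - inner f (step f))"
    unfolding inner_step by (simp add: sum_distrib_left[symmetric] sum_negf)
  finally show ?thesis .
qed

lemma inner_nonneg: "0 \<le> inner f f"
  unfolding inner_def using pi_pos by (intro sum_nonneg) (auto simp: mult.assoc less_imp_le)

lemma inner_Cauchy_Schwarz: "(inner f g)\<^sup>2 \<le> inner f f * inner g g"
proof -
  have "inner f g = (\<Sum>x\<in>Pow E. (sqrt (\<pi> x) * f x) * (sqrt (\<pi> x) * g x))" for f g
    unfolding inner_def
  proof (intro sum.cong refl)
    fix x assume "x \<in> Pow E"
    then have "sqrt (\<pi> x) * sqrt (\<pi> x) = \<pi> x"
      using pi_pos by (simp add: less_imp_le)
    then show "\<pi> x * f x * g x = (sqrt (\<pi> x) * f x) * (sqrt (\<pi> x) * g x)"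
      by (metis mult.assoc mult.commute)
  qed
  then show ?thesis
    using Cauchy_Schwarz_ineq_sum[of "\<lambda>x. sqrt (\<pi> x) * f x" "\<lambda>x. sqrt (\<pi> x) * g x" "Pow E"]
    by (simp add: power2_eq_square)
qed

text \<open>Self-adjointness turns the squared norm of P^(k+1) f into the inner product of P^k f and
  P^(k+2) f, to which Cauchy-Schwarz applies.\<close>

lemma inner_iter_log_convex:
  "(inner (iter (Suc k) f) (iter (Suc k) f))\<^sup>2
    \<le> inner (iter k f) (iter k f) * inner (iter (Suc (Suc k)) f) (iter (Suc (Suc k)) f)"
proof -
  have "inner (iter (Suc k) f) (iter (Suc k) f) = inner (iter k f) (iter (Suc (Suc k)) f)"
    using inner_step_commute[of "iter k f" "iter (Suc k) f"] by simp
  then show ?thesis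
    using inner_Cauchy_Schwarz by simp
qed

lemma inner_iter_1: "inner (iter k f) (\<lambda>x. 1) = inner f (\<lambda>x. 1)"
  by (induction k) (auto simp: inner_step_commute[symmetric] step_const)

text \<open>Every configuration is reached from the empty one by at most \<open>M\<close> flips, and
  the vanishing mean places \<open>f {}\<close> itself within \<open>l * M\<close> of 0.\<close>

lemma inner_le_gradient:
  assumes l: "\<And>x e. x \<subseteq> E \<Longrightarrow> e \<in> E \<Longrightarrow> \<bar>f (insert e x) - f (x - {e})\<bar> \<le> l"
    and mean: "inner f (\<lambda>x. 1) = 0"
  shows "inner f f \<le> (2 * l * M)\<^sup>2"
proof -
  have l0: "0 \<le> l"
    using l[of "{}"] E_nonempty by fastforce
  have 1: "\<bar>f x - f {}\<bar> \<le> l * M" if "x \<subseteq> E" for x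
  proof -
    have "\<bar>f x - f {}\<bar> \<le> l * real (card x)"
      using gradient_le_increasing[OF l, unfolded increasing_def, rule_format, OF _ _ empty_subsetI that]
      by (simp add: abs_le_iff algebra_simps)
    also have "\<dots> \<le> l * M"
      using l0 card_mono[OF finite_E that] by (intro mult_left_mono) auto
    finally show ?thesis .
  qed
  have "f {} = (\<Sum>x\<in>Pow E. \<pi> x * (f {} - f x))"
    using mean pi_sum unfolding inner_def
    by (simp add: right_diff_distrib sum_subtractf sum_distrib_right[symmetric])
  also have "\<bar>\<dots>\<bar> \<le> (\<Sum>x\<in>Pow E. \<pi> x * (l * M))"
    using 1 pi_pos by (intro order_trans[OF sum_abs] sum_mono)
      (auto simp: abs_mult abs_minus_commute less_imp_le intro!: mult_left_mono)
  finally have 2: "\<bar>f {}\<bar> \<le> l * M"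
    using pi_sum by (simp add: sum_distrib_right[symmetric])
  have "inner f f \<le> (\<Sum>x\<in>Pow E. \<pi> x * (2 * l * M)\<^sup>2)"
    unfolding inner_def mult.assoc
  proof (intro sum_mono mult_left_mono)
    fix x assume x: "x \<in> Pow E"
    then have "\<bar>f x\<bar> \<le> \<bar>2 * l * M\<bar>"
      using 1[of x] 2 by auto
    then show "f x * f x \<le> (2 * (l * M))\<^sup>2"
      by (simp add: abs_le_square_iff power2_eq_square mult_ac)
  qed (use pi_pos in \<open>auto simp: less_imp_le\<close>)
  then show ?thesis
    using pi_sum by (simp add: sum_distrib_right[symmetric])
qed

text \<open>Passing from gradients to norms costs a factor polynomial in \<open>M\<close>, but it
  does not depend on the number of blocks of \<open>T\<close> steps. In the limit of many blocks
  only the rate 1/4 per block survives, and log-convexity hands it down to the first step.\<close>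

lemma poincare_of_gradient_halving:
  assumes T: "T \<ge> 1"
    and N: "\<And>x e. x \<subseteq> E \<Longrightarrow> e \<in> E \<Longrightarrow>
      iter T (\<lambda>x. real (card x)) (insert e x) - iter T (\<lambda>x. real (card x)) (x - {e}) \<le> 1 / 2"
    and mean: "inner f (\<lambda>x. 1) = 0"
  shows "inner f f \<le> real T * dirichlet f"
proof -
  define B where "B k = inner (iter k f) (iter k f)" for k
  have B0: "B 0 = inner f f"
    by (simp add: B_def)
  have Bnn: "0 \<le> B k" for k
    unfolding B_def by (rule inner_nonneg)
  define c where "c = inner f (step f)"
  have c2: "c\<^sup>2 \<le> B 0 * B 1"
    unfolding c_def B_def using inner_Cauchy_Schwarz[of f "step f"] by simp
  have dir: "dirichlet f = 2 * (B 0 - c)"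
    unfolding dirichlet_eq c_def B0 ..
  \<comment> \<open>Any finite gradient bound serves, since only the rate of decay matters in the
    end.\<close>
  define l where "l = 2 * (\<Sum>x\<in>Pow E. \<bar>f x\<bar>)"
  have fl: "\<bar>f x\<bar> \<le> l / 2" if "x \<subseteq> E" for x
    unfolding l_def using member_le_sum[of x "Pow E" "\<lambda>x. \<bar>f x\<bar>"] finite_E that by simp
  have l: "\<bar>f (insert e x) - f (x - {e})\<bar> \<le> l" if "x \<subseteq> E" "e \<in> E" for x e
  proof -
    have "insert e x \<subseteq> E" "x - {e} \<subseteq> E"
      using that by auto
    from this[THEN fl] show ?thesis
      by linarith
  qed
  have decay: "B (j * T) \<le> (2 * l * M)\<^sup>2 / 4 ^ j" for j
  proof -
    have "B (j * T) \<le> (2 * (l / 2 ^ j) * M)\<^sup>2"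
      unfolding B_def using mean
      by (intro inner_le_gradient gradient_halving[OF N l]) (simp_all add: inner_iter_1)
    also have "\<dots> = (2 * l * M)\<^sup>2 / (2 ^ j)\<^sup>2"
      by (simp add: power_divide power_mult_distrib)
    also have "((2::real) ^ j)\<^sup>2 = 4 ^ j"
      by (simp add: power2_eq_square power_mult_distrib[symmetric])
    finally show ?thesis .
  qed
  \<comment> \<open>By \<open>dir\<close> this says that \<open>dirichlet f\<close> is at least B 0
    / T.\<close>
  have key: "c \<le> (1 - 1 / (2 * real T)) * B 0"
  proof (cases "0 < B 0 \<and> 0 < B 1")
    case False
    then have "c\<^sup>2 \<le> 0"
      using c2 Bnn[of 0] Bnn[of 1] by (auto simp: not_less)
    then have "c = 0"
      by simp
    moreover have "1 / (2 * real T) \<le> 1"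
      using T by simp
    ultimately show ?thesis
      using Bnn[of 0] by simp
  next
    case True
    define \<rho> where "\<rho> = B 1 / B 0"
    have rho: "0 < \<rho>"
      using True by (simp add: \<rho>_def)
    \<comment> \<open>Growth at least like \<open>\<rho> ^ k\<close> meets decay like 4^(-j) at k =
      j T; boundedness in \<open>j\<close> forces 4 \<rho>^T \<le> 1.\<close>
    have "(4 * \<rho> ^ T) ^ j \<le> (2 * l * M)\<^sup>2 / B 0" for j
    proof -
      have "\<rho> ^ (j * T) * B 0 \<le> (2 * l * M)\<^sup>2 / 4 ^ j"
        using log_convex_growth[of B "j * T"] inner_iter_log_convex[of _ f] True Bnn decay[of j]
        unfolding \<rho>_def B_def by (meson order_trans)
      then have "(\<rho> ^ T) ^ j * 4 ^ j \<le> (2 * l * M)\<^sup>2 / B 0"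
        using True by (simp add: pos_le_divide_eq mult.commute[of j T] power_mult mult_ac)
      then show ?thesis
        by (simp only: power_mult_distrib mult.commute)
    qed
    then have "4 * \<rho> ^ T \<le> 1"
      by (rule bounded_powers_le_1)
    then have "(2 * sqrt \<rho> ^ T)\<^sup>2 \<le> 1\<^sup>2"
      using rho by (simp add: power_mult_distrib power_mult[symmetric] mult.commute[of T] power_mult)
    then have s: "2 * sqrt \<rho> ^ T \<le> 1"
      by (rule power2_le_imp_le) simp
    \<comment> \<open>By Bernoulli the T-th power of the right-hand side is at least 1/2, while that
      of \<open>sqrt \<rho>\<close> is at most 1/2.\<close>
    have "sqrt \<rho> \<le> 1 - 1 / (2 * real T)"
    proof (rule ccontr)
      assume "\<not> ?thesis"
      moreover have T': "1 / (2 * real T) \<le> 1 / 2"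
        using T by simp
      ultimately have "(1 - 1 / (2 * real T)) ^ T < sqrt \<rho> ^ T"
        using T by (intro power_strict_mono) auto
      moreover have "1 + real T * (- (1 / (2 * real T))) \<le> (1 + - (1 / (2 * real T))) ^ T"
        using T' by (intro Bernoulli_inequality) auto
      moreover have "1 + real T * (- (1 / (2 * real T))) = 1 / 2"
        using T by simp
      ultimately show False
        using s by simp
    qed
    moreover have "c \<le> sqrt \<rho> * B 0"
    proof (rule power2_le_imp_le)
      show "c\<^sup>2 \<le> (sqrt \<rho> * B 0)\<^sup>2"
        using c2 True by (simp add: power_mult_distrib \<rho>_def power2_eq_square[of "B 0"] mult.commute)
      show "0 \<le> sqrt \<rho> * B 0"
        using rho True by simp
    qed
    ultimately show ?thesis
      using True by (meson less_imp_le mult_right_mono order_trans)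
  qed
  have "B 0 = real T * (2 * (1 / (2 * real T) * B 0))"
    using T by simp
  also have "\<dots> \<le> real T * dirichlet f"
    unfolding dir using key by (intro mult_left_mono) (auto simp: algebra_simps)
  finally show ?thesis
    by (simp add: B0)
qed

end

section \<open>Rooted subgraph counts\<close>

definition inj_maps :: "nat \<Rightarrow> 'v graph \<Rightarrow> ('v \<Rightarrow> nat) set" where
  "inj_maps n G = {\<psi>. \<psi> \<in> verts G \<rightarrow>\<^sub>E {1..n} \<and> inj_on \<psi> (verts G)}"

definition rooted_maps :: "nat \<Rightarrow> 'v graph \<Rightarrow> 'v set \<Rightarrow> nat set \<Rightarrow> ('v \<Rightarrow> nat) set" where
  "rooted_maps n G a e = {\<psi> \<in> inj_maps n G. \<psi> ` a = e}"

text \<open>The root edge \<open>a\<close> lands on \<open>e\<close> in either orientation. This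
  fixes two vertices, so dividing by n^(|V| - 2) keeps the count bounded in
  \<open>n\<close>.\<close>

definition rooted_count ::
  "nat \<Rightarrow> 'v graph \<Rightarrow> 'v set \<Rightarrow> 'v set set \<Rightarrow> nat set \<Rightarrow> nat set set \<Rightarrow> real" where
  "rooted_count n G a B e x =
     (\<Sum>\<psi>\<in>rooted_maps n G a e. of_bool ((`) \<psi> ` B \<subseteq> x)) / real n ^ (card (verts G) - 2)"

text \<open>The interaction kernel: flipping \<open>f\<close> changes a count rooted at
  \<open>e\<close> only through embeddings that use both edges.\<close>

definition pair_count :: "nat \<Rightarrow> 'v graph \<Rightarrow> 'v set \<Rightarrow> 'v set \<Rightarrow> nat set \<Rightarrow> nat set \<Rightarrow> real" where
  "pair_count n G a b e f =
     real (card {\<psi> \<in> rooted_maps n G a e. \<psi> ` b = f}) / real n ^ (card (verts G) - 2)"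

lemma finite_complete_edges: "finite (complete_edges n)"
  using finite_configs[of n] by (simp add: configs_def finite_Pow_iff)

lemma card_complete_edges: "real (card (complete_edges n)) = real n * (real n - 1) / 2"
proof -
  have "card (complete_edges n) = n choose 2"
    unfolding complete_edges_def using n_subsets[of "{1..n}" 2] by simp
  moreover have "even (n * (n - 1))"
    by (cases "even n") auto
  ultimately have "2 * card (complete_edges n) = n * (n - 1)"
    by (simp only: choose_two dvd_mult_div_cancel)
  then have "2 * real (card (complete_edges n)) = real n * real (n - 1)"
    by (metis of_nat_mult of_nat_numeral)
  then show ?thesis
    by (cases n) auto
qed

context
  fixes G :: "'v graph"
  assumes G: "finite_simple_graph G"
begin

lemma finite_verts: "finite (verts G)"
  using G by (simp add: finite_simple_graph_def)

lemma edge_subset: "a \<in> edges G \<Longrightarrow> a \<subseteq> verts G"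
  using G by (simp add: finite_simple_graph_def)

lemma card_edge: "a \<in> edges G \<Longrightarrow> card a = 2"
  using G by (simp add: finite_simple_graph_def)

lemma finite_edges: "finite (edges G)"
  using finite_verts edge_subset by (meson PowI finite_Pow_iff rev_finite_subset subsetI)

lemma card_verts_ge_2: "a \<in> edges G \<Longrightarrow> 2 \<le> card (verts G)"
  using card_edge edge_subset finite_verts by (metis card_mono)

lemma finite_inj_maps: "finite (inj_maps n G)"
  unfolding inj_maps_def
  by (rule finite_subset[of _ "verts G \<rightarrow>\<^sub>E {1..n}"]) (auto intro!: finite_PiE finite_verts)

lemma finite_rooted_maps: "finite (rooted_maps n G a e)"
  unfolding rooted_maps_def using finite_inj_maps by simp

lemma image_edge:
  assumes "\<psi> \<in> inj_maps n G" "a \<in> edges G"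
  shows "\<psi> ` a \<in> complete_edges n"
proof -
  have "inj_on \<psi> a"
    using assms edge_subset by (auto simp: inj_maps_def intro: inj_on_subset)
  then have "card (\<psi> ` a) = 2"
    using card_edge[OF assms(2)] by (simp add: card_image)
  moreover have "\<psi> ` a \<subseteq> {1..n}"
    using assms edge_subset[OF assms(2)] by (auto simp: inj_maps_def)
  ultimately show ?thesis
    by (simp add: complete_edges_def)
qed

lemma image_edge_eq_iff:
  assumes "\<psi> \<in> inj_maps n G" "a \<in> edges G" "b \<in> edges G"
  shows "\<psi> ` a = \<psi> ` b \<longleftrightarrow> a = b"
  using assms edge_subset by (auto simp: inj_maps_def inj_on_image_eq_iff)

lemma card_image_edges:
  assumes "\<psi> \<in> inj_maps n G" "B \<subseteq> edges G"
  shows "card ((`) \<psi> ` B) = card B"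
  using assms image_edge_eq_iff by (intro card_image inj_onI) blast

lemma sum_rooted_maps:
  assumes "a \<in> edges G"
  shows "(\<Sum>e\<in>complete_edges n. \<Sum>\<psi>\<in>rooted_maps n G a e. F \<psi>) = (\<Sum>\<psi>\<in>inj_maps n G. F \<psi>)"
  unfolding rooted_maps_def
  by (rule sum.group[OF finite_inj_maps finite_complete_edges])
    (use assms image_edge in blast)

context
  fixes a :: "'v set" and e :: "nat set" and n :: nat
  assumes a: "a \<in> edges G" and e: "e \<in> complete_edges n"
begin

definition pinned :: "'v \<Rightarrow> 'v \<Rightarrow> nat \<Rightarrow> nat \<Rightarrow> 'v \<Rightarrow> nat set" where
  "pinned u w i j v = (if v = u then {i} else if v = w then {j} else {1..n})"

lemma edge_endpoints:
  obtains u w i j where "a = {u, w}" "u \<noteq> w" "u \<in> verts G" "w \<in> verts G"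
    "e = {i, j}" "i \<noteq> j" "i \<in> {1..n}" "j \<in> {1..n}"
proof -
  obtain u w where uw: "a = {u, w}" "u \<noteq> w"
    using card_edge[OF a] by (auto simp: card_2_iff)
  obtain i j where ij: "e = {i, j}" "i \<noteq> j"
    using e by (auto simp: complete_edges_def card_2_iff)
  show ?thesis
    using that[OF uw _ _ ij] edge_subset[OF a] e uw ij by (auto simp: complete_edges_def)
qed

section \<open>Counting embeddings with a prescribed root\<close>

lemma card_pinned:
  assumes "u \<noteq> w" "u \<in> verts G" "w \<in> verts G"
  shows "card (Pi\<^sub>E (verts G) (pinned u w i j)) = n ^ (card (verts G) - 2)"
  using card_pinned_PiE[of "{u, w}" "verts G" "pinned u w i j" n] assms finite_verts
  by (simp add: pinned_def numeral_2_eq_2)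

text \<open>Since \<open>u\<close> and \<open>w\<close> have the distinct images \<open>i\<close>
  and \<open>j\<close>, every collision involves a vertex \<open>s\<close> other than these two. Its
  value is determined by the remaining ones, which loses a factor \<open>n\<close>, and there are at
  most |V|^2 pairs that can collide.\<close>

lemma card_pinned_inj_ge:
  assumes uw: "u \<noteq> w" "u \<in> verts G" "w \<in> verts G" and ij: "i \<noteq> j"
  shows "real n ^ (card (verts G) - 2) - (real (card (verts G)))\<^sup>2 * (real n ^ (card (verts G) - 2) / real n)
    \<le> real (card {\<psi> \<in> Pi\<^sub>E (verts G) (pinned u w i j). inj_on \<psi> (verts G)})"
proof -
  let ?V = "verts G" and ?W = "Pi\<^sub>E (verts G) (pinned u w i j)"
  let ?I = "{\<psi> \<in> ?W. inj_on \<psi> ?V}"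
  let ?P = "(?V - {u, w}) \<times> ?V"
  let ?N = "\<lambda>st. {\<psi> \<in> ?W. fst st \<noteq> snd st \<and> \<psi> (fst st) = \<psi> (snd st)}"
  have n0: "n > 0"
    using e by (auto simp: complete_edges_def intro: Nat.gr0I)
  have finW: "finite ?W"
    using finite_verts by (intro finite_PiE) (auto simp: pinned_def)
  have N: "real (card (?N st)) \<le> real n ^ (card ?V - 2) / real n" if "st \<in> ?P" for st
  proof (cases "fst st = snd st")
    case False
    obtain s t where "st = (s, t)"
      by (cases st)
    with that False have st: "st = (s, t)" "s \<in> ?V" "s \<noteq> u" "s \<noteq> w" "t \<in> ?V" "s \<noteq> t"
      by auto
    have "card (?N st) \<le> card (Pi\<^sub>E (?V - {s}) (pinned u w i j))"
    proof (rule card_inj_on_le)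
      show "inj_on (\<lambda>\<psi>. restrict \<psi> (?V - {s})) (?N st)"
      proof (rule inj_onI)
        fix \<psi> \<psi>' assume *: "\<psi> \<in> ?N st" "\<psi>' \<in> ?N st"
          and eq: "restrict \<psi> (?V - {s}) = restrict \<psi>' (?V - {s})"
        have **: "\<psi> v = \<psi>' v" if "v \<in> ?V - {s}" for v
          using fun_cong[OF eq, of v] that by simp
        have "\<psi> v = \<psi>' v" if "v \<in> ?V" for v
        proof (cases "v = s")
          case True
          then show ?thesis
            using * **[of t] st by auto
        qed (use ** that in auto)
        then show "\<psi> = \<psi>'"
          using * by (intro PiE_ext[of \<psi> ?V "pinned u w i j" \<psi>']) auto
      qed
      show "(\<lambda>\<psi>. restrict \<psi> (?V - {s})) ` ?N st \<subseteq> Pi\<^sub>E (?V - {s}) (pinned u w i j)"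
        by (auto simp: PiE_iff split: if_splits)
      show "finite (Pi\<^sub>E (?V - {s}) (pinned u w i j))"
        using finite_verts by (intro finite_PiE) (auto simp: pinned_def)
    qed
    also have "\<dots> = n ^ (card (?V - {s}) - 2)"
      using card_pinned_PiE[of "{u, w}" "?V - {s}" "pinned u w i j" n] uw st finite_verts
      by (simp add: pinned_def)
    finally have le: "card (?N st) \<le> n ^ (card ?V - 3)"
      using st finite_verts by (simp add: card_Diff_singleton numeral_eq_Suc)
    have "card {u, w, s} \<le> card ?V"
      using st uw finite_verts by (intro card_mono) auto
    then have "card ?V - 2 = Suc (card ?V - 3)"
      using st uw by simp
    then have "real n ^ (card ?V - 2) / real n = real (n ^ (card ?V - 3))"
      using n0 by simp
    then show ?thesis
      using le by (simp only: of_nat_le_iff)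
  qed simp
  have "?W - ?I \<subseteq> (\<Union>st\<in>?P. ?N st)"
  proof
    fix \<psi> assume psi: "\<psi> \<in> ?W - ?I"
    then obtain s t where st: "s \<in> ?V" "t \<in> ?V" "s \<noteq> t" "\<psi> s = \<psi> t"
      by (auto simp: inj_on_def)
    have "\<psi> u = i" "\<psi> w = j"
      using psi uw by (auto simp: PiE_def Pi_def pinned_def split: if_splits)
    then have "s \<notin> {u, w} \<or> t \<notin> {u, w}"
      using st ij by auto
    then show "\<psi> \<in> (\<Union>st\<in>?P. ?N st)"
    proof
      assume "s \<notin> {u, w}"
      then show ?thesis
        using st psi by (intro UN_I[of "(s, t)"]) auto
    next
      assume "t \<notin> {u, w}"
      then show ?thesis
        using st psi by (intro UN_I[of "(t, s)"]) auto
    qed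
  qed
  then have "card (?W - ?I) \<le> card (\<Union>st\<in>?P. ?N st)"
    using finW finite_verts by (intro card_mono) auto
  also have "\<dots> \<le> (\<Sum>st\<in>?P. card (?N st))"
    using finite_verts by (intro card_UN_le) auto
  finally have "real (card (?W - ?I)) \<le> real (\<Sum>st\<in>?P. card (?N st))"
    by (simp only: of_nat_le_iff)
  also have "\<dots> \<le> (\<Sum>st\<in>?P. real n ^ (card ?V - 2) / real n)"
    using N unfolding of_nat_sum by (intro sum_mono) auto
  also have "\<dots> = real (card (?V - {u, w}) * card ?V) * (real n ^ (card ?V - 2) / real n)"
    by (simp add: card_cartesian_product)
  also have "\<dots> \<le> real (card ?V * card ?V) * (real n ^ (card ?V - 2) / real n)"
  proof (intro mult_right_mono)
    show "real (card (?V - {u, w}) * card ?V) \<le> real (card ?V * card ?V)"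
      unfolding of_nat_le_iff using finite_verts by (intro mult_right_mono card_mono) auto
  qed simp
  finally have "real (card (?W - ?I)) \<le> (real (card ?V))\<^sup>2 * (real n ^ (card ?V - 2) / real n)"
    by (simp add: power2_eq_square)
  moreover have "card (?W - ?I) + card ?I = card ?W"
    using finW by (subst card_Diff_subset) (auto intro!: le_add_diff_inverse2 card_mono)
  then have "real (card (?W - ?I)) + real (card ?I) = real n ^ (card ?V - 2)"
    using card_pinned[OF uw, of i j] by (simp only: of_nat_add[symmetric] of_nat_power[symmetric])
  ultimately show ?thesis
    by linarith
qed

lemma card_rooted_maps_le: "real (card (rooted_maps n G a e)) \<le> 2 * real n ^ (card (verts G) - 2)"
proof -
  obtain u w i j where uw: "a = {u, w}" "u \<noteq> w" "u \<in> verts G" "w \<in> verts G"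
    and ij: "e = {i, j}" "i \<noteq> j" "i \<in> {1..n}" "j \<in> {1..n}"
    by (rule edge_endpoints)
  let ?W = "\<lambda>i j. Pi\<^sub>E (verts G) (pinned u w i j)"
  have fin: "finite (?W i j)" for i j
    using finite_verts by (intro finite_PiE) (auto simp: pinned_def)
  have "rooted_maps n G a e \<subseteq> ?W i j \<union> ?W j i"
  proof
    fix \<psi> assume "\<psi> \<in> rooted_maps n G a e"
    then have *: "\<psi> \<in> verts G \<rightarrow>\<^sub>E {1..n}" "{\<psi> u, \<psi> w} = {i, j}"
      by (auto simp: rooted_maps_def inj_maps_def uw ij)
    then have "\<psi> u = i \<and> \<psi> w = j \<or> \<psi> u = j \<and> \<psi> w = i"
      by (auto simp: doubleton_eq_iff)
    then show "\<psi> \<in> ?W i j \<union> ?W j i"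
      using *(1) by (auto simp: PiE_iff pinned_def)
  qed
  then have "card (rooted_maps n G a e) \<le> card (?W i j) + card (?W j i)"
    using fin by (meson card_Un_le card_mono finite_UnI order_trans)
  also have "\<dots> = 2 * n ^ (card (verts G) - 2)"
    using card_pinned uw by simp
  finally have "real (card (rooted_maps n G a e)) \<le> real (2 * n ^ (card (verts G) - 2))"
    by (simp only: of_nat_le_iff)
  then show ?thesis
    by simp
qed

text \<open>The two orientations of the root give disjoint families of almost n^(|V| - 2) maps each.
  This is the origin of the factor 2 in \<open>mean_field_Psi\<close>.\<close>

lemma card_rooted_maps_ge:
  "2 * real n ^ (card (verts G) - 2) - 2 * (real (card (verts G)))\<^sup>2 * (real n ^ (card (verts G) - 2) / real n)
    \<le> real (card (rooted_maps n G a e))"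
proof -
  obtain u w i j where uw: "a = {u, w}" "u \<noteq> w" "u \<in> verts G" "w \<in> verts G"
    and ij: "e = {i, j}" "i \<noteq> j" "i \<in> {1..n}" "j \<in> {1..n}"
    by (rule edge_endpoints)
  let ?I = "\<lambda>i j. {\<psi> \<in> Pi\<^sub>E (verts G) (pinned u w i j). inj_on \<psi> (verts G)}"
  have fin: "finite (?I i j)" for i j
    by (rule finite_subset[of _ "Pi\<^sub>E (verts G) (pinned u w i j)"])
      (auto intro!: finite_PiE finite_verts simp: pinned_def)
  have at: "\<psi> u = i \<and> \<psi> w = j" if "\<psi> \<in> ?I i j" for \<psi> i j
    using that uw by (auto simp: PiE_iff pinned_def split: if_splits)
  have sub: "?I i j \<subseteq> rooted_maps n G a e" if "{i, j} = e" for i j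
  proof
    fix \<psi> assume psi: "\<psi> \<in> ?I i j"
    have "i \<in> {1..n}" "j \<in> {1..n}"
      using that e by (auto simp: complete_edges_def)
    then have "\<psi> \<in> verts G \<rightarrow>\<^sub>E {1..n}"
      using psi by (auto simp: PiE_iff pinned_def split: if_splits)
    then show "\<psi> \<in> rooted_maps n G a e"
      using psi at[OF psi] that by (auto simp: rooted_maps_def inj_maps_def uw)
  qed
  have "?I i j \<inter> ?I j i = {}"
    using at ij(2) by blast
  then have "card (?I i j) + card (?I j i) = card (?I i j \<union> ?I j i)"
    using fin by (intro card_Un_disjoint[symmetric]) auto
  also have "\<dots> \<le> card (rooted_maps n G a e)"
    using sub ij finite_rooted_maps by (intro card_mono) (auto simp: insert_commute)
  finally have "real (card (?I i j)) + real (card (?I j i)) \<le> real (card (rooted_maps n G a e))"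
    by (simp only: of_nat_le_iff flip: of_nat_add)
  then show ?thesis
    using card_pinned_inj_ge[OF uw(2-4) ij(2)] card_pinned_inj_ge[OF uw(2-4) ij(2)[symmetric]]
    by linarith
qed

lemma n_pos: "n > 0"
  using e by (auto simp: complete_edges_def intro: Nat.gr0I)

lemma rooted_density_le: "real (card (rooted_maps n G a e)) / real n ^ (card (verts G) - 2) \<le> 2"
proof -
  have "0 < real n ^ (card (verts G) - 2)"
    using n_pos by simp
  then show ?thesis
    using card_rooted_maps_le by (simp only: pos_divide_le_eq)
qed

lemma rooted_density_close:
  "\<bar>real (card (rooted_maps n G a e)) / real n ^ (card (verts G) - 2) - 2\<bar>
    \<le> 2 * (real (card (verts G)))\<^sup>2 / real n"
proof -
  have p: "0 < real n ^ (card (verts G) - 2)"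
    using n_pos by simp
  have "2 - 2 * (real (card (verts G)))\<^sup>2 / real n
      = (2 * real n ^ (card (verts G) - 2) - 2 * (real (card (verts G)))\<^sup>2 * (real n ^ (card (verts G) - 2) / real n))
        / real n ^ (card (verts G) - 2)"
  proof -
    have "2 - 2 * k / m = (2 * X - 2 * k * (X / m)) / X" if "0 < X" for X k m :: real
      using that by (simp add: diff_divide_distrib)
    from this[OF p] show ?thesis .
  qed
  also have "\<dots> \<le> real (card (rooted_maps n G a e)) / real n ^ (card (verts G) - 2)"
    using card_rooted_maps_ge p by (intro divide_right_mono) auto
  finally show ?thesis
    using rooted_density_le by (simp add: abs_le_iff)
qed

text \<open>An edge \<open>b\<close> other than \<open>a\<close> has a vertex \<open>z\<close>
  outside \<open>a\<close>, and its image lies in \<open>f\<close>. The three vertices have two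
  possible images each, hence 8; only |V| - 3 vertices remain free, hence the gain of 1/n.\<close>

lemma pair_count_le:
  assumes b: "b \<in> edges G" "b \<noteq> a" and f: "f \<in> complete_edges n"
  shows "pair_count n G a b e f \<le> 8 / real n"
proof -
  obtain u w i j where uw: "a = {u, w}" "u \<noteq> w" "u \<in> verts G" "w \<in> verts G"
    by (rule edge_endpoints)
  have "\<not> b \<subseteq> a"
    using card_edge[OF a] card_edge[OF b(1)] b(2) by (metis card_subset_eq card.infinite zero_neq_numeral)
  then obtain z where z: "z \<in> b" "z \<notin> a"
    by blast
  then have zV: "z \<in> verts G"
    using edge_subset[OF b(1)] by blast
  define F where "F v = (if v \<in> a then e else if v = z then f else {1..n})" for v
  have fin: "finite (Pi\<^sub>E (verts G) F)"
    using finite_verts e f by (intro finite_PiE) (auto simp: F_def complete_edges_def intro: finite_subset)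
  have "{\<psi> \<in> rooted_maps n G a e. \<psi> ` b = f} \<subseteq> Pi\<^sub>E (verts G) F"
    using z by (auto simp: rooted_maps_def inj_maps_def F_def PiE_iff intro: extensional_arb)
  then have "card {\<psi> \<in> rooted_maps n G a e. \<psi> ` b = f} \<le> card (Pi\<^sub>E (verts G) F)"
    using fin by (intro card_mono)
  also have "\<dots> = (\<Prod>v\<in>{u, w, z}. card (F v)) * n ^ (card (verts G) - card {u, w, z})"
    using uw zV finite_verts by (intro card_pinned_PiE) (auto simp: F_def)
  also have "\<dots> = 8 * n ^ (card (verts G) - 3)"
  proof -
    have "F u = e" "F w = e" "F z = f" "z \<noteq> u" "z \<noteq> w"
      using uw z unfolding F_def by auto
    moreover have "card e = 2" "card f = 2"
      using e f by (simp_all add: complete_edges_def)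
    ultimately show ?thesis
      using uw(2) by (simp add: numeral_3_eq_3)
  qed
  finally have "real (card {\<psi> \<in> rooted_maps n G a e. \<psi> ` b = f}) \<le> real (8 * n ^ (card (verts G) - 3))"
    by (simp only: of_nat_le_iff)
  then have le: "real (card {\<psi> \<in> rooted_maps n G a e. \<psi> ` b = f}) \<le> 8 * real n ^ (card (verts G) - 3)"
    by simp
  have "card {u, w, z} \<le> card (verts G)"
    using uw zV finite_verts by (intro card_mono) auto
  then have "card (verts G) - 2 = Suc (card (verts G) - 3)"
    using uw z by auto
  then show ?thesis
    unfolding pair_count_def using le n_pos by (simp add: field_simps)
qed

lemma sum_pair_count:
  assumes b: "b \<in> edges G"
  shows "(\<Sum>f\<in>complete_edges n. pair_count n G a b e f) \<le> 2"
proof -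
  have "(\<Sum>f\<in>complete_edges n. card {\<psi> \<in> rooted_maps n G a e. \<psi> ` b = f})
      = (\<Sum>f\<in>complete_edges n. \<Sum>\<psi>\<in>{\<psi> \<in> rooted_maps n G a e. \<psi> ` b = f}. 1)"
    by simp
  also have "\<dots> = (\<Sum>\<psi>\<in>rooted_maps n G a e. 1)"
    by (rule sum.group[OF finite_rooted_maps finite_complete_edges])
      (use image_edge b in \<open>auto simp: rooted_maps_def\<close>)
  finally show ?thesis
    unfolding pair_count_def sum_divide_distrib[symmetric] of_nat_sum[symmetric]
    using rooted_density_le by simp
qed

end

lemma pair_count_commute: "pair_count n G a b e f = pair_count n G b a f e"
proof -
  have "{\<psi> \<in> rooted_maps n G a e. \<psi> ` b = f} = {\<psi> \<in> rooted_maps n G b f. \<psi> ` a = e}"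
    unfolding rooted_maps_def by blast
  then show ?thesis
    unfolding pair_count_def by simp
qed

lemma pair_count_nonneg: "0 \<le> pair_count n G a b e f"
  unfolding pair_count_def by simp

section \<open>Rooted counts as functions of the configuration\<close>

lemma rooted_count_nonneg: "0 \<le> rooted_count n G a B e x"
  unfolding rooted_count_def by (intro divide_nonneg_nonneg sum_nonneg) auto

lemma rooted_count_mono: "x \<subseteq> y \<Longrightarrow> rooted_count n G a B e x \<le> rooted_count n G a B e y"
  unfolding rooted_count_def by (intro divide_right_mono sum_mono) auto

lemma rooted_count_influence:
  assumes B: "B \<subseteq> edges G"
  shows "\<bar>rooted_count n G a B e (insert f x) - rooted_count n G a B e (x - {f})\<bar>
    \<le> (\<Sum>b\<in>B. pair_count n G a b e f)"
proof -
  have finB: "finite B"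
    using B finite_edges finite_subset by blast
  let ?i = "\<lambda>\<psi> x. of_bool ((`) \<psi> ` B \<subseteq> x) :: real"
  have "?i \<psi> (insert f x) - ?i \<psi> (x - {f}) \<le> (\<Sum>b\<in>B. of_bool (\<psi> ` b = f))" for \<psi>
  proof (cases "\<exists>b\<in>B. \<psi> ` b = f")
    case True
    then obtain b where b: "b \<in> B" "\<psi> ` b = f"
      by blast
    have "(of_bool (\<psi> ` b = f) :: real) \<le> (\<Sum>b\<in>B. of_bool (\<psi> ` b = f))"
      using b finB by (intro member_le_sum) auto
    moreover have "?i \<psi> (insert f x) - ?i \<psi> (x - {f}) \<le> 1"
      by simp
    ultimately show ?thesis
      using b by simp
  next
    case False
    then have "(`) \<psi> ` B \<subseteq> insert f x \<longleftrightarrow> (`) \<psi> ` B \<subseteq> x - {f}"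
      by auto
    then show ?thesis
      by (simp add: sum_nonneg)
  qed
  then have "(\<Sum>\<psi>\<in>rooted_maps n G a e. ?i \<psi> (insert f x) - ?i \<psi> (x - {f}))
      \<le> (\<Sum>\<psi>\<in>rooted_maps n G a e. \<Sum>b\<in>B. of_bool (\<psi> ` b = f))"
    by (intro sum_mono)
  also have "\<dots> = (\<Sum>b\<in>B. real (card {\<psi> \<in> rooted_maps n G a e. \<psi> ` b = f}))"
    by (subst sum.swap) (simp add: of_bool_def sum.If_cases finite_rooted_maps Int_def)
  finally have "rooted_count n G a B e (insert f x) - rooted_count n G a B e (x - {f})
      \<le> (\<Sum>b\<in>B. pair_count n G a b e f)"
    unfolding rooted_count_def pair_count_def sum_divide_distrib[symmetric]
      diff_divide_distrib[symmetric] sum_subtractf[symmetric]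
    by (intro divide_right_mono) auto
  moreover have "rooted_count n G a B e (x - {f}) \<le> rooted_count n G a B e (insert f x)"
    by (rule rooted_count_mono) auto
  ultimately show ?thesis
    by simp
qed

lemma sum_rooted_count:
  assumes "a \<in> edges G"
  shows "(\<Sum>e\<in>complete_edges n. rooted_count n G a B e x)
    = (\<Sum>\<psi>\<in>inj_maps n G. of_bool ((`) \<psi> ` B \<subseteq> x)) / real n ^ (card (verts G) - 2)"
  unfolding rooted_count_def sum_divide_distrib[symmetric] sum_rooted_maps[OF assms] ..

text \<open>A copy of \<open>B\<close> that appears between \<open>x\<close> and \<open>y\<close>
  uses an edge \<open>f\<close> of \<open>y - x\<close> as the image of some \<open>b\<close>, and
  is charged to that pair. Summing over \<open>e\<close> releases the root \<open>a\<close>, so the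
  same maps can be counted with the root \<open>b\<close> at \<open>f\<close>.\<close>

lemma rooted_count_increment:
  assumes a: "a \<in> edges G" and B: "B \<subseteq> edges G" and xy: "x \<subseteq> y" "y \<subseteq> complete_edges n"
  shows "(\<Sum>e\<in>complete_edges n. rooted_count n G a B e y - rooted_count n G a B e x)
    \<le> (\<Sum>b\<in>B. \<Sum>f\<in>y - x. rooted_count n G b (B - {b}) f y)"
proof -
  have finB: "finite B"
    using B finite_edges finite_subset by blast
  have finy: "finite (y - x)"
    using xy finite_complete_edges finite_subset by blast
  let ?N = "real n ^ (card (verts G) - 2)"
  let ?t = "\<lambda>\<psi> b f. of_bool (\<psi> ` b = f \<and> (`) \<psi> ` (B - {b}) \<subseteq> y) :: real"
  have "of_bool ((`) \<psi> ` B \<subseteq> y) - of_bool ((`) \<psi> ` B \<subseteq> x) \<le> (\<Sum>b\<in>B. \<Sum>f\<in>y - x. ?t \<psi> b f)" for \<psi>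
  proof (cases "(`) \<psi> ` B \<subseteq> y \<and> \<not> (`) \<psi> ` B \<subseteq> x")
    case True
    then obtain b where b: "b \<in> B" "\<psi> ` b \<in> y - x"
      by blast
    have "1 = ?t \<psi> b (\<psi> ` b)"
      using True by auto
    also have "\<dots> \<le> (\<Sum>f\<in>y - x. ?t \<psi> b f)"
      using b finy by (intro member_le_sum) auto
    also have "\<dots> \<le> (\<Sum>b\<in>B. \<Sum>f\<in>y - x. ?t \<psi> b f)"
      using b finB by (intro member_le_sum[of b B "\<lambda>b. \<Sum>f\<in>y - x. ?t \<psi> b f"]) (auto intro: sum_nonneg)
    finally show ?thesis
      using True by simp
  next
    case False
    then have "of_bool ((`) \<psi> ` B \<subseteq> y) - of_bool ((`) \<psi> ` B \<subseteq> x) \<le> (0::real)"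
      by auto
    also have "\<dots> \<le> (\<Sum>b\<in>B. \<Sum>f\<in>y - x. ?t \<psi> b f)"
      by (intro sum_nonneg) auto
    finally show ?thesis .
  qed
  then have "(\<Sum>\<psi>\<in>inj_maps n G. of_bool ((`) \<psi> ` B \<subseteq> y) - of_bool ((`) \<psi> ` B \<subseteq> x)) / ?N
      \<le> (\<Sum>\<psi>\<in>inj_maps n G. \<Sum>b\<in>B. \<Sum>f\<in>y - x. ?t \<psi> b f) / ?N"
    by (intro divide_right_mono sum_mono) auto
  also have "(\<Sum>\<psi>\<in>inj_maps n G. \<Sum>b\<in>B. \<Sum>f\<in>y - x. ?t \<psi> b f)
      = (\<Sum>b\<in>B. \<Sum>f\<in>y - x. \<Sum>\<psi>\<in>inj_maps n G. ?t \<psi> b f)"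
    by (subst sum.swap, rule sum.cong[OF refl], rule sum.swap)
  also have "\<dots> = (\<Sum>b\<in>B. \<Sum>f\<in>y - x. \<Sum>\<psi>\<in>rooted_maps n G b f. of_bool ((`) \<psi> ` (B - {b}) \<subseteq> y))"
    unfolding rooted_maps_def sum.inter_filter[OF finite_inj_maps]
    by (intro sum.cong refl) auto
  finally show ?thesis
    unfolding sum_subtractf sum_rooted_count[OF a]
    by (simp add: rooted_count_def sum_divide_distrib diff_divide_distrib)
qed

lemma hom_count_eq: "hom_count n G x = (\<Sum>\<psi>\<in>inj_maps n G. of_bool ((`) \<psi> ` edges G \<subseteq> x))"
  unfolding hom_count_def inj_maps_def
  by (intro sum.cong refl) (auto simp: prod_of_bool[OF finite_edges])

text \<open>By injectivity at most one edge of \<open>G\<close> is mapped onto \<open>e\<close>, so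
  the sum over \<open>a\<close> counts each embedding at most once.\<close>

lemma hom_count_deriv:
  "hom_count n G (edge_on x e) - hom_count n G (edge_off x e)
    = (\<Sum>a\<in>edges G. \<Sum>\<psi>\<in>rooted_maps n G a e. of_bool ((`) \<psi> ` (edges G - {a}) \<subseteq> x))"
proof -
  let ?E = "edges G"
  have "of_bool ((`) \<psi> ` ?E \<subseteq> insert e x) - of_bool ((`) \<psi> ` ?E \<subseteq> x - {e})
      = (\<Sum>a\<in>?E. of_bool (\<psi> ` a = e \<and> (`) \<psi> ` (?E - {a}) \<subseteq> x) :: real)"
    if psi: "\<psi> \<in> inj_maps n G" for \<psi>
  proof (cases "\<exists>a\<in>?E. \<psi> ` a = e")
    case True
    then obtain a where a: "a \<in> ?E" "\<psi> ` a = e"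
      by blast
    have "(\<Sum>a'\<in>?E. of_bool (\<psi> ` a' = e \<and> (`) \<psi> ` (?E - {a'}) \<subseteq> x) :: real)
        = (\<Sum>a'\<in>?E. if a' = a then of_bool ((`) \<psi> ` (?E - {a}) \<subseteq> x) else 0)"
      using a image_edge_eq_iff[OF psi] by (intro sum.cong refl) auto
    also have "\<dots> = of_bool ((`) \<psi> ` (?E - {a}) \<subseteq> x)"
      using a finite_edges by simp
    also have "(`) \<psi> ` (?E - {a}) \<subseteq> x \<longleftrightarrow> (`) \<psi> ` ?E \<subseteq> insert e x"
    proof -
      have "(`) \<psi> ` ?E = insert e ((`) \<psi> ` (?E - {a}))"
        using a by (metis image_insert insert_Diff)
      moreover have "e \<notin> (`) \<psi> ` (?E - {a})"
      proof
        assume "e \<in> (`) \<psi> ` (?E - {a})"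
        then obtain b where "b \<in> ?E" "b \<noteq> a" "\<psi> ` b = e"
          by blast
        then show False
          using a image_edge_eq_iff[OF psi a(1)] by metis
      qed
      ultimately show ?thesis
        by (simp add: subset_insert)
    qed
    finally have *: "(\<Sum>a'\<in>?E. of_bool (\<psi> ` a' = e \<and> (`) \<psi> ` (?E - {a'}) \<subseteq> x) :: real)
        = of_bool ((`) \<psi> ` ?E \<subseteq> insert e x)" .
    have "e \<in> (`) \<psi> ` ?E"
      using a by (metis imageI)
    then have "\<not> (`) \<psi> ` ?E \<subseteq> x - {e}"
      by blast
    then show ?thesis
      unfolding * by simp
  next
    case False
    then have "(`) \<psi> ` ?E \<subseteq> insert e x \<longleftrightarrow> (`) \<psi> ` ?E \<subseteq> x - {e}"
      by auto
    moreover have "(\<Sum>a\<in>?E. of_bool (\<psi> ` a = e \<and> (`) \<psi> ` (?E - {a}) \<subseteq> x) :: real) = 0"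
      using False by (intro sum.neutral) auto
    ultimately show ?thesis
      by simp
  qed
  then have "hom_count n G (edge_on x e) - hom_count n G (edge_off x e)
      = (\<Sum>\<psi>\<in>inj_maps n G. \<Sum>a\<in>?E. of_bool (\<psi> ` a = e \<and> (`) \<psi> ` (?E - {a}) \<subseteq> x))"
    unfolding hom_count_eq edge_on_def edge_off_def sum_subtractf[symmetric] by (intro sum.cong refl)
  also have "\<dots> = (\<Sum>a\<in>?E. \<Sum>\<psi>\<in>inj_maps n G. of_bool (\<psi> ` a = e \<and> (`) \<psi> ` (?E - {a}) \<subseteq> x))"
    by (rule sum.swap)
  also have "\<dots> = (\<Sum>a\<in>?E. \<Sum>\<psi>\<in>rooted_maps n G a e. of_bool ((`) \<psi> ` (?E - {a}) \<subseteq> x))"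
    unfolding rooted_maps_def sum.inter_filter[OF finite_inj_maps]
    by (intro sum.cong refl) auto
  finally show ?thesis .
qed

text \<open>A graph with an edge has at least two vertices, so the integer exponent agrees with the
  truncated one; without edges both sides vanish.\<close>

lemma hom_count_deriv_scaled:
  "(hom_count n G (edge_on x e) - hom_count n G (edge_off x e)) / real n powi (int (card (verts G)) - 2)
    = (\<Sum>a\<in>edges G. rooted_count n G a (edges G - {a}) e x)"
proof (cases "edges G = {}")
  case False
  then have "2 \<le> card (verts G)"
    using card_verts_ge_2 by blast
  then have "real n powi (int (card (verts G)) - 2) = real n ^ (card (verts G) - 2)"
    by (metis int_ops(3) of_nat_diff of_nat_numeral power_int_of_nat)
  then show ?thesis
    unfolding hom_count_deriv rooted_count_def by (simp add: sum_divide_distrib)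
qed (simp add: hom_count_deriv)

end

section \<open>Exponential random graphs: mean-field behaviour\<close>

text \<open>The weight 8 (k + 1) (v + 1)^2 is made to dominate all constants attached to a single
  rooted count: the gradient bound 8 (k + 1), the density bound 2 and the approximation error 2 v^2
  + 2.\<close>

lemma size_weight_ge:
  "8 * (k + 1) \<le> 8 * (k + 1) * (real (v + 1))\<^sup>2" "2 * (real v)\<^sup>2 + 2 \<le> 8 * (k + 1) * (real (v + 1))\<^sup>2"
  if "0 \<le> k" for k :: real
proof -
  have 1: "1 \<le> (real (v + 1))\<^sup>2" "(real v)\<^sup>2 \<le> (real (v + 1))\<^sup>2"
    by (auto intro: one_le_power power_mono)
  have "8 * (k + 1) * 1 \<le> 8 * (k + 1) * (real (v + 1))\<^sup>2"
    using 1 that by (intro mult_left_mono) auto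
  then show "8 * (k + 1) \<le> 8 * (k + 1) * (real (v + 1))\<^sup>2"
    by simp
  have "8 * 1 * (real (v + 1))\<^sup>2 \<le> 8 * (k + 1) * (real (v + 1))\<^sup>2"
    using that by (intro mult_right_mono) auto
  then show "2 * (real v)\<^sup>2 + 2 \<le> 8 * (k + 1) * (real (v + 1))\<^sup>2"
    using 1 by linarith
qed

text \<open>The derivative of \<open>mean_field_Psi\<close>, written over ordered pairs of distinct
  edges so as to match \<open>total_influence\<close> term by term.\<close>

definition Psi_deriv :: "nat \<Rightarrow> (nat \<Rightarrow> 'v graph) \<Rightarrow> (nat \<Rightarrow> real) \<Rightarrow> real \<Rightarrow> real" where
  "Psi_deriv s G \<beta> p =
     (\<Sum>i=1..s. \<beta> i * (\<Sum>a\<in>edges (G i). \<Sum>b\<in>edges (G i) - {a}. 2 * p ^ (card (edges (G i)) - 2)))"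

text \<open>A generous constant independent of \<open>n\<close> that serves everywhere: two factors
  |E| + 1 cover sums over one edge or a pair of edges, and the rest is the weight of
  \<open>size_weight_ge\<close>.\<close>

definition size_const :: "nat \<Rightarrow> (nat \<Rightarrow> 'v graph) \<Rightarrow> (nat \<Rightarrow> real) \<Rightarrow> real" where
  "size_const s G \<beta> = (\<Sum>i=1..s. \<beta> i * (real (card (edges (G i)) + 1) * (real (card (edges (G i)) + 1) *
     (8 * real (card (edges (G i)) + 1) * (real (card (verts (G i)) + 1))\<^sup>2))))"

text \<open>Bounds the order of the moments that occur in fields and total influences. The recursion
  for \<open>S\<close> involves only \<open>S\<close> and \<open>S\<close> minus an edge, so moments
  up to this order can be followed by themselves.\<close>

definition max_edges :: "nat \<Rightarrow> (nat \<Rightarrow> 'v graph) \<Rightarrow> nat" where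
  "max_edges s G = (\<Sum>i=1..s. card (edges (G i)))"

locale ergm_model =
  fixes s :: nat and G :: "nat \<Rightarrow> 'v graph" and \<beta> :: "nat \<Rightarrow> real" and n :: nat
  assumes graphs: "i \<in> {1..s} \<Longrightarrow> finite_simple_graph (G i)"
    and beta_pos: "i \<in> {1..s} \<Longrightarrow> 0 < \<beta> i"
    and n_ge_2: "2 \<le> n"
begin

abbreviation C0 :: real where "C0 \<equiv> size_const s G \<beta>"

definition field :: "nat set \<Rightarrow> nat set set \<Rightarrow> real" where
  "field e x = edge_deriv e (hamiltonian s G \<beta> n) x"

definition field_influence :: "nat set \<Rightarrow> nat set \<Rightarrow> real" where
  "field_influence e f =
     (\<Sum>i=1..s. \<beta> i * (\<Sum>a\<in>edges (G i). \<Sum>b\<in>edges (G i) - {a}. pair_count n (G i) a b e f))"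

text \<open>The sum over all \<open>e\<close> of the discrete derivatives of \<open>field e\<close>
  in direction \<open>f\<close>. Unlike \<open>field_influence\<close> it depends on the
  configuration, so it can be compared with the mean-field value \<open>Psi_deriv\<close>.\<close>

definition total_influence :: "nat set \<Rightarrow> nat set set \<Rightarrow> real" where
  "total_influence f x =
     (\<Sum>i=1..s. \<beta> i * (\<Sum>a\<in>edges (G i). \<Sum>b\<in>edges (G i) - {a}.
        rooted_count n (G i) b (edges (G i) - {a} - {b}) f x))"

lemma field_eq:
  "field e x = (\<Sum>i=1..s. \<beta> i * (\<Sum>a\<in>edges (G i). rooted_count n (G i) a (edges (G i) - {a}) e x))"
  unfolding field_def edge_deriv_def hamiltonian_def sum_subtractf[symmetric]
  by (intro sum.cong refl)
    (simp add: hom_count_deriv_scaled[OF graphs, symmetric] right_diff_distrib[symmetric]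
      diff_divide_distrib[symmetric])

lemma weighted_sum_le_1:
  assumes "0 \<le> D"
    and "\<And>i a. i \<in> {1..s} \<Longrightarrow> a \<in> edges (G i) \<Longrightarrow>
      t i a \<le> 8 * real (card (edges (G i)) + 1) * (real (card (verts (G i)) + 1))\<^sup>2 * D"
  shows "(\<Sum>i=1..s. \<beta> i * (\<Sum>a\<in>edges (G i). t i a)) \<le> C0 * D"
  unfolding size_const_def sum_distrib_right
proof (intro sum_mono)
  fix i assume i: "i \<in> {1..s}"
  let ?k = "real (card (edges (G i)) + 1)" and ?u = "8 * real (card (edges (G i)) + 1) * (real (card (verts (G i)) + 1))\<^sup>2 * D"
  have u: "0 \<le> ?u"
    using assms(1) by simp
  have "(\<Sum>a\<in>edges (G i). t i a) \<le> (\<Sum>a\<in>edges (G i). ?u)"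
    using assms(2) i by (intro sum_mono)
  also have "\<dots> = real (card (edges (G i))) * ?u"
    by simp
  also have "\<dots> \<le> ?k * ?u"
    using u by (intro mult_right_mono) auto
  also have "\<dots> \<le> ?k * (?k * ?u)"
  proof (intro mult_left_mono)
    have "1 * ?u \<le> ?k * ?u"
      using u by (intro mult_right_mono) auto
    then show "?u \<le> ?k * ?u"
      by simp
  qed simp
  finally have "\<beta> i * (\<Sum>a\<in>edges (G i). t i a) \<le> \<beta> i * (?k * (?k * ?u))"
    using beta_pos[OF i] by (intro mult_left_mono) auto
  then show "\<beta> i * (\<Sum>a\<in>edges (G i). t i a) \<le> \<beta> i * (?k * (?k * (8 * ?k * (real (card (verts (G i)) + 1))\<^sup>2))) * D"
    by (simp only: mult.assoc)
qed

lemma weighted_sum_le_2: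
  assumes "0 \<le> D"
    and "\<And>i a b. i \<in> {1..s} \<Longrightarrow> a \<in> edges (G i) \<Longrightarrow> b \<in> edges (G i) - {a} \<Longrightarrow>
      t i a b \<le> 8 * real (card (edges (G i)) + 1) * (real (card (verts (G i)) + 1))\<^sup>2 * D"
  shows "(\<Sum>i=1..s. \<beta> i * (\<Sum>a\<in>edges (G i). \<Sum>b\<in>edges (G i) - {a}. t i a b)) \<le> C0 * D"
  unfolding size_const_def sum_distrib_right
proof (intro sum_mono)
  fix i assume i: "i \<in> {1..s}"
  let ?k = "real (card (edges (G i)) + 1)" and ?u = "8 * real (card (edges (G i)) + 1) * (real (card (verts (G i)) + 1))\<^sup>2 * D"
  have u: "0 \<le> ?u"
    using assms(1) by simp
  have fin: "finite (edges (G i))"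
    using finite_edges[OF graphs[OF i]] .
  have "(\<Sum>b\<in>edges (G i) - {a}. t i a b) \<le> ?k * ?u" if "a \<in> edges (G i)" for a
  proof -
    have "(\<Sum>b\<in>edges (G i) - {a}. t i a b) \<le> (\<Sum>b\<in>edges (G i) - {a}. ?u)"
      using assms(2) i that by (intro sum_mono)
    also have "\<dots> = real (card (edges (G i) - {a})) * ?u"
      by simp
    also have "\<dots> \<le> ?k * ?u"
    proof (intro mult_right_mono)
      have "card (edges (G i) - {a}) \<le> card (edges (G i))"
        using fin by (intro card_mono) auto
      then show "real (card (edges (G i) - {a})) \<le> ?k"
        by simp
    qed (rule u)
    finally show ?thesis .
  qed
  then have "(\<Sum>a\<in>edges (G i). \<Sum>b\<in>edges (G i) - {a}. t i a b) \<le> (\<Sum>a\<in>edges (G i). ?k * ?u)"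
    by (intro sum_mono)
  also have "\<dots> = real (card (edges (G i))) * (?k * ?u)"
    by simp
  also have "\<dots> \<le> ?k * (?k * ?u)"
    using u by (intro mult_right_mono mult_nonneg_nonneg[OF _ u]) auto
  finally have "\<beta> i * (\<Sum>a\<in>edges (G i). \<Sum>b\<in>edges (G i) - {a}. t i a b) \<le> \<beta> i * (?k * (?k * ?u))"
    using beta_pos[OF i] by (intro mult_left_mono) auto
  then show "\<beta> i * (\<Sum>a\<in>edges (G i). \<Sum>b\<in>edges (G i) - {a}. t i a b)
      \<le> \<beta> i * (?k * (?k * (8 * ?k * (real (card (verts (G i)) + 1))\<^sup>2))) * D"
    by (simp only: mult.assoc)
qed

lemma field_insert: "field e (insert e x) = field e x"
  unfolding field_def edge_deriv_def edge_on_def edge_off_def by simp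

lemma field_mono: "x \<subseteq> y \<Longrightarrow> field e x \<le> field e y"
  unfolding field_eq using beta_pos
  by (intro sum_mono mult_left_mono) (auto intro: rooted_count_mono[OF graphs] less_imp_le)

lemma field_nonneg: "0 \<le> field e x"
  unfolding field_eq using beta_pos
  by (intro sum_nonneg mult_nonneg_nonneg) (auto intro: rooted_count_nonneg[OF graphs] less_imp_le)

lemma field_influence_nonneg: "0 \<le> field_influence e f"
  unfolding field_influence_def using beta_pos
  by (intro sum_nonneg mult_nonneg_nonneg) (auto intro: pair_count_nonneg[OF graphs] less_imp_le)

lemma field_diff_le: "\<bar>field e (insert f x) - field e (x - {f})\<bar> \<le> field_influence e f"
proof -
  have "\<bar>field e (insert f x) - field e (x - {f})\<bar> \<le> (\<Sum>i=1..s. \<bar>\<beta> i * (\<Sum>a\<in>edges (G i).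
      rooted_count n (G i) a (edges (G i) - {a}) e (insert f x)
      - rooted_count n (G i) a (edges (G i) - {a}) e (x - {f}))\<bar>)"
    unfolding field_eq sum_subtractf[symmetric] right_diff_distrib[symmetric] by (rule sum_abs)
  also have "\<dots> \<le> field_influence e f"
    unfolding field_influence_def
  proof (intro sum_mono)
    fix i assume i: "i \<in> {1..s}"
    show "\<bar>\<beta> i * (\<Sum>a\<in>edges (G i). rooted_count n (G i) a (edges (G i) - {a}) e (insert f x)
      - rooted_count n (G i) a (edges (G i) - {a}) e (x - {f}))\<bar>
      \<le> \<beta> i * (\<Sum>a\<in>edges (G i). \<Sum>b\<in>edges (G i) - {a}. pair_count n (G i) a b e f)"
      unfolding abs_mult using beta_pos[OF i] rooted_count_influence[OF graphs[OF i]]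
      by (auto intro!: mult_left_mono order_trans[OF sum_abs] sum_mono)
  qed
  finally show ?thesis .
qed

lemma sum_field_influence:
  assumes "e \<in> complete_edges n"
  shows "(\<Sum>f\<in>complete_edges n. field_influence e f) \<le> C0"
proof -
  have "(\<Sum>f\<in>complete_edges n. field_influence e f)
      = (\<Sum>i=1..s. \<beta> i * (\<Sum>a\<in>edges (G i). \<Sum>b\<in>edges (G i) - {a}. \<Sum>f\<in>complete_edges n. pair_count n (G i) a b e f))"
    unfolding field_influence_def by (simp only: sum_distrib_left sum.swap[of _ _ "complete_edges n"])
  also have "\<dots> \<le> C0 * 1"
  proof (rule weighted_sum_le_2)
    fix i a b assume i: "i \<in> {1..s}" and a: "a \<in> edges (G i)" and b: "b \<in> edges (G i) - {a}"
    have "(\<Sum>f\<in>complete_edges n. pair_count n (G i) a b e f) \<le> 2"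
      using sum_pair_count[OF graphs[OF i] a assms] b by blast
    also have "\<dots> \<le> 8 * real (card (edges (G i)) + 1) * (real (card (verts (G i)) + 1))\<^sup>2 * 1"
      using size_weight_ge(2)[of "real (card (edges (G i)))" "card (verts (G i))"]
      by (simp add: add.commute) (smt (verit) zero_le_power2)
    finally show "(\<Sum>f\<in>complete_edges n. pair_count n (G i) a b e f)
      \<le> 8 * real (card (edges (G i)) + 1) * (real (card (verts (G i)) + 1))\<^sup>2 * 1" .
  qed simp
  finally show ?thesis
    by simp
qed

text \<open>Exchange of the edges \<open>a\<close> and \<open>b\<close>. It lets the row bound
  \<open>sum_field_influence\<close> serve for the columns as well.\<close>

lemma field_influence_commute: "field_influence e f = field_influence f e"
proof -
  have "(\<Sum>a\<in>edges (G i). \<Sum>b\<in>edges (G i) - {a}. pair_count n (G i) a b e f)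
      = (\<Sum>a\<in>edges (G i). \<Sum>b\<in>edges (G i) - {a}. pair_count n (G i) a b f e)" if i: "i \<in> {1..s}" for i
  proof -
    have fin: "finite (edges (G i))"
      using finite_edges[OF graphs[OF i]] .
    have eq: "edges (G i) - {a} = {b \<in> edges (G i). a \<noteq> b}" "edges (G i) - {a} = {b \<in> edges (G i). b \<noteq> a}" for a
      by auto
    have "(\<Sum>a\<in>edges (G i). \<Sum>b\<in>edges (G i) - {a}. pair_count n (G i) a b e f)
        = (\<Sum>b\<in>edges (G i). \<Sum>a | a \<in> edges (G i) \<and> a \<noteq> b. pair_count n (G i) a b e f)"
      unfolding eq(1) by (rule sum.swap_restrict[OF fin fin])
    also have "\<dots> = (\<Sum>b\<in>edges (G i). \<Sum>a\<in>edges (G i) - {b}. pair_count n (G i) b a f e)"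
      unfolding eq(2) using pair_count_commute[OF graphs[OF i]] by (intro sum.cong refl)
    finally show ?thesis .
  qed
  then show ?thesis
    unfolding field_influence_def by (intro sum.cong refl) simp
qed

lemma complete_edges_nonempty: "complete_edges n \<noteq> {}"
proof -
  have "{1, 2} \<in> complete_edges n"
    using n_ge_2 by (auto simp: complete_edges_def)
  then show ?thesis
    by blast
qed

sublocale heat_bath_influence "complete_edges n" "\<lambda>e x. logistic (field e x)" field_influence C0
proof
  show "finite (complete_edges n)"
    by (rule finite_complete_edges)
  show "complete_edges n \<noteq> {}"
    by (rule complete_edges_nonempty)
  show "0 \<le> logistic (field e x)" "logistic (field e x) \<le> 1" for e x
    using logistic_pos logistic_less_1 by (auto intro: less_imp_le)
  show "logistic (field e (insert e x)) = logistic (field e x)" for e x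
    by (simp add: field_insert)
  show "logistic (field e x) \<le> logistic (field e y)" if "x \<subseteq> y" for e x y
    using that by (intro logistic_mono field_mono)
  show "0 \<le> field_influence e f" for e f
    by (rule field_influence_nonneg)
  show "\<bar>logistic (field e' (insert e x)) - logistic (field e' (x - {e}))\<bar> \<le> field_influence e' e" for e' e x
    by (rule order_trans[OF logistic_lipschitz field_diff_le])
  show "(\<Sum>f\<in>complete_edges n. field_influence e f) \<le> C0" if "e \<in> complete_edges n" for e
    by (rule sum_field_influence[OF that])
  show "(\<Sum>f\<in>complete_edges n. field_influence f e) \<le> C0" if "e \<in> complete_edges n" for e
    using sum_field_influence[OF that] by (simp only: field_influence_commute[of _ e])
qed

section \<open>Gradients of fields and total influences, and their mean-field values\<close>

lemma lip_bounded_rooted_count: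
  assumes i: "i \<in> {1..s}" and a: "a \<in> edges (G i)" and B: "B \<subseteq> edges (G i) - {a}"
    and e: "e \<in> complete_edges n"
  shows "lip_bounded (rooted_count n (G i) a B e)
    (8 * real (card (edges (G i)) + 1) / real n) (8 * real (card (edges (G i)) + 1))"
proof -
  note Gi = graphs[OF i]
  have cardB: "real (card B) \<le> real (card (edges (G i)) + 1)"
  proof -
    have "card B \<le> card (edges (G i))"
      using B finite_edges[OF Gi] by (intro card_mono) auto
    then show ?thesis
      by simp
  qed
  let ?L = "\<lambda>f. \<Sum>b\<in>B. pair_count n (G i) a b e f"
  have "0 \<le> ?L f \<and> ?L f \<le> 8 * real (card (edges (G i)) + 1) / real n" if f: "f \<in> complete_edges n" for f
  proof
    show "0 \<le> ?L f"
      using pair_count_nonneg[OF Gi] by (intro sum_nonneg)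
    have "?L f \<le> (\<Sum>b\<in>B. 8 / real n)"
      using pair_count_le[OF Gi a e _ _ f] B by (intro sum_mono) blast
    also have "\<dots> = real (card B) * (8 / real n)"
      by simp
    also have "\<dots> \<le> real (card (edges (G i)) + 1) * (8 / real n)"
      using cardB by (intro mult_right_mono) auto
    finally show "?L f \<le> 8 * real (card (edges (G i)) + 1) / real n"
      by (simp add: mult.commute)
  qed
  moreover have "(\<Sum>f\<in>complete_edges n. ?L f) \<le> 8 * real (card (edges (G i)) + 1)"
  proof -
    have "(\<Sum>f\<in>complete_edges n. ?L f) = (\<Sum>b\<in>B. \<Sum>f\<in>complete_edges n. pair_count n (G i) a b e f)"
      by (rule sum.swap)
    also have "\<dots> \<le> (\<Sum>b\<in>B. 2)"
      using sum_pair_count[OF Gi a e] B by (intro sum_mono) blast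
    finally show ?thesis
      using cardB by simp
  qed
  moreover have "\<bar>rooted_count n (G i) a B e (insert f x) - rooted_count n (G i) a B e (x - {f})\<bar> \<le> ?L f" for f x
    using rooted_count_influence[OF Gi] B by blast
  ultimately show ?thesis
    unfolding lip_bounded_def by (intro exI[of _ ?L]) blast
qed

lemma lip_bounded_field:
  assumes e: "e \<in> complete_edges n"
  shows "lip_bounded (field e) (C0 / real n) C0"
proof -
  let ?k = "\<lambda>i. 8 * real (card (edges (G i)) + 1)"
  have w: "?k i * D \<le> 8 * real (card (edges (G i)) + 1) * (real (card (verts (G i)) + 1))\<^sup>2 * D"
    if "0 \<le> D" for i D
    using size_weight_ge(1)[of "real (card (edges (G i)))" "card (verts (G i))"] that
    by (intro mult_right_mono) (simp_all add: add.commute)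
  have "lip_bounded (\<lambda>x. \<Sum>i=1..s. \<beta> i * (\<Sum>a\<in>edges (G i). rooted_count n (G i) a (edges (G i) - {a}) e x))
      (\<Sum>i=1..s. \<bar>\<beta> i\<bar> * (\<Sum>a\<in>edges (G i). ?k i / real n)) (\<Sum>i=1..s. \<bar>\<beta> i\<bar> * (\<Sum>a\<in>edges (G i). ?k i))"
    using finite_edges[OF graphs] e
    by (intro lip_bounded_sum lip_bounded_cmult lip_bounded_rooted_count) auto
  moreover have "(\<Sum>i=1..s. \<bar>\<beta> i\<bar> * (\<Sum>a\<in>edges (G i). ?k i / real n)) \<le> C0 * (1 / real n)"
    using weighted_sum_le_1[of "1 / real n" "\<lambda>i a. ?k i / real n"] w[of "1 / real n"] beta_pos
    by (simp add: less_imp_le)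
  moreover have "(\<Sum>i=1..s. \<bar>\<beta> i\<bar> * (\<Sum>a\<in>edges (G i). ?k i)) \<le> C0 * 1"
    using weighted_sum_le_1[of "1" "\<lambda>i a. ?k i"] w[of "1"] beta_pos
    by (simp add: less_imp_le)
  ultimately show ?thesis
    unfolding field_eq[abs_def] by (auto intro: lip_bounded_mono)
qed

lemma lip_bounded_total_influence:
  assumes f: "f \<in> complete_edges n"
  shows "lip_bounded (total_influence f) (C0 / real n) C0"
proof -
  let ?k = "\<lambda>i. 8 * real (card (edges (G i)) + 1)"
  have w: "?k i * D \<le> 8 * real (card (edges (G i)) + 1) * (real (card (verts (G i)) + 1))\<^sup>2 * D"
    if "0 \<le> D" for i D
    using size_weight_ge(1)[of "real (card (edges (G i)))" "card (verts (G i))"] that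
    by (intro mult_right_mono) (simp_all add: add.commute)
  have "lip_bounded (\<lambda>x. \<Sum>i=1..s. \<beta> i * (\<Sum>a\<in>edges (G i). \<Sum>b\<in>edges (G i) - {a}.
        rooted_count n (G i) b (edges (G i) - {a} - {b}) f x))
      (\<Sum>i=1..s. \<bar>\<beta> i\<bar> * (\<Sum>a\<in>edges (G i). \<Sum>b\<in>edges (G i) - {a}. ?k i / real n))
      (\<Sum>i=1..s. \<bar>\<beta> i\<bar> * (\<Sum>a\<in>edges (G i). \<Sum>b\<in>edges (G i) - {a}. ?k i))"
    using finite_edges[OF graphs] f
    by (intro lip_bounded_sum lip_bounded_cmult lip_bounded_rooted_count) auto
  moreover have "(\<Sum>i=1..s. \<bar>\<beta> i\<bar> * (\<Sum>a\<in>edges (G i). \<Sum>b\<in>edges (G i) - {a}. ?k i / real n)) \<le> C0 * (1 / real n)"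
    using weighted_sum_le_2[of "1 / real n" "\<lambda>i a b. ?k i / real n"] w[of "1 / real n"] beta_pos
    by (simp add: less_imp_le)
  moreover have "(\<Sum>i=1..s. \<bar>\<beta> i\<bar> * (\<Sum>a\<in>edges (G i). \<Sum>b\<in>edges (G i) - {a}. ?k i)) \<le> C0 * 1"
    using weighted_sum_le_2[of "1" "\<lambda>i a b. ?k i"] w[of "1"] beta_pos
    by (simp add: less_imp_le)
  ultimately show ?thesis
    unfolding total_influence_def[abs_def] by (auto intro: lip_bounded_mono)
qed

lemma total_influence_mono: "x \<subseteq> y \<Longrightarrow> total_influence f x \<le> total_influence f y"
  unfolding total_influence_def using beta_pos
  by (intro sum_mono mult_left_mono) (auto intro: rooted_count_mono[OF graphs] less_imp_le)

lemma sum_field_increment: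
  assumes xy: "x \<subseteq> y" "y \<subseteq> complete_edges n"
  shows "(\<Sum>e\<in>complete_edges n. field e y - field e x) \<le> (\<Sum>f\<in>y - x. total_influence f y)"
proof -
  let ?R = "\<lambda>i a e x. rooted_count n (G i) a (edges (G i) - {a}) e x"
  have "(\<Sum>e\<in>complete_edges n. field e y - field e x)
      = (\<Sum>i=1..s. \<beta> i * (\<Sum>a\<in>edges (G i). \<Sum>e\<in>complete_edges n. ?R i a e y - ?R i a e x))"
    unfolding field_eq sum_subtractf[symmetric] right_diff_distrib[symmetric]
    by (simp only: sum_distrib_left sum.swap[of _ _ "complete_edges n"])
  also have "\<dots> \<le> (\<Sum>i=1..s. \<beta> i * (\<Sum>a\<in>edges (G i). \<Sum>b\<in>edges (G i) - {a}. \<Sum>f\<in>y - x.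
      rooted_count n (G i) b (edges (G i) - {a} - {b}) f y))"
    using beta_pos xy
    by (intro sum_mono mult_left_mono rooted_count_increment[OF graphs]) (auto intro: less_imp_le)
  also have "\<dots> = (\<Sum>f\<in>y - x. total_influence f y)"
    unfolding total_influence_def by (simp only: sum_distrib_left sum.swap[of _ _ "y - x"])
  finally show ?thesis .
qed

text \<open>The expected count is a sum of moments over the images of \<open>B\<close>, all of the
  same size by injectivity. Their number divided by n^(|V| - 2) is 2 up to O(1/n), and each moment
  is within \<open>D\<close> of the power of \<open>u\<close>.\<close>

lemma iter_rooted_count_close:
  assumes i: "i \<in> {1..s}" and a: "a \<in> edges (G i)" and B: "B \<subseteq> edges (G i) - {a}"
    and e: "e \<in> complete_edges n" and u: "0 \<le> u" "u \<le> 1"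
    and D: "\<And>S. S \<subseteq> complete_edges n \<Longrightarrow> card S \<le> max_edges s G \<Longrightarrow>
      \<bar>iter t (\<lambda>x. of_bool (S \<subseteq> x)) x0 - u ^ card S\<bar> \<le> D"
  shows "\<bar>iter t (rooted_count n (G i) a B e) x0 - 2 * u ^ card B\<bar>
    \<le> 8 * real (card (edges (G i)) + 1) * (real (card (verts (G i)) + 1))\<^sup>2 * (D + 1 / real n)"
proof -
  note Gi = graphs[OF i]
  let ?N = "real n ^ (card (verts (G i)) - 2)" and ?R = "rooted_maps n (G i) a e"
  let ?m = "\<lambda>\<psi>. iter t (\<lambda>x. of_bool ((`) \<psi> ` B \<subseteq> x)) x0"
  have N: "0 < ?N"
    using n_ge_2 by simp
  have D0: "0 \<le> D"
    using D[of "{}"] by force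
  have "card B \<le> card (edges (G i))"
    using B finite_edges[OF Gi] by (intro card_mono) auto
  also have "\<dots> \<le> max_edges s G"
    unfolding max_edges_def using i by (intro member_le_sum) auto
  finally have cardB: "card B \<le> max_edges s G" .
  have m: "\<bar>?m \<psi> - u ^ card B\<bar> \<le> D" if "\<psi> \<in> ?R" for \<psi>
  proof -
    have psi: "\<psi> \<in> inj_maps n (G i)"
      using that by (simp add: rooted_maps_def)
    have "(`) \<psi> ` B \<subseteq> complete_edges n"
      using image_edge[OF Gi psi] B by blast
    moreover have "card ((`) \<psi> ` B) = card B"
      using card_image_edges[OF Gi psi] B by blast
    ultimately show ?thesis
      using D cardB by metis
  qed
  have "iter t (rooted_count n (G i) a B e) x0 = (\<Sum>\<psi>\<in>?R. ?m \<psi>) / ?N"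
    unfolding rooted_count_def[abs_def] by (simp only: iter_divide iter_sum)
  also have "\<dots> = (\<Sum>\<psi>\<in>?R. ?m \<psi> - u ^ card B) / ?N + real (card ?R) / ?N * u ^ card B"
    by (simp add: sum_subtractf diff_divide_distrib)
  finally have eq: "iter t (rooted_count n (G i) a B e) x0 - 2 * u ^ card B
      = (\<Sum>\<psi>\<in>?R. ?m \<psi> - u ^ card B) / ?N + (real (card ?R) / ?N - 2) * u ^ card B"
    by (simp add: left_diff_distrib)
  have "\<bar>\<Sum>\<psi>\<in>?R. ?m \<psi> - u ^ card B\<bar> \<le> real (card ?R) * D"
    by (intro order_trans[OF sum_abs] sum_bounded_above m)
  then have "\<bar>(\<Sum>\<psi>\<in>?R. ?m \<psi> - u ^ card B) / ?N\<bar> \<le> real (card ?R) / ?N * D"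
    using N by (simp add: divide_right_mono)
  also have "\<dots> \<le> 2 * D"
    using rooted_density_le[OF Gi a e] D0 by (intro mult_right_mono)
  finally have 1: "\<bar>(\<Sum>\<psi>\<in>?R. ?m \<psi> - u ^ card B) / ?N\<bar> \<le> 2 * D" .
  have "\<bar>(real (card ?R) / ?N - 2) * u ^ card B\<bar> \<le> 2 * (real (card (verts (G i))))\<^sup>2 / real n * 1"
    unfolding abs_mult using rooted_density_close[OF Gi a e] u
    by (intro mult_mono) (auto intro: power_le_one)
  then have 2: "\<bar>(real (card ?R) / ?N - 2) * u ^ card B\<bar> \<le> 2 * (real (card (verts (G i))))\<^sup>2 * (1 / real n)"
    by simp
  have "\<bar>iter t (rooted_count n (G i) a B e) x0 - 2 * u ^ card B\<bar>
      \<le> 2 * D + 2 * (real (card (verts (G i))))\<^sup>2 * (1 / real n)"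
    unfolding eq by (intro order_trans[OF abs_triangle_ineq] add_mono 1 2)
  also have "\<dots> \<le> (2 * (real (card (verts (G i))))\<^sup>2 + 2) * (D + 1 / real n)"
    using D0 by (simp add: algebra_simps)
  also have "\<dots> \<le> 8 * (real (card (edges (G i))) + 1) * (real (card (verts (G i)) + 1))\<^sup>2 * (D + 1 / real n)"
    using D0 by (intro mult_right_mono size_weight_ge(2)) auto
  finally show ?thesis
    by (simp only: of_nat_add of_nat_1)
qed

lemma iter_field_close:
  assumes e: "e \<in> complete_edges n" and u: "0 \<le> u" "u \<le> 1"
    and D: "\<And>S. S \<subseteq> complete_edges n \<Longrightarrow> card S \<le> max_edges s G \<Longrightarrow>
      \<bar>iter t (\<lambda>x. of_bool (S \<subseteq> x)) x0 - u ^ card S\<bar> \<le> D"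
  shows "\<bar>iter t (field e) x0 - mean_field_Psi s G \<beta> u\<bar> \<le> C0 * (D + 1 / real n)"
proof -
  have D0: "0 \<le> D"
    using D[of "{}"] by force
  let ?R = "\<lambda>i a. iter t (rooted_count n (G i) a (edges (G i) - {a}) e) x0"
  let ?p = "\<lambda>i a. 2 * u ^ card (edges (G i) - {a})"
  have Psi: "mean_field_Psi s G \<beta> u = (\<Sum>i=1..s. \<beta> i * (\<Sum>a\<in>edges (G i). ?p i a))"
    unfolding mean_field_Psi_def
  proof (intro sum.cong refl)
    fix i assume i: "i \<in> {1..s}"
    have "(\<Sum>a\<in>edges (G i). ?p i a) = (\<Sum>a\<in>edges (G i). 2 * u ^ (card (edges (G i)) - 1))"
      using finite_edges[OF graphs[OF i]] by (intro sum.cong refl) simp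
    then show "2 * \<beta> i * real (card (edges (G i))) * u ^ (card (edges (G i)) - 1)
        = \<beta> i * (\<Sum>a\<in>edges (G i). ?p i a)"
      by simp
  qed
  have "field e = (\<lambda>x. \<Sum>i=1..s. \<beta> i * (\<Sum>a\<in>edges (G i). rooted_count n (G i) a (edges (G i) - {a}) e x))"
    by (rule ext) (rule field_eq)
  then have "iter t (field e) x0 = iter t (\<lambda>x. \<Sum>i=1..s. \<beta> i *
      (\<Sum>a\<in>edges (G i). rooted_count n (G i) a (edges (G i) - {a}) e x)) x0"
    by (rule arg_cong)
  also have "\<dots> = (\<Sum>i=1..s. \<beta> i * (\<Sum>a\<in>edges (G i). ?R i a))"
    by (simp only: iter_sum iter_cmult)
  finally have "\<bar>iter t (field e) x0 - mean_field_Psi s G \<beta> u\<bar>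
      = \<bar>\<Sum>i=1..s. \<beta> i * (\<Sum>a\<in>edges (G i). ?R i a - ?p i a)\<bar>"
    unfolding Psi by (simp only: sum_subtractf right_diff_distrib)
  also have "\<dots> \<le> (\<Sum>i=1..s. \<beta> i * (\<Sum>a\<in>edges (G i). \<bar>?R i a - ?p i a\<bar>))"
    using beta_pos by (intro order_trans[OF sum_abs] sum_mono)
      (auto simp: abs_mult less_imp_le intro!: mult_left_mono)
  also have "\<dots> \<le> C0 * (D + 1 / real n)"
    using D0 by (intro weighted_sum_le_1 iter_rooted_count_close e u D) auto
  finally show ?thesis .
qed

lemma iter_total_influence_close:
  assumes f: "f \<in> complete_edges n" and u: "0 \<le> u" "u \<le> 1"
    and D: "\<And>S. S \<subseteq> complete_edges n \<Longrightarrow> card S \<le> max_edges s G \<Longrightarrow>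
      \<bar>iter t (\<lambda>x. of_bool (S \<subseteq> x)) x0 - u ^ card S\<bar> \<le> D"
  shows "\<bar>iter t (total_influence f) x0 - Psi_deriv s G \<beta> u\<bar> \<le> C0 * (D + 1 / real n)"
proof -
  have D0: "0 \<le> D"
    using D[of "{}"] by force
  let ?R = "\<lambda>i a b. iter t (rooted_count n (G i) b (edges (G i) - {a} - {b}) f) x0"
  let ?p = "\<lambda>i a b. 2 * u ^ card (edges (G i) - {a} - {b})"
  have Psi: "Psi_deriv s G \<beta> u = (\<Sum>i=1..s. \<beta> i * (\<Sum>a\<in>edges (G i). \<Sum>b\<in>edges (G i) - {a}. ?p i a b))"
    unfolding Psi_deriv_def
  proof (intro sum.cong refl)
    fix i assume i: "i \<in> {1..s}"
    have "(\<Sum>a\<in>edges (G i). \<Sum>b\<in>edges (G i) - {a}. 2 * u ^ (card (edges (G i)) - 2))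
        = (\<Sum>a\<in>edges (G i). \<Sum>b\<in>edges (G i) - {a}. ?p i a b)"
      using finite_edges[OF graphs[OF i]] by (intro sum.cong refl) (simp add: numeral_2_eq_2)
    then show "\<beta> i * (\<Sum>a\<in>edges (G i). \<Sum>b\<in>edges (G i) - {a}. 2 * u ^ (card (edges (G i)) - 2))
        = \<beta> i * (\<Sum>a\<in>edges (G i). \<Sum>b\<in>edges (G i) - {a}. ?p i a b)"
      by simp
  qed
  have "iter t (total_influence f) x0 = (\<Sum>i=1..s. \<beta> i * (\<Sum>a\<in>edges (G i). \<Sum>b\<in>edges (G i) - {a}. ?R i a b))"
    unfolding total_influence_def[abs_def] by (simp only: iter_sum iter_cmult)
  then have "\<bar>iter t (total_influence f) x0 - Psi_deriv s G \<beta> u\<bar>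
      = \<bar>\<Sum>i=1..s. \<beta> i * (\<Sum>a\<in>edges (G i). \<Sum>b\<in>edges (G i) - {a}. ?R i a b - ?p i a b)\<bar>"
    unfolding Psi by (simp only: sum_subtractf right_diff_distrib)
  also have "\<dots> \<le> (\<Sum>i=1..s. \<beta> i * (\<Sum>a\<in>edges (G i). \<Sum>b\<in>edges (G i) - {a}. \<bar>?R i a b - ?p i a b\<bar>))"
    using beta_pos by (intro order_trans[OF sum_abs] sum_mono)
      (auto simp: abs_mult less_imp_le intro!: mult_left_mono order_trans[OF sum_abs] sum_mono)
  also have "\<dots> \<le> C0 * (D + 1 / real n)"
    using D0 by (intro weighted_sum_le_2 iter_rooted_count_close f u D) auto
  finally show ?thesis .
qed

section \<open>Mean-field recursion for the moments\<close>

text \<open>The Euler scheme with step 1 / M for the differential equation p' = phi(p) - p, where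
  phi is \<open>mean_field_phi\<close>.\<close>

definition euler :: "real \<Rightarrow> real" where
  "euler p = p + (mean_field_phi s G \<beta> p - p) / M"

lemma euler_bounds:
  assumes "0 \<le> p" "p \<le> 1"
  shows "0 \<le> euler p" "euler p \<le> 1" "\<bar>(mean_field_phi s G \<beta> p - p) / M\<bar> \<le> 1 / M"
proof -
  have phi: "0 < mean_field_phi s G \<beta> p" "mean_field_phi s G \<beta> p < 1"
    unfolding mean_field_phi_def by (rule logistic_pos logistic_less_1)+
  have e: "euler p = (1 - 1 / M) * p + (1 / M) * mean_field_phi s G \<beta> p"
    unfolding euler_def by (simp add: algebra_simps diff_divide_distrib)
  have "0 \<le> 1 - 1 / M" "0 \<le> 1 / M"
    using M_ge_1 by auto
  then show "0 \<le> euler p"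
    unfolding e using assms phi by (intro add_nonneg_nonneg mult_nonneg_nonneg) auto
  have "(1 - 1 / M) * p + (1 / M) * mean_field_phi s G \<beta> p \<le> (1 - 1 / M) * 1 + (1 / M) * 1"
    using assms phi \<open>0 \<le> 1 - 1 / M\<close> by (intro add_mono mult_left_mono) auto
  then show "euler p \<le> 1"
    unfolding e by simp
  show "\<bar>(mean_field_phi s G \<beta> p - p) / M\<bar> \<le> 1 / M"
    using assms phi M_pos by (simp add: divide_right_mono)
qed

lemma euler_iter_bounds: "0 \<le> p \<Longrightarrow> p \<le> 1 \<Longrightarrow> 0 \<le> (euler ^^ t) p \<and> (euler ^^ t) p \<le> 1"
  by (induction t) (auto intro: euler_bounds)

text \<open>As the field has small mean absolute deviation, its logistic image may be replaced by
  the constant phi(u) inside the expectation, which decouples it from the indicator. What remains is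
  the linearisation of the power of \<open>euler u\<close> at \<open>u\<close>.\<close>

lemma moment_step:
  assumes S: "S \<subseteq> complete_edges n" "card S \<le> max_edges s G" and u: "0 \<le> u" "u \<le> 1"
    and x0: "x0 \<subseteq> complete_edges n"
    and D: "\<And>S. S \<subseteq> complete_edges n \<Longrightarrow> card S \<le> max_edges s G \<Longrightarrow>
      \<bar>iter t (\<lambda>x. of_bool (S \<subseteq> x)) x0 - u ^ card S\<bar> \<le> D"
    and eta: "\<And>e. e \<in> complete_edges n \<Longrightarrow> iter t (\<lambda>x. \<bar>field e x - iter t (field e) x0\<bar>) x0 \<le> \<eta>"
  shows "\<bar>iter (Suc t) (\<lambda>x. of_bool (S \<subseteq> x)) x0 - euler u ^ card S\<bar>
    \<le> D + real (max_edges s G) * (\<eta> + C0 / real n + (C0 + 1) * D) / M + (real (max_edges s G))\<^sup>2 / M\<^sup>2"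
proof -
  let ?k = "card S" and ?K = "real (max_edges s G)" and ?phi = "mean_field_phi s G \<beta> u"
  let ?m = "\<lambda>S. iter t (\<lambda>x. of_bool (S \<subseteq> x)) x0"
  let ?d = "(?phi - u) / M"
  let ?Q = "\<eta> + C0 / real n + (C0 + 1) * D"
  let ?q = "\<lambda>e. iter t (\<lambda>x. logistic (field e x) * of_bool (S - {e} \<subseteq> x)) x0"
  have finS: "finite S"
    using S finite_complete_edges finite_subset by blast
  have D0: "0 \<le> D"
    using D[of "{}"] by force
  have kM: "real ?k \<le> M"
    using card_mono[OF finite_complete_edges S(1)] by simp
  have phi: "0 \<le> ?phi" "?phi \<le> 1"
    unfolding mean_field_phi_def using logistic_pos logistic_less_1 by (auto intro: less_imp_le)
  have q: "\<bar>?q e - ?phi * u ^ (?k - 1)\<bar> \<le> ?Q" if e: "e \<in> S" for e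
  proof -
    have eE: "e \<in> complete_edges n"
      using e S by blast
    have cS: "card (S - {e}) = ?k - 1"
      using e finS by simp
    have "\<bar>logistic (field e x) * of_bool (S - {e} \<subseteq> x) - ?phi * of_bool (S - {e} \<subseteq> x)\<bar>
        \<le> \<bar>field e x - iter t (field e) x0\<bar> + C0 * (D + 1 / real n)" for x
    proof -
      have "\<bar>(logistic (field e x) - ?phi) * of_bool (S - {e} \<subseteq> x)\<bar> \<le> \<bar>logistic (field e x) - ?phi\<bar>"
        by (simp add: abs_mult)
      also have "\<dots> \<le> \<bar>field e x - mean_field_Psi s G \<beta> u\<bar>"
        unfolding mean_field_phi_def by (rule logistic_lipschitz)
      also have "\<dots> \<le> \<bar>field e x - iter t (field e) x0\<bar> + C0 * (D + 1 / real n)"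
        using iter_field_close[OF eE u D] by linarith
      finally show ?thesis
        by (simp only: left_diff_distrib)
    qed
    from iter_abs_le[OF this x0, of t]
    have "\<bar>?q e - ?phi * ?m (S - {e})\<bar> \<le> iter t (\<lambda>x. \<bar>field e x - iter t (field e) x0\<bar>) x0 + C0 * (D + 1 / real n)"
      by (simp only: iter_diff iter_add iter_const iter_cmult)
    then have 1: "\<bar>?q e - ?phi * ?m (S - {e})\<bar> \<le> \<eta> + C0 * (D + 1 / real n)"
      using eta[OF eE] by linarith
    have "\<bar>?m (S - {e}) - u ^ card (S - {e})\<bar> \<le> D"
      using S cS by (intro D) auto
    then have "\<bar>?phi * (?m (S - {e}) - u ^ (?k - 1))\<bar> \<le> 1 * D"
      unfolding abs_mult cS using phi D0 by (intro mult_mono) auto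
    then have 2: "\<bar>?phi * ?m (S - {e}) - ?phi * u ^ (?k - 1)\<bar> \<le> D"
      by (simp only: right_diff_distrib mult_1_left)
    have "?Q = \<eta> + C0 * (D + 1 / real n) + D"
      by (simp add: algebra_simps)
    then show ?thesis
      using 1 2 by linarith
  qed
  have Q0: "0 \<le> ?Q"
  proof -
    have "0 \<le> iter t (\<lambda>x. \<bar>field e x - iter t (field e) x0\<bar>) x0" for e
      using x0 by (intro iter_nonneg) auto
    then have "0 \<le> \<eta>"
      using eta complete_edges_nonempty by (meson all_not_in_conv order_trans)
    then show ?thesis
      using D0 c_nonneg by (intro add_nonneg_nonneg mult_nonneg_nonneg divide_nonneg_nonneg) auto
  qed
  have "\<bar>(\<Sum>e\<in>S. ?q e - ?phi * u ^ (?k - 1)) / M\<bar> \<le> real ?k * ?Q / M"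
    using q order_trans[OF sum_abs sum_bounded_above, of S "\<lambda>e. ?q e - ?phi * u ^ (?k - 1)" ?Q] M_pos
    by (simp add: divide_right_mono)
  also have "\<dots> \<le> ?K * ?Q / M"
    using S(2) Q0 M_pos by (intro divide_right_mono mult_right_mono) auto
  finally have A: "\<bar>(\<Sum>e\<in>S. ?q e - ?phi * u ^ (?k - 1)) / M\<bar> \<le> ?K * ?Q / M" .
  have B: "\<bar>(1 - real ?k / M) * (?m S - u ^ ?k)\<bar> \<le> D"
  proof -
    have "\<bar>1 - real ?k / M\<bar> * \<bar>?m S - u ^ ?k\<bar> \<le> 1 * D"
      using kM M_pos D[OF S] by (intro mult_mono) auto
    then show ?thesis
      by (simp add: abs_mult)
  qed
  have eu: "euler u = u + ?d"
    by (simp add: euler_def)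
  have "\<bar>euler u ^ ?k - u ^ ?k - real ?k * u ^ (?k - 1) * ?d\<bar> \<le> (real ?k)\<^sup>2 * ?d\<^sup>2"
    unfolding eu using euler_bounds[OF u] u unfolding eu by (intro power_first_order_error) auto
  also have "\<dots> \<le> ?K\<^sup>2 * (1 / M)\<^sup>2"
  proof (intro mult_mono)
    show "?d\<^sup>2 \<le> (1 / M)\<^sup>2"
      using power_mono[OF euler_bounds(3)[OF u], of 2] by (simp only: abs_ge_zero power2_abs)
  qed (use S(2) in \<open>auto intro: power_mono\<close>)
  finally have C: "\<bar>euler u ^ ?k - u ^ ?k - real ?k * u ^ (?k - 1) * ?d\<bar> \<le> ?K\<^sup>2 / M\<^sup>2"
    by (simp add: power_divide)
  have upow: "real ?k * u ^ (?k - 1) * u = real ?k * u ^ ?k"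
    by (cases ?k) auto
  have "iter (Suc t) (\<lambda>x. of_bool (S \<subseteq> x)) x0 = (1 - real ?k / M) * ?m S + (\<Sum>e\<in>S. ?q e) / M"
    by (rule iter_indicator_subset_Suc[OF S(1)])
  \<comment> \<open>Splits off the first-order Taylor polynomial of \<open>euler u ^ card S\<close>.
    The error carried over, the decoupling error and the Taylor remainder are bounded by
    \<open>B\<close>, \<open>A\<close> and \<open>C\<close>.\<close>
  also have "\<dots> = (1 - real ?k / M) * (?m S - u ^ ?k) + (\<Sum>e\<in>S. ?q e - ?phi * u ^ (?k - 1)) / M
      + (u ^ ?k + real ?k * u ^ (?k - 1) * ?d)"
  proof -
    have "real ?k * u ^ (?k - 1) * ?d = real ?k * ?phi * u ^ (?k - 1) / M - (real ?k * u ^ (?k - 1) * u) / M"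
      by (simp add: diff_divide_distrib right_diff_distrib)
    then have "real ?k * u ^ (?k - 1) * ?d = real ?k * ?phi * u ^ (?k - 1) / M - real ?k * u ^ ?k / M"
      unfolding upow .
    moreover have "(\<Sum>e\<in>S. ?q e - ?phi * u ^ (?k - 1)) / M
        = (\<Sum>e\<in>S. ?q e) / M - real ?k * ?phi * u ^ (?k - 1) / M"
      by (simp add: sum_subtractf diff_divide_distrib)
    moreover have "(1 - real ?k / M) * (?m S - u ^ ?k) = (1 - real ?k / M) * ?m S - u ^ ?k + real ?k * u ^ ?k / M"
      by (simp add: algebra_simps)
    ultimately show ?thesis
      by linarith
  qed
  finally have eq: "iter (Suc t) (\<lambda>x. of_bool (S \<subseteq> x)) x0 = (1 - real ?k / M) * (?m S - u ^ ?k)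
      + (\<Sum>e\<in>S. ?q e - ?phi * u ^ (?k - 1)) / M + (u ^ ?k + real ?k * u ^ (?k - 1) * ?d)" .
  have "\<bar>X - y\<bar> \<le> D + b' + c'"
    if "X = a + b + (p + q)" "\<bar>b\<bar> \<le> b'" "\<bar>a\<bar> \<le> D" "\<bar>y - p - q\<bar> \<le> c'" for X y a b p q b' c' :: real
    using that by linarith
  from this[OF eq A B C] show ?thesis .
qed

text \<open>The two extreme starts are those for which the moments are exact powers, of 0 or of 1,
  at time 0; the errors of \<open>moment_step\<close> then accumulate from zero.\<close>

lemma moments_close:
  assumes x0: "x0 = {} \<and> p0 = 0 \<or> x0 = complete_edges n \<and> p0 = 1"
    and eta: "\<And>t e. real t \<le> K * M \<Longrightarrow> e \<in> complete_edges n \<Longrightarrow>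
      iter t (\<lambda>x. \<bar>field e x - iter t (field e) x0\<bar>) x0 \<le> \<eta>"
    and C1: "C1 = real (max_edges s G) * (C0 + 1) + 1"
    and delta: "\<delta> = real (max_edges s G) * (\<eta> + C0 / real n) + (real (max_edges s G))\<^sup>2 / M"
    and eta0: "0 \<le> \<eta>"
    and t: "real t \<le> K * M" and S: "S \<subseteq> complete_edges n" "card S \<le> max_edges s G"
  shows "\<bar>iter t (\<lambda>x. of_bool (S \<subseteq> x)) x0 - (euler ^^ t) p0 ^ card S\<bar> \<le> \<delta> * exp (C1 * K)"
proof -
  have x0E: "x0 \<subseteq> complete_edges n" and p0: "0 \<le> p0" "p0 \<le> 1"
    using x0 by auto
  have C1pos: "1 \<le> C1"
    unfolding C1 using c_nonneg by simp
  have d0: "0 \<le> \<delta>"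
    unfolding delta using eta0 c_nonneg M_pos
    by (intro add_nonneg_nonneg mult_nonneg_nonneg divide_nonneg_nonneg) auto
  \<comment> \<open>The bound solves D_(t+1) = (1 + C1 / M) D_t + C1 \<delta> / M with D_0 = 0. Here
    \<open>\<delta>\<close> is \<open>M\<close> times the error produced afresh in one step, and the
    summand 1 in \<open>C1\<close> makes C1 \<delta> cover it.\<close>
  have main: "\<bar>iter t (\<lambda>x. of_bool (S \<subseteq> x)) x0 - (euler ^^ t) p0 ^ card S\<bar> \<le> \<delta> * ((1 + C1 / M) ^ t - 1)"
    using t S
  proof (induction t arbitrary: S)
    case 0
    have "finite S"
      using 0 finite_complete_edges finite_subset by blast
    then have "of_bool (S \<subseteq> x0) = p0 ^ card S"
      using x0 0 by (cases "S = {}") (auto simp: card_gt_0_iff)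
    then show ?case
      by simp
  next
    case (Suc t)
    let ?D = "\<delta> * ((1 + C1 / M) ^ t - 1)" and ?K = "real (max_edges s G)"
    have t: "real t \<le> K * M"
      using Suc.prems by simp
    note b = euler_iter_bounds[OF p0, of t]
    have D0: "0 \<le> ?D"
      using d0 C1pos M_pos by (intro mult_nonneg_nonneg) (auto intro: one_le_power)
    have "\<bar>iter (Suc t) (\<lambda>x. of_bool (S \<subseteq> x)) x0 - euler ((euler ^^ t) p0) ^ card S\<bar>
        \<le> ?D + ?K * (\<eta> + C0 / real n + (C0 + 1) * ?D) / M + ?K\<^sup>2 / M\<^sup>2"
      using b Suc.prems x0E t Suc.IH eta by (intro moment_step) auto
    also have "\<dots> = ?D + ?K * (C0 + 1) * ?D / M + \<delta> / M"
      unfolding delta using M_pos by (simp add: field_simps power2_eq_square)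
    also have "\<dots> \<le> ?D + C1 * ?D / M + C1 * \<delta> / M"
    proof -
      have "?K * (C0 + 1) * ?D \<le> C1 * ?D" "1 * \<delta> \<le> C1 * \<delta>"
        using mult_right_mono[OF C1pos d0] mult_right_mono[OF _ D0, of "?K * (C0 + 1)" C1]
        unfolding C1 by simp_all
      then show ?thesis
        using M_pos by (intro add_mono divide_right_mono) auto
    qed
    also have "\<dots> = \<delta> * ((1 + C1 / M) ^ Suc t - 1)"
      by (simp add: algebra_simps diff_divide_distrib)
    finally show ?case
      by simp
  qed
  have "(1 + C1 / M) ^ t \<le> exp (C1 / M) ^ t"
    using exp_ge_add_one_self[of "C1 / M"] C1pos M_pos by (intro power_mono) (auto intro: add_nonneg_nonneg)
  also have "\<dots> = exp (real t * (C1 / M))"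
    by (rule exp_of_nat_mult[symmetric])
  also have "\<dots> \<le> exp (C1 * K)"
    using mult_left_mono[OF t, of C1] C1pos M_pos by (simp add: field_simps)
  finally have "\<delta> * ((1 + C1 / M) ^ t - 1) \<le> \<delta> * exp (C1 * K)"
    using d0 by (intro mult_left_mono) auto
  with main show ?thesis
    by linarith
qed

end

section \<open>Relaxation and contraction at high temperature\<close>

text \<open>By compactness x - \<phi> x is at least some d > 0 between p + \<epsilon> and 1, so the
  recursion descends by d / m per step until it is below p + \<epsilon>, while monotonicity keeps it
  above \<open>p\<close>. About m / d steps suffice, so \<open>T0\<close> does not depend on
  \<open>m\<close>.\<close>

lemma relaxation_upper:
  fixes \<phi> :: "real \<Rightarrow> real"
  assumes cont: "continuous_on {0..1} \<phi>"
    and mono: "\<And>x y. 0 \<le> x \<Longrightarrow> x \<le> y \<Longrightarrow> y \<le> 1 \<Longrightarrow> \<phi> x \<le> \<phi> y"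
    and p: "0 \<le> p" "p \<le> 1" "\<phi> p = p"
    and above: "\<And>q. p < q \<Longrightarrow> q \<le> 1 \<Longrightarrow> \<phi> q < q"
    and eps: "0 < \<epsilon>"
  shows "\<exists>T0::nat. \<forall>m\<ge>1. \<forall>t. real T0 * m \<le> real t \<longrightarrow> ((\<lambda>x. x + (\<phi> x - x) / m) ^^ t) 1 \<le> p + \<epsilon>"
proof -
  obtain d where d: "0 < d" "\<And>q. p + \<epsilon> \<le> q \<Longrightarrow> q \<le> 1 \<Longrightarrow> \<phi> q \<le> q - d"
  proof (cases "p + \<epsilon> \<le> 1")
    case True
    have "continuous_on {p + \<epsilon>..1} (\<lambda>q. q - \<phi> q)"
      using cont p eps by (intro continuous_intros) (auto intro: continuous_on_subset)
    then obtain q0 where q0: "q0 \<in> {p + \<epsilon>..1}" "\<And>q. q \<in> {p + \<epsilon>..1} \<Longrightarrow> q0 - \<phi> q0 \<le> q - \<phi> q"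
      using True continuous_attains_inf[of "{p + \<epsilon>..1}" "\<lambda>q. q - \<phi> q"] by auto
    show ?thesis
    proof (rule that[of "q0 - \<phi> q0"])
      show "0 < q0 - \<phi> q0"
        using above[of q0] q0(1) eps by simp
      show "\<phi> q \<le> q - (q0 - \<phi> q0)" if "p + \<epsilon> \<le> q" "q \<le> 1" for q
        using q0(2)[of q] that by simp
    qed
  next
    case False
    show ?thesis
      by (rule that[of 1]) (use False in auto)
  qed
  obtain T0 :: nat where T0: "1 / d \<le> real T0"
    using real_arch_simple by blast
  have claim: "p \<le> ((\<lambda>x. x + (\<phi> x - x) / m) ^^ t) 1 \<and> ((\<lambda>x. x + (\<phi> x - x) / m) ^^ t) 1 \<le> 1
      \<and> ((\<lambda>x. x + (\<phi> x - x) / m) ^^ t) 1 \<le> max (p + \<epsilon>) (1 - real t * d / m)" if m: "1 \<le> m" for m t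
  proof (induction t)
    case 0
    then show ?case
      using p by simp
  next
    case (Suc t)
    define x where "x = ((\<lambda>x. x + (\<phi> x - x) / m) ^^ t) 1"
    have x: "p \<le> x" "x \<le> 1" "x \<le> max (p + \<epsilon>) (1 - real t * d / m)"
      using Suc by (auto simp: x_def)
    have le: "\<phi> x \<le> x"
      using above[of x] x p by (cases "x = p") auto
    have ge: "p \<le> \<phi> x"
      using mono[of p x] x p by simp
    have "p = (1 - 1 / m) * p + (1 / m) * p"
      using m by (simp add: field_simps)
    also have "\<dots> \<le> (1 - 1 / m) * x + (1 / m) * \<phi> x"
      using m x ge by (intro add_mono mult_left_mono) auto
    also have "\<dots> = x + (\<phi> x - x) / m"
      by (simp add: algebra_simps diff_divide_distrib)
    finally have 1: "p \<le> x + (\<phi> x - x) / m" .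
    have 2: "x + (\<phi> x - x) / m \<le> x"
      using le m by (simp add: divide_nonpos_pos)
    have 3: "x + (\<phi> x - x) / m \<le> max (p + \<epsilon>) (1 - real (Suc t) * d / m)"
    proof (cases "p + \<epsilon> \<le> x")
      case True
      have "(\<phi> x - x) / m \<le> - d / m"
        using d(2)[OF True x(2)] m by (intro divide_right_mono) auto
      then have "x + (\<phi> x - x) / m \<le> x - d / m"
        by simp
      moreover have "0 \<le> d / m"
        using d m by simp
      moreover have "1 - real (Suc t) * d / m = 1 - real t * d / m - d / m"
        by (simp add: add_divide_distrib algebra_simps)
      ultimately show ?thesis
        using x(3) by (auto simp: max_def split: if_splits)
    next
      case False
      then show ?thesis
        using 2 by simp
    qed
    show ?case
      using 1 2 3 x by (simp add: x_def)
  qed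
  have "((\<lambda>x. x + (\<phi> x - x) / m) ^^ t) 1 \<le> p + \<epsilon>" if m: "1 \<le> m" and t: "real T0 * m \<le> real t" for m t
  proof -
    have "1 \<le> real T0 * d"
      using T0 d by (simp add: field_simps)
    then have "m \<le> real T0 * d * m"
      using m mult_right_mono[of 1 "real T0 * d" m] by simp
    also have "\<dots> \<le> real t * d"
      using t d mult_right_mono[of "real T0 * m" "real t" d] by (simp add: mult_ac)
    finally have "1 \<le> real t * d / m"
      using m by simp
    then show ?thesis
      using claim[OF m, of t] p eps by (auto simp: max_def split: if_splits)
  qed
  then show ?thesis
    by blast
qed

text \<open>The lower half is the upper half for the reflected map q \<mapsto> 1 - \<phi> (1 - q),
  which exchanges the starts 0 and 1.\<close>

lemma relaxation:
  fixes \<phi> :: "real \<Rightarrow> real"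
  assumes cont: "continuous_on {0..1} \<phi>"
    and mono: "\<And>x y. 0 \<le> x \<Longrightarrow> x \<le> y \<Longrightarrow> y \<le> 1 \<Longrightarrow> \<phi> x \<le> \<phi> y"
    and p: "0 \<le> p" "p \<le> 1" "\<phi> p = p"
    and above: "\<And>q. p < q \<Longrightarrow> q \<le> 1 \<Longrightarrow> \<phi> q < q"
    and below: "\<And>q. 0 \<le> q \<Longrightarrow> q < p \<Longrightarrow> q < \<phi> q"
    and eps: "0 < \<epsilon>"
  shows "\<exists>T0::nat. \<forall>m\<ge>1. \<forall>t. real T0 * m \<le> real t \<longrightarrow>
    ((\<lambda>x. x + (\<phi> x - x) / m) ^^ t) 1 \<le> p + \<epsilon> \<and> p - \<epsilon> \<le> ((\<lambda>x. x + (\<phi> x - x) / m) ^^ t) 0"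
proof -
  let ?\<psi> = "\<lambda>q. 1 - \<phi> (1 - q)"
  have "continuous_on {0..1} ?\<psi>"
    by (intro continuous_intros continuous_on_compose2[OF cont]) auto
  then have "\<exists>T1::nat. \<forall>m\<ge>1. \<forall>t. real T1 * m \<le> real t \<longrightarrow>
      ((\<lambda>x. x + (?\<psi> x - x) / m) ^^ t) 1 \<le> (1 - p) + \<epsilon>"
  proof (rule relaxation_upper)
    show "?\<psi> x \<le> ?\<psi> y" if "0 \<le> x" "x \<le> y" "y \<le> 1" for x y
      using mono[of "1 - y" "1 - x"] that by simp
    show "?\<psi> q < q" if "1 - p < q" "q \<le> 1" for q
      using below[of "1 - q"] that by simp
  qed (use p eps in auto)
  then obtain T1 :: nat where T1: "\<And>m t. 1 \<le> m \<Longrightarrow> real T1 * m \<le> real t \<Longrightarrow>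
      ((\<lambda>x. x + (?\<psi> x - x) / m) ^^ t) 1 \<le> (1 - p) + \<epsilon>"
    by blast
  have reflect: "((\<lambda>x. x + (?\<psi> x - x) / m) ^^ t) 1 = 1 - ((\<lambda>x. x + (\<phi> x - x) / m) ^^ t) 0" for m t
    by (induction t) (auto simp: diff_divide_distrib)
  obtain T0 :: nat where T0: "\<And>m t. 1 \<le> m \<Longrightarrow> real T0 * m \<le> real t \<Longrightarrow>
      ((\<lambda>x. x + (\<phi> x - x) / m) ^^ t) 1 \<le> p + \<epsilon>"
    using relaxation_upper[OF cont mono p above eps] by blast
  have "((\<lambda>x. x + (\<phi> x - x) / m) ^^ t) 1 \<le> p + \<epsilon> \<and> p - \<epsilon> \<le> ((\<lambda>x. x + (\<phi> x - x) / m) ^^ t) 0"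
    if m: "1 \<le> m" and t: "real (T0 + T1) * m \<le> real t" for m t
  proof
    have "real T0 * m \<le> real (T0 + T1) * m" "real T1 * m \<le> real (T0 + T1) * m"
      using m by (auto intro: mult_right_mono)
    then have "real T0 * m \<le> real t" "real T1 * m \<le> real t"
      using t by linarith+
    from T0[OF m this(1)] T1[OF m this(2)]
    show "((\<lambda>x. x + (\<phi> x - x) / m) ^^ t) 1 \<le> p + \<epsilon>" "p - \<epsilon> \<le> ((\<lambda>x. x + (\<phi> x - x) / m) ^^ t) 0"
      unfolding reflect by linarith+
  qed
  then show ?thesis
    by blast
qed

section \<open>Good configurations and contraction of the edge count\<close>

context ergm_model
begin

text \<open>A low field is a decreasing event and a large total influence an increasing one, so by
  monotonicity the empty and the complete graph are the worst starts. The factor \<open>M\<close> is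
  a union bound over edges, the 2 stands for the two events.\<close>

lemma bad_field_probability:
  assumes b: "\<And>e. e \<in> complete_edges n \<Longrightarrow> iter t (\<lambda>x. of_bool (field e x < a)) {} \<le> b"
    and b': "\<And>e. e \<in> complete_edges n \<Longrightarrow>
      iter t (\<lambda>x. of_bool (w < total_influence e x)) (complete_edges n) \<le> b"
    and x: "x \<subseteq> complete_edges n"
  shows "iter t (\<lambda>x. of_bool (\<not> (\<forall>e\<in>complete_edges n. a \<le> field e x \<and> total_influence e x \<le> w))) x
    \<le> M * (2 * b)"
proof -
  let ?A = "\<lambda>e x. of_bool (field e x < a) :: real" and ?B = "\<lambda>e x. of_bool (w < total_influence e x) :: real"
  have "iter t (\<lambda>x. of_bool (\<not> (\<forall>e\<in>complete_edges n. a \<le> field e x \<and> total_influence e x \<le> w))) x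
      \<le> iter t (\<lambda>x. \<Sum>e\<in>complete_edges n. ?A e x + ?B e x) x"
  proof (rule iter_mono[OF _ x])
    fix y assume "y \<subseteq> complete_edges n"
    show "of_bool (\<not> (\<forall>e\<in>complete_edges n. a \<le> field e y \<and> total_influence e y \<le> w))
        \<le> (\<Sum>e\<in>complete_edges n. ?A e y + ?B e y)"
    proof (cases "\<forall>e\<in>complete_edges n. a \<le> field e y \<and> total_influence e y \<le> w")
      case False
      then obtain e where e: "e \<in> complete_edges n" "field e y < a \<or> w < total_influence e y"
        by force
      then have "1 \<le> ?A e y + ?B e y"
        by auto
      also have "\<dots> \<le> (\<Sum>e\<in>complete_edges n. ?A e y + ?B e y)"
        using e finite_complete_edges by (intro member_le_sum) auto
      finally show ?thesis
        using False by simp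
    qed (simp add: sum_nonneg)
  qed
  also have "\<dots> = (\<Sum>e\<in>complete_edges n. iter t (?A e) x + iter t (?B e) x)"
    by (simp only: iter_sum iter_add)
  also have "\<dots> \<le> (\<Sum>e\<in>complete_edges n. 2 * b)"
  proof (intro sum_mono)
    fix e assume e: "e \<in> complete_edges n"
    have "increasing (\<lambda>x. (-1) * ?A e x)"
      unfolding increasing_def
    proof (intro allI impI)
      fix x y assume "x \<subseteq> y" "y \<subseteq> complete_edges n"
      then show "(-1) * ?A e x \<le> (-1) * ?A e y"
        using field_mono[of x y e] by auto
    qed
    from increasing_iter[OF this, of t] have "iter t (?A e) x \<le> iter t (?A e) {}"
      using x unfolding iter_cmult increasing_def by (auto dest!: spec[of _ "{}"])
    moreover have "increasing (?B e)"
      unfolding increasing_def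
    proof (intro allI impI)
      fix x y assume "x \<subseteq> y" "y \<subseteq> complete_edges n"
      then show "?B e x \<le> ?B e y"
        using total_influence_mono[of x y e] by auto
    qed
    from increasing_iter[OF this, of t] have "iter t (?B e) x \<le> iter t (?B e) (complete_edges n)"
      using x unfolding increasing_def by auto
    ultimately show "iter t (?A e) x + iter t (?B e) x \<le> 2 * b"
      using b[OF e] b'[OF e] by linarith
  qed
  also have "\<dots> = M * (2 * b)"
    by simp
  finally show ?thesis .
qed

text \<open>From \<open>x\<close> to \<open>y\<close> the fields grow starting at a level of at
  least \<open>a\<close>, so their logistic images grow with at most the slope at \<open>a\<close>;
  the growth of the sum of fields is charged to the new edges, at most \<open>w\<close>
  each.\<close>

lemma good_decreasing:
  assumes a: "0 \<le> a" and w: "0 \<le> w"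
    and xy: "x \<subseteq> y" "y \<subseteq> complete_edges n"
    and gx: "\<And>e. e \<in> complete_edges n \<Longrightarrow> a \<le> field e x"
    and gy: "\<And>e. e \<in> complete_edges n \<Longrightarrow> total_influence e y \<le> w"
  shows "(\<Sum>e\<in>complete_edges n. logistic (field e y)) - (\<Sum>e\<in>complete_edges n. logistic (field e x))
    \<le> logistic a * (1 - logistic a) * w * (real (card y) - real (card x))"
proof -
  have fin: "finite y"
    using finite_subset[OF xy(2) finite_complete_edges] .
  then have "finite x"
    using finite_subset[OF xy(1)] by blast
  have slope: "0 \<le> logistic a * (1 - logistic a)"
    using logistic_pos[of a] logistic_less_1[of a] by simp
  have "(\<Sum>e\<in>complete_edges n. logistic (field e y)) - (\<Sum>e\<in>complete_edges n. logistic (field e x))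
      \<le> (\<Sum>e\<in>complete_edges n. logistic a * (1 - logistic a) * (field e y - field e x))"
    unfolding sum_subtractf[symmetric] using a gx field_mono[OF xy(1)]
    by (intro sum_mono logistic_concave) auto
  also have "\<dots> \<le> logistic a * (1 - logistic a) * (\<Sum>f\<in>y - x. total_influence f y)"
    unfolding sum_distrib_left[symmetric] using sum_field_increment[OF xy] slope by (rule mult_left_mono)
  also have "\<dots> \<le> logistic a * (1 - logistic a) * (\<Sum>f\<in>y - x. w)"
    using gy xy slope by (intro mult_left_mono sum_mono) auto
  also have "(\<Sum>f\<in>y - x. w) = w * (real (card y) - real (card x))"
    using fin \<open>finite x\<close> xy by (simp add: card_Diff_subset of_nat_diff card_mono)
  finally show ?thesis
    by (simp add: mult.assoc)
qed

text \<open>The hypotheses collect the numerical conditions that hold for large \<open>n\<close>. In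
  the first \<open>T0 * M\<close> steps the gradient may grow to exp (C0 T0), but afterwards bad
  configurations are rare; \<open>K1 * M\<close> further steps bring it down to 1/4, and the bad
  configurations add at most 1/4. Throughout l = sqrt n, for which \<open>B\<close> is the exponent
  in \<open>concentration\<close>.\<close>

lemma card_contraction:
  fixes T0 K1 :: nat
  assumes B: "B = real T0 * exp (2 * C0 * real T0) * C0\<^sup>2"
    and C1: "C1 = real (max_edges s G) * (C0 + 1) + 1"
    and delta: "\<delta> = real (max_edges s G) * (2 * exp B / sqrt n + C0 / real n) + (real (max_edges s G))\<^sup>2 / M"
    and eps: "0 < \<epsilon>" "\<epsilon> \<le> p"
    and relax: "(euler ^^ (T0 * card (complete_edges n))) 1 \<le> p + \<epsilon>"
      "p - \<epsilon> \<le> (euler ^^ (T0 * card (complete_edges n))) 0"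
    and l: "C0 * exp (C0 * real T0) \<le> sqrt n"
    and D: "C0 * (\<delta> * exp (C1 * real T0) + 1 / real n) \<le> \<epsilon> / 2"
    and a: "a = max (mean_field_Psi s G \<beta> (p - \<epsilon>) - \<epsilon>) 0"
    and w: "w = Psi_deriv s G \<beta> (p + \<epsilon>) + \<epsilon>"
    and kappa: "\<kappa> = logistic a * (1 - logistic a) * w" "\<kappa> < 1"
    and K1: "exp (- ((1 - \<kappa>) * real K1)) * exp (C0 * real T0) \<le> 1 / 4"
    and small: "6 * (M * (2 * exp (B - sqrt n * (\<epsilon> / 2)))) * M / (1 - \<kappa>) \<le> 1 / 4"
    and x: "x \<subseteq> complete_edges n" and e: "e \<in> complete_edges n"
  shows "iter ((K1 + T0) * card (complete_edges n)) (\<lambda>x. real (card x)) (insert e x)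
    - iter ((K1 + T0) * card (complete_edges n)) (\<lambda>x. real (card x)) (x - {e}) \<le> 1 / 2"
proof -
  define T where "T = T0 * card (complete_edges n)"
  define \<eta> where "\<eta> = 2 * exp B / sqrt n"
  have sn: "0 < sqrt n"
    using n_ge_2 by simp
  have T: "real T \<le> real T0 * M"
    by (simp add: T_def)
  have l': "0 < sqrt n" "sqrt n * (C0 / real n) * exp (C0 * real T0) \<le> 1"
  proof -
    have "sqrt n * (C0 / real n) * exp (C0 * real T0) = C0 * exp (C0 * real T0) / sqrt n"
      using n_ge_2 by (simp add: field_simps)
    then show "sqrt n * (C0 / real n) * exp (C0 * real T0) \<le> 1"
      using l sn by simp
  qed (rule sn)
  have B': "real T0 * exp (2 * C0 * real T0) * ((sqrt n)\<^sup>2 * (C0 / real n) * C0) = B"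
    unfolding B using n_ge_2 by (simp add: power2_eq_square[of C0])
  have eta: "iter t (\<lambda>x. \<bar>field e x - iter t (field e) x0\<bar>) x0 \<le> \<eta>"
    if "real t \<le> real T0 * M" "e \<in> complete_edges n" "x0 \<subseteq> complete_edges n" for t e x0
    using mean_abs_deviation[OF lip_bounded_field[OF that(2)] that(1,3) l'] unfolding B' \<eta>_def .
  have eta0: "0 \<le> \<eta>"
    unfolding \<eta>_def by simp
  let ?D = "\<delta> * exp (C1 * real T0)"
  have mom: "\<bar>iter T (\<lambda>x. of_bool (S \<subseteq> x)) x0 - (euler ^^ T) p0 ^ card S\<bar> \<le> ?D"
    if "x0 = {} \<and> p0 = 0 \<or> x0 = complete_edges n \<and> p0 = 1"
      "S \<subseteq> complete_edges n" "card S \<le> max_edges s G" for x0 p0 S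
    using that eta eta0 T C1 delta unfolding \<eta>_def[symmetric]
    by (intro moments_close) auto
  have beta_nonneg: "0 \<le> \<beta> i" if "i \<in> {1..s}" for i
    using beta_pos[OF that] by simp
  have p_eps: "0 \<le> p - \<epsilon>" "0 \<le> p + \<epsilon>"
    using eps by auto
  have Psi_mono: "mean_field_Psi s G \<beta> u \<le> mean_field_Psi s G \<beta> v" if "0 \<le> u" "u \<le> v" for u v
    unfolding mean_field_Psi_def using that beta_nonneg
    by (intro sum_mono mult_left_mono power_mono) auto
  have Psi_deriv_mono: "Psi_deriv s G \<beta> u \<le> Psi_deriv s G \<beta> v" if "0 \<le> u" "u \<le> v" for u v
    unfolding Psi_deriv_def using that beta_pos
    by (intro sum_mono mult_left_mono power_mono) (auto intro: less_imp_le)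
  have Psi_deriv_nonneg: "0 \<le> Psi_deriv s G \<beta> u" if "0 \<le> u" for u
    unfolding Psi_deriv_def using that beta_pos
    by (intro sum_nonneg mult_nonneg_nonneg) (auto intro: less_imp_le)
  have low: "iter T (\<lambda>x. of_bool (field f x < a)) {} \<le> exp (B - sqrt n * (\<epsilon> / 2))"
    if f: "f \<in> complete_edges n" for f
  proof -
    let ?u = "(euler ^^ T) 0"
    have u: "0 \<le> ?u" "?u \<le> 1"
      using euler_iter_bounds by auto
    have "\<bar>iter T (field f) {} - mean_field_Psi s G \<beta> ?u\<bar> \<le> C0 * (?D + 1 / real n)"
      by (rule iter_field_close[OF f u]) (rule mom, auto)
    moreover have "mean_field_Psi s G \<beta> (p - \<epsilon>) \<le> mean_field_Psi s G \<beta> ?u"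
      using relax(2) p_eps by (intro Psi_mono) (auto simp: T_def)
    ultimately have ge: "mean_field_Psi s G \<beta> (p - \<epsilon>) - \<epsilon> / 2 \<le> iter T (field f) {}"
      using D by linarith
    have "iter T (\<lambda>x. of_bool (field f x < a)) {}
        \<le> iter T (\<lambda>x. of_bool (field f x < iter T (field f) {} - \<epsilon> / 2)) {}"
    proof (rule iter_mono)
      fix x
      \<comment> \<open>If the maximum in \<open>a\<close> is 0, the event is empty, because fields
        are never negative.\<close>
      show "of_bool (field f x < a) \<le> (of_bool (field f x < iter T (field f) {} - \<epsilon> / 2) :: real)"
        using ge field_nonneg[of f x] unfolding a by (auto simp: max_def split: if_splits)
    qed simp
    also have "\<dots> \<le> exp (B - sqrt n * (\<epsilon> / 2))"
      using tail_bounds(2)[OF lip_bounded_field[OF f] T _ l', of "{}" "\<epsilon> / 2"] unfolding B' by simp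
    finally show ?thesis .
  qed
  have high: "iter T (\<lambda>x. of_bool (w < total_influence f x)) (complete_edges n) \<le> exp (B - sqrt n * (\<epsilon> / 2))"
    if f: "f \<in> complete_edges n" for f
  proof -
    let ?u = "(euler ^^ T) 1" and ?E = "complete_edges n"
    have u: "0 \<le> ?u" "?u \<le> 1"
      using euler_iter_bounds[of 1 T] by auto
    have "\<bar>iter T (total_influence f) ?E - Psi_deriv s G \<beta> ?u\<bar> \<le> C0 * (?D + 1 / real n)"
      by (rule iter_total_influence_close[OF f u]) (rule mom, auto)
    moreover have "Psi_deriv s G \<beta> ?u \<le> Psi_deriv s G \<beta> (p + \<epsilon>)"
      using relax(1) u by (intro Psi_deriv_mono) (auto simp: T_def)
    ultimately have le: "iter T (total_influence f) ?E \<le> Psi_deriv s G \<beta> (p + \<epsilon>) + \<epsilon> / 2"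
      using D by linarith
    have "iter T (\<lambda>x. of_bool (w < total_influence f x)) ?E
        \<le> iter T (\<lambda>x. of_bool (iter T (total_influence f) ?E + \<epsilon> / 2 < total_influence f x)) ?E"
    proof (rule iter_mono)
      fix x
      show "of_bool (w < total_influence f x)
          \<le> (of_bool (iter T (total_influence f) ?E + \<epsilon> / 2 < total_influence f x) :: real)"
        using le unfolding w by auto
    qed simp
    also have "\<dots> \<le> exp (B - sqrt n * (\<epsilon> / 2))"
      using tail_bounds(1)[OF lip_bounded_total_influence[OF f] T _ l', of ?E "\<epsilon> / 2"] unfolding B' by simp
    finally show ?thesis .
  qed
  let ?good = "\<lambda>x. \<forall>e\<in>complete_edges n. a \<le> field e x \<and> total_influence e x \<le> w"
  have a0: "0 \<le> a"
    unfolding a by simp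
  have w0: "0 \<le> w"
    unfolding w using Psi_deriv_nonneg[OF p_eps(2)] eps by simp
  have kappa0: "0 \<le> \<kappa>"
    unfolding kappa using w0 logistic_pos[of a] logistic_less_1[of a] by simp
  have bad: "iter T (\<lambda>x. of_bool (\<not> ?good x)) x \<le> M * (2 * exp (B - sqrt n * (\<epsilon> / 2)))"
    if "x \<subseteq> complete_edges n" for x
    using low high that by (rule bad_field_probability)
  have lip: "lip_bounded (\<lambda>x. real (card x)) 1 M"
    unfolding lip_bounded_def
  proof (intro exI[of _ "\<lambda>_. 1"] conjI allI impI)
    fix x e assume x: "x \<subseteq> complete_edges n" "e \<in> complete_edges n"
    have "finite (x - {e})"
      using x finite_complete_edges finite_subset by blast
    then have "card (insert e x) = Suc (card (x - {e}))"
      by (metis DiffE card_insert_disjoint insertI1 insert_Diff_single)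
    then show "\<bar>real (card (insert e x)) - real (card (x - {e}))\<bar> \<le> 1"
      by (simp only: of_nat_Suc)
  qed auto
  have grad: "iter T (\<lambda>x. real (card x)) (insert e x) - iter T (\<lambda>x. real (card x)) (x - {e}) \<le> exp (C0 * real T0)"
    if xe: "x \<subseteq> complete_edges n" "e \<in> complete_edges n" for x e
  proof -
    obtain L where L: "\<And>e. e \<in> complete_edges n \<Longrightarrow> L e \<le> (1 + C0 / M) ^ T * 1"
        "\<And>x e. x \<subseteq> complete_edges n \<Longrightarrow> e \<in> complete_edges n \<Longrightarrow>
          \<bar>iter T (\<lambda>x. real (card x)) (insert e x) - iter T (\<lambda>x. real (card x)) (x - {e})\<bar> \<le> L e"
      using lip_bounded_iter[OF lip, of T] unfolding lip_bounded_def by blast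
    show ?thesis
      using L(1)[OF xe(2)] L(2)[OF xe] growth_le_exp[OF T] by linarith
  qed
  have "iter (K1 * card (complete_edges n) + T) (\<lambda>x. real (card x)) (insert e x)
      - iter (K1 * card (complete_edges n) + T) (\<lambda>x. real (card x)) (x - {e})
      \<le> (1 - (1 - \<kappa>) / M) ^ (K1 * card (complete_edges n)) * exp (C0 * real T0)
        + 6 * (M * (2 * exp (B - sqrt n * (\<epsilon> / 2)))) * M / (1 - \<kappa>)"
    using good_decreasing[OF a0 w0] unfolding kappa(1)[symmetric]
    by (intro gradient_bound[of \<kappa> ?good, OF kappa0 kappa(2) _ bad grad x e]) auto
  also have "\<dots> \<le> 1 / 4 + 1 / 4"
  proof (intro add_mono small)
    have "0 \<le> 1 - (1 - \<kappa>) / M"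
      using kappa0 M_ge_1 by (simp add: field_simps)
    then have "(1 - (1 - \<kappa>) / M) ^ (K1 * card (complete_edges n)) \<le> exp (- ((1 - \<kappa>) / M)) ^ (K1 * card (complete_edges n))"
      using exp_ge_add_one_self[of "- ((1 - \<kappa>) / M)"] by (intro power_mono) auto
    also have "\<dots> = exp (real (K1 * card (complete_edges n)) * - ((1 - \<kappa>) / M))"
      by (rule exp_of_nat_mult[symmetric])
    also have "real (K1 * card (complete_edges n)) * - ((1 - \<kappa>) / M) = - ((1 - \<kappa>) * real K1)"
      using M_pos by (simp add: mult.commute)
    finally have "(1 - (1 - \<kappa>) / M) ^ (K1 * card (complete_edges n)) * exp (C0 * real T0)
        \<le> exp (- ((1 - \<kappa>) * real K1)) * exp (C0 * real T0)"
      by (intro mult_right_mono) auto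
    with K1 show "(1 - (1 - \<kappa>) / M) ^ (K1 * card (complete_edges n)) * exp (C0 * real T0) \<le> 1 / 4"
      by linarith
  qed
  finally show ?thesis
    by (simp add: T_def distrib_right)
qed

section \<open>The Gibbs measure, variance of one edge and upper bound on the gap\<close>

abbreviation \<mu> :: "nat set set \<Rightarrow> real" where "\<mu> \<equiv> pmf (ergm s G \<beta> n)"

lemma field_eq_hamiltonian: "e \<notin> x \<Longrightarrow>
    field e x = hamiltonian s G \<beta> n (insert e x) - hamiltonian s G \<beta> n x"
  unfolding field_def edge_deriv_def edge_on_def edge_off_def by simp

sublocale heat_bath_reversible "complete_edges n" "\<lambda>e x. logistic (field e x)" \<mu>
proof
  show "0 < \<mu> x" if "x \<subseteq> complete_edges n" for x
    using that partition_fun_pos[of s G \<beta> n] by (simp add: pmf_ergm configs_def)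
  show "(\<Sum>x\<in>Pow (complete_edges n). \<mu> x) = 1"
    by (rule sum_pmf_eq_1) (auto simp: finite_complete_edges set_pmf_eq pmf_ergm configs_def split: if_splits)
  show "\<mu> x * logistic (field e x) = \<mu> (insert e x) * (1 - logistic (field e x))"
    if x: "x \<subseteq> complete_edges n" and e: "e \<in> complete_edges n" "e \<notin> x" for x e
  proof -
    let ?H = "hamiltonian s G \<beta> n" and ?Z = "partition_fun s G \<beta> n"
    have nz: "1 + exp (field e x) \<noteq> 0"
      using exp_gt_zero[of "field e x"] by linarith
    have "1 - logistic (field e x) = 1 / (1 + exp (field e x))"
      unfolding logistic_def using nz by (simp add: field_simps)
    moreover have "exp (?H (insert e x)) = exp (?H x) * exp (field e x)"
      unfolding field_eq_hamiltonian[OF e(2)] by (simp add: exp_add[symmetric])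
    ultimately show ?thesis
      using x e by (simp add: pmf_ergm configs_def logistic_def)
  qed
qed

lemma expectation_eq_inner: "measure_pmf.expectation (ergm s G \<beta> n) f = inner f (\<lambda>x. 1)"
proof -
  have "measure_pmf.expectation (ergm s G \<beta> n) f = (\<Sum>x\<in>configs n. f x * \<mu> x)"
    by (rule integral_measure_pmf_real)
      (auto simp: finite_configs set_pmf_eq pmf_ergm split: if_splits)
  then show ?thesis
    unfolding inner_def by (simp add: configs_def mult.commute)
qed

lemma dirichlet_form_eq: "dirichlet_form s G \<beta> n f f = dirichlet f"
proof -
  have "flip_prob s G \<beta> n x e = rate e x" for x e
  proof -
    let ?g = "\<lambda>b. if b then edge_on x e else edge_off x e"
    have "inj ?g"
      by (auto simp: inj_def edge_on_def edge_off_def)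
    then have "pmf (map_pmf ?g (bernoulli_pmf (logistic (field e x)))) (?g b)
        = pmf (bernoulli_pmf (logistic (field e x))) b" for b
      by (rule pmf_map_inj')
    from this[of True] this[of False] show ?thesis
      unfolding flip_prob_def glauber_update_def rate_def edge_flip_def field_def[symmetric]
      using logistic_pos[of "field e x"] logistic_less_1[of "field e x"]
      by (auto simp: less_imp_le)
  qed
  moreover have "edge_flip x e = flip x e" for x e
    unfolding edge_flip_def flip_def edge_on_def edge_off_def by simp
  ultimately show ?thesis
    unfolding dirichlet_form_def dirichlet_def card_complete_edges configs_def
    by (simp add: power2_eq_square mult.assoc)
qed

lemma field_le: "e \<in> complete_edges n \<Longrightarrow> field e x \<le> C0"
proof -
  assume e: "e \<in> complete_edges n"
  have "field e x \<le> C0 * 1"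
    unfolding field_eq
  proof (rule weighted_sum_le_1)
    fix i a assume i: "i \<in> {1..s}" and a: "a \<in> edges (G i)"
    let ?R = "rooted_maps n (G i) a e"
    have "rooted_count n (G i) a (edges (G i) - {a}) e x \<le> (\<Sum>\<psi>\<in>?R. 1) / real n ^ (card (verts (G i)) - 2)"
      unfolding rooted_count_def by (intro divide_right_mono sum_mono) auto
    also have "\<dots> \<le> 2"
      using rooted_density_le[OF graphs[OF i] a e] by simp
    also have "2 \<le> 8 * real (card (edges (G i)) + 1) * (real (card (verts (G i)) + 1))\<^sup>2 * 1"
      using size_weight_ge(2)[of "real (card (edges (G i)))" "card (verts (G i))"]
        zero_le_power2[of "real (card (verts (G i)))"]
      by (simp only: of_nat_add of_nat_1 mult_1_right) linarith
    finally show "rooted_count n (G i) a (edges (G i) - {a}) e x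
        \<le> 8 * real (card (edges (G i)) + 1) * (real (card (verts (G i)) + 1))\<^sup>2 * 1" .
  qed simp
  then show ?thesis
    by simp
qed

text \<open>By stationarity \<open>p\<close> is the mean of the logistic image of the field, which
  lies between 0 and \<open>C0\<close>. So \<open>p\<close> lies between 1/2 and
  \<open>logistic C0\<close>, away from 0 and 1 uniformly in \<open>n\<close>.\<close>

lemma edge_variance:
  assumes e: "e \<in> complete_edges n"
  defines "p \<equiv> inner (\<lambda>x. of_bool (e \<in> x)) (\<lambda>x. 1)"
  shows "1 / 2 * (1 - logistic C0) \<le> p * (1 - p)"
proof -
  let ?f = "\<lambda>x. of_bool (e \<in> x) :: real"
  have "step ?f x = (1 - 1 / M) * ?f x + logistic (field e x) / M" for x
    using iter_indicator_subset_Suc[of "{e}" 0 x] e by simp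
  then have "step ?f = (\<lambda>x. (1 - 1 / M) * ?f x + logistic (field e x) / M)"
    by blast
  moreover have "inner (step ?f) (\<lambda>x. 1) = p"
    using inner_iter_1[of 1 ?f] by (simp add: p_def)
  ultimately have "p = inner (\<lambda>x. (1 - 1 / M) * ?f x + logistic (field e x) / M) (\<lambda>x. 1)"
    by simp
  also have "\<dots> = (1 - 1 / M) * p + inner (\<lambda>x. logistic (field e x)) (\<lambda>x. 1) / M"
    unfolding p_def inner_def
    by (simp add: algebra_simps sum.distrib sum_distrib_left sum_divide_distrib sum_subtractf)
  finally have p: "p = inner (\<lambda>x. logistic (field e x)) (\<lambda>x. 1)"
    using M_pos by (simp add: field_simps)
  have "1 / 2 \<le> logistic (field e x)" for x
    using logistic_mono[OF field_nonneg[of e x]] by (simp add: logistic_def)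
  then have "(\<Sum>x\<in>Pow (complete_edges n). \<mu> x * (1 / 2)) \<le> p"
    unfolding p inner_def mult_1_right by (intro sum_mono mult_left_mono) auto
  then have 1: "1 / 2 \<le> p"
    unfolding sum_distrib_right[symmetric] pi_sum by simp
  have "p \<le> (\<Sum>x\<in>Pow (complete_edges n). \<mu> x * logistic C0)"
    unfolding p inner_def mult_1_right using field_le[OF e]
    by (intro sum_mono mult_left_mono logistic_mono) auto
  then have "p \<le> logistic C0"
    unfolding sum_distrib_right[symmetric] pi_sum by simp
  then show ?thesis
    using 1 logistic_less_1[of C0] by (intro mult_mono) auto
qed

text \<open>Only flips of \<open>e\<close> change the function, by 1 / c, and \<open>e\<close> is
  chosen with probability 1 / M.\<close>

lemma dirichlet_edge_le:
  assumes e: "e \<in> complete_edges n"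
  shows "dirichlet (\<lambda>x. (of_bool (e \<in> x) - p) / c) \<le> 1 / M / c\<^sup>2"
proof -
  let ?f = "\<lambda>x. (of_bool (e \<in> x) - p) / c :: real"
  have sq: "(?f (flip x e') - ?f x)\<^sup>2 = of_bool (e' = e) / c\<^sup>2" for x e'
    unfolding flip_def by (auto simp: diff_divide_distrib[symmetric] power_divide)
  have "(\<Sum>x\<in>Pow (complete_edges n). \<Sum>e'\<in>complete_edges n. rate e' x * (?f (flip x e') - ?f x)\<^sup>2 * \<mu> x)
      = (\<Sum>x\<in>Pow (complete_edges n). rate e x * \<mu> x / c\<^sup>2)"
  proof (intro sum.cong refl)
    fix x
    have "(\<Sum>e'\<in>complete_edges n. rate e' x * (?f (flip x e') - ?f x)\<^sup>2 * \<mu> x)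
        = (\<Sum>e'\<in>complete_edges n. if e' = e then rate e x * \<mu> x / c\<^sup>2 else 0)"
      unfolding sq by (intro sum.cong refl) auto
    then show "(\<Sum>e'\<in>complete_edges n. rate e' x * (?f (flip x e') - ?f x)\<^sup>2 * \<mu> x) = rate e x * \<mu> x / c\<^sup>2"
      using e finite_complete_edges by simp
  qed
  also have "\<dots> \<le> (\<Sum>x\<in>Pow (complete_edges n). \<mu> x / c\<^sup>2)"
  proof (intro sum_mono divide_right_mono)
    fix x
    have "rate e x \<le> 1"
      unfolding rate_def using logistic_pos[of "field e x"] logistic_less_1[of "field e x"] by simp
    then show "rate e x * \<mu> x \<le> \<mu> x"
      by (intro mult_left_le_one_le) (auto simp: rate_def logistic_pos logistic_less_1 less_imp_le)
  qed simp
  also have "\<dots> = 1 / c\<^sup>2"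
    using pi_sum by (simp add: sum_divide_distrib[symmetric])
  finally have "dirichlet ?f \<le> 1 / c\<^sup>2 / M"
    unfolding dirichlet_def using M_pos by (intro divide_right_mono) auto
  then show ?thesis
    by (simp add: mult.commute)
qed

lemma inner_diff_const: "inner (\<lambda>x. f x - m) (\<lambda>x. 1) = inner f (\<lambda>x. 1) - m"
  unfolding inner_def using pi_sum
  by (simp add: right_diff_distrib sum_subtractf sum_distrib_right[symmetric])

lemma inner_cmult: "inner (\<lambda>x. k * f x) g = k * inner f g"
  unfolding inner_def by (simp add: sum_distrib_left mult_ac)

text \<open>The test function is centred and scaled to unit variance. It also witnesses that the
  infimum runs over a nonempty set, without which no lower bound on it could be derived.\<close>

lemma spectral_gap_le: "spectral_gap s G \<beta> n \<le> 1 / M / (1 / 2 * (1 - logistic C0))"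
  and spectral_gap_set_nonempty:
    "{dirichlet_form s G \<beta> n f f | f. measure_pmf.expectation (ergm s G \<beta> n) f = 0
      \<and> measure_pmf.expectation (ergm s G \<beta> n) (\<lambda>x. (f x)\<^sup>2) = 1} \<noteq> {}"
proof -
  obtain e where e: "e \<in> complete_edges n"
    using complete_edges_nonempty by blast
  define p where "p = inner (\<lambda>x. of_bool (e \<in> x)) (\<lambda>x. 1)"
  have v: "1 / 2 * (1 - logistic C0) \<le> p * (1 - p)"
    unfolding p_def by (rule edge_variance[OF e])
  have v0: "0 < 1 / 2 * (1 - logistic C0)"
    using logistic_less_1[of C0] by simp
  define c where "c = sqrt (p * (1 - p))"
  have c2: "c\<^sup>2 = p * (1 - p)" "0 < c\<^sup>2"
    unfolding c_def using v v0 by auto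
  let ?f = "\<lambda>x. (of_bool (e \<in> x) - p) / c :: real"
  have "inner ?f (\<lambda>x. 1) = inner (\<lambda>x. of_bool (e \<in> x) - p) (\<lambda>x. 1) / c"
    unfolding inner_def by (simp add: sum_divide_distrib)
  also have "\<dots> = 0"
    unfolding inner_diff_const p_def by simp
  finally have mean: "measure_pmf.expectation (ergm s G \<beta> n) ?f = 0"
    unfolding expectation_eq_inner .
  \<comment> \<open>The square of an indicator is the indicator itself; the double minus sign brings
    the constant into the form of \<open>inner_diff_const\<close>.\<close>
  have sq: "(?f x)\<^sup>2 = ((1 - 2 * p) * of_bool (e \<in> x) - (- (p\<^sup>2))) / c\<^sup>2" for x
    by (cases "e \<in> x") (simp_all add: power_divide power2_eq_square algebra_simps)
  have "inner (\<lambda>x. (?f x)\<^sup>2) (\<lambda>x. 1)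
      = inner (\<lambda>x. (1 - 2 * p) * of_bool (e \<in> x) - (- (p\<^sup>2))) (\<lambda>x. 1) / c\<^sup>2"
    unfolding inner_def sq by (simp add: sum_divide_distrib)
  also have "\<dots> = ((1 - 2 * p) * p - (- (p\<^sup>2))) / c\<^sup>2"
    unfolding inner_diff_const inner_cmult p_def ..
  also have "\<dots> = 1"
    using c2 by (simp add: power2_eq_square[of p] algebra_simps)
  finally have var: "measure_pmf.expectation (ergm s G \<beta> n) (\<lambda>x. (?f x)\<^sup>2) = 1"
    unfolding expectation_eq_inner .
  let ?S = "{dirichlet_form s G \<beta> n f f | f. measure_pmf.expectation (ergm s G \<beta> n) f = 0
      \<and> measure_pmf.expectation (ergm s G \<beta> n) (\<lambda>x. (f x)\<^sup>2) = 1}"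
  have mem: "dirichlet_form s G \<beta> n ?f ?f \<in> ?S"
    using mean var by blast
  then show "?S \<noteq> {}"
    by blast
  have "bdd_below ?S"
  proof (rule bdd_belowI[of _ 0])
    fix y assume "y \<in> ?S"
    then obtain f where "y = dirichlet f"
      unfolding dirichlet_form_eq by blast
    then show "0 \<le> y"
      unfolding dirichlet_def rate_def
      by (auto intro!: divide_nonneg_nonneg sum_nonneg mult_nonneg_nonneg
          simp: logistic_pos logistic_less_1 less_imp_le)
  qed
  then have "spectral_gap s G \<beta> n \<le> dirichlet_form s G \<beta> n ?f ?f"
    unfolding spectral_gap_def using mem by (intro cInf_lower)
  also have "\<dots> \<le> 1 / M / c\<^sup>2"
    unfolding dirichlet_form_eq by (rule dirichlet_edge_le[OF e])
  also have "\<dots> \<le> 1 / M / (1 / 2 * (1 - logistic C0))"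
    using v v0 c2 M_pos by (intro divide_left_mono) auto
  finally show "spectral_gap s G \<beta> n \<le> 1 / M / (1 / 2 * (1 - logistic C0))" .
qed

lemma variance_le:
  assumes K: "K \<ge> 1"
    and half: "\<And>x e. x \<subseteq> complete_edges n \<Longrightarrow> e \<in> complete_edges n \<Longrightarrow>
      iter (K * card (complete_edges n)) (\<lambda>x. real (card x)) (insert e x)
      - iter (K * card (complete_edges n)) (\<lambda>x. real (card x)) (x - {e}) \<le> 1 / 2"
  shows "measure_pmf.variance (ergm s G \<beta> n) f \<le> real K * (real n)\<^sup>2 * dirichlet_form s G \<beta> n f f"
proof -
  define m where "m = measure_pmf.expectation (ergm s G \<beta> n) f"
  let ?g = "\<lambda>x. f x - m"
  have m: "m = inner f (\<lambda>x. 1)"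
    unfolding m_def by (rule expectation_eq_inner)
  have dir: "dirichlet ?g = dirichlet_form s G \<beta> n f f"
    unfolding dirichlet_form_eq dirichlet_def by simp
  have dir0: "0 \<le> dirichlet ?g"
    unfolding dirichlet_def rate_def
    by (auto intro!: divide_nonneg_nonneg sum_nonneg mult_nonneg_nonneg
        simp: logistic_pos logistic_less_1 less_imp_le)
  have "1 \<le> real (card (complete_edges n))"
    by (rule M_ge_1)
  then have T: "1 \<le> K * card (complete_edges n)"
    using K by (simp add: Suc_le_eq)
  have "measure_pmf.variance (ergm s G \<beta> n) f = measure_pmf.expectation (ergm s G \<beta> n) (\<lambda>x. (?g x)\<^sup>2)"
    by (simp only: m_def)
  also have "\<dots> = inner ?g ?g"
    unfolding expectation_eq_inner inner_def by (simp add: power2_eq_square mult.assoc)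
  also have "\<dots> \<le> real (K * card (complete_edges n)) * dirichlet ?g"
    using T half by (intro poincare_of_gradient_halving) (auto simp: inner_diff_const m)
  also have "\<dots> \<le> real K * (real n)\<^sup>2 * dirichlet ?g"
  proof (intro mult_right_mono dir0)
    have "real (card (complete_edges n)) \<le> (real n)\<^sup>2"
      unfolding card_complete_edges by (simp add: power2_eq_square field_simps)
    then show "real (K * card (complete_edges n)) \<le> real K * (real n)\<^sup>2"
      by (simp add: mult_left_mono)
  qed
  finally show ?thesis
    unfolding dir .
qed

end

section \<open>Choice of constants at high temperature\<close>

lemma Psi_has_derivative:
  "(mean_field_Psi s G \<beta> has_real_derivative Psi_deriv s G \<beta> p) (at p)"
proof -
  let ?k = "\<lambda>i. card (edges (G i))"
  have "((\<lambda>p. \<Sum>i=1..s. 2 * \<beta> i * real (?k i) * p ^ (?k i - 1)) has_real_derivative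
      (\<Sum>i=1..s. 2 * \<beta> i * real (?k i) * (real (?k i - 1) * p ^ (?k i - 2)))) (at p)"
    by (auto intro!: derivative_eq_intros sum.cong simp: numeral_2_eq_2)
  moreover have "(\<Sum>i=1..s. 2 * \<beta> i * real (?k i) * (real (?k i - 1) * p ^ (?k i - 2))) = Psi_deriv s G \<beta> p"
    unfolding Psi_deriv_def
  proof (intro sum.cong refl)
    fix i
    have "(\<Sum>a\<in>edges (G i). \<Sum>b\<in>edges (G i) - {a}. 2 * p ^ (?k i - 2))
        = (\<Sum>a\<in>edges (G i). real (?k i - 1) * (2 * p ^ (?k i - 2)))"
      by (intro sum.cong refl) (cases "finite (edges (G i))", auto)
    then show "2 * \<beta> i * real (?k i) * (real (?k i - 1) * p ^ (?k i - 2))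
        = \<beta> i * (\<Sum>a\<in>edges (G i). \<Sum>b\<in>edges (G i) - {a}. 2 * p ^ (?k i - 2))"
      by simp
  qed
  ultimately show ?thesis
    by (simp add: mean_field_Psi_def[abs_def])
qed

lemma continuous_logistic: "continuous_on S logistic"
  using logistic_deriv DERIV_isCont continuous_at_imp_continuous_on by blast

lemma continuous_Psi: "continuous_on S (mean_field_Psi s G \<beta>)"
  unfolding mean_field_Psi_def by (intro continuous_intros)

text \<open>At \<epsilon> = 0 the product defining \<open>\<kappa>\<close> is the derivative of
  \<open>mean_field_phi\<close> at the fixed point, which is less than 1; by continuity the strict
  inequality leaves room for a margin.\<close>

lemma high_temperature_constants:
  assumes beta: "\<And>i. i \<in> {1..s} \<Longrightarrow> \<beta> i > 0" and high: "high_temperature s G \<beta>"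
  obtains p \<epsilon> \<kappa> :: real and T0 :: nat where
    "0 < \<epsilon>" "\<epsilon> \<le> p" "\<kappa> < 1" "0 \<le> \<kappa>"
    "\<kappa> = (let a = max (mean_field_Psi s G \<beta> (p - \<epsilon>) - \<epsilon>) 0 in
       logistic a * (1 - logistic a) * (Psi_deriv s G \<beta> (p + \<epsilon>) + \<epsilon>))"
    "\<And>m t. 1 \<le> m \<Longrightarrow> real T0 * m \<le> real t \<Longrightarrow>
      ((\<lambda>x. x + (mean_field_phi s G \<beta> x - x) / m) ^^ t) 1 \<le> p + \<epsilon> \<and>
      p - \<epsilon> \<le> ((\<lambda>x. x + (mean_field_phi s G \<beta> x - x) / m) ^^ t) 0"
proof -
  let ?\<phi> = "mean_field_phi s G \<beta>" and ?\<Psi> = "mean_field_Psi s G \<beta>" and ?D = "Psi_deriv s G \<beta>"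
  obtain p where p: "0 < p" "?\<phi> p = p" "\<And>q. 0 < q \<Longrightarrow> ?\<phi> q = q \<Longrightarrow> q = p" "deriv ?\<phi> p < 1"
    using high unfolding high_temperature_def by blast
  have beta_nonneg: "0 \<le> \<beta> i" if "i \<in> {1..s}" for i
    using beta[OF that] by simp
  have phi: "0 < ?\<phi> q" "?\<phi> q < 1" for q
    unfolding mean_field_phi_def by (rule logistic_pos logistic_less_1)+
  have p1: "p < 1"
    using phi(2)[of p] p(2) by simp
  have cont: "continuous_on S ?\<phi>" for S
    unfolding mean_field_phi_def
    by (rule continuous_on_compose2[OF continuous_logistic continuous_Psi]) auto
  have Psi_nonneg: "0 \<le> ?\<Psi> q" if "0 \<le> q" for q
    unfolding mean_field_Psi_def using that beta_nonneg by (intro sum_nonneg mult_nonneg_nonneg) auto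
  have D_nonneg: "0 \<le> ?D q" if "0 \<le> q" for q
    unfolding Psi_deriv_def using that beta_nonneg by (intro sum_nonneg mult_nonneg_nonneg) auto
  have mono: "?\<phi> x \<le> ?\<phi> y" if "0 \<le> x" "x \<le> y" for x y
    unfolding mean_field_phi_def mean_field_Psi_def using that beta_nonneg
    by (intro logistic_mono sum_mono mult_left_mono power_mono) auto
  \<comment> \<open>Otherwise, as phi(1) < 1, the intermediate value theorem gives a second fixed
    point in [q, 1].\<close>
  have above: "?\<phi> q < q" if q: "p < q" "q \<le> 1" for q
  proof (rule ccontr)
    assume "\<not> ?\<phi> q < q"
    then have "\<exists>x. q \<le> x \<and> x \<le> 1 \<and> ?\<phi> x - x = 0"
      using phi(2)[of 1] q by (intro IVT2' continuous_intros cont) auto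
    then obtain x where "q \<le> x" "?\<phi> x = x"
      by auto
    then show False
      using p(1) p(3)[of x] q by linarith
  qed
  \<comment> \<open>Here phi(0) > 0 is used. The fixed point found is a value of phi, hence
    positive, so uniqueness among positive points applies to it.\<close>
  have below: "q < ?\<phi> q" if q: "0 \<le> q" "q < p" for q
  proof (rule ccontr)
    assume "\<not> q < ?\<phi> q"
    then have "\<exists>x. 0 \<le> x \<and> x \<le> q \<and> ?\<phi> x - x = 0"
      using phi(1)[of 0] q by (intro IVT2' continuous_intros cont) auto
    then obtain x where x: "0 \<le> x" "x \<le> q" "?\<phi> x = x"
      by auto
    then show False
      using p(3)[of x] phi(1)[of x] q by linarith
  qed
  have "(?\<phi> has_real_derivative logistic (?\<Psi> p) * (1 - logistic (?\<Psi> p)) * ?D p) (at p)"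
    unfolding mean_field_phi_def[abs_def] by (rule DERIV_chain2[OF logistic_deriv Psi_has_derivative])
  then have slope: "logistic (?\<Psi> p) * (1 - logistic (?\<Psi> p)) * ?D p < 1"
    using p(4) by (simp add: DERIV_imp_deriv)
  define k where "k \<epsilon> = (let a = max (?\<Psi> (p - \<epsilon>) - \<epsilon>) 0 in logistic a * (1 - logistic a) * (?D (p + \<epsilon>) + \<epsilon>))" for \<epsilon>
  have "isCont k 0"
  proof -
    have D: "continuous_on UNIV (\<lambda>\<epsilon>. ?D (p + \<epsilon>))"
      unfolding Psi_deriv_def by (intro continuous_intros)
    have "continuous_on UNIV (\<lambda>\<epsilon>. max (?\<Psi> (p - \<epsilon>) - \<epsilon>) 0)"
      unfolding mean_field_Psi_def by (intro continuous_intros)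
    then have L: "continuous_on UNIV (\<lambda>\<epsilon>. logistic (max (?\<Psi> (p - \<epsilon>) - \<epsilon>) 0))"
      by (rule continuous_on_compose2[OF continuous_logistic]) auto
    have "continuous_on UNIV k"
      unfolding k_def Let_def by (intro continuous_intros D L)
    then show ?thesis
      by (simp add: continuous_on_eq_continuous_at)
  qed
  moreover have "k 0 < 1"
    using slope Psi_nonneg[of p] p(1) by (simp add: k_def max_absorb1 Let_def)
  ultimately have "eventually (\<lambda>\<epsilon>. k \<epsilon> < 1) (at 0)"
    unfolding isCont_def by (rule order_tendstoD(2))
  then obtain d where d: "0 < d" "\<And>\<epsilon>. \<epsilon> \<noteq> 0 \<Longrightarrow> \<bar>\<epsilon>\<bar> < d \<Longrightarrow> k \<epsilon> < 1"
    unfolding eventually_at by (auto simp: dist_real_def)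
  \<comment> \<open>The bound by \<open>p\<close> keeps p - \<epsilon> nonnegative, where the powers
    in \<open>mean_field_Psi\<close> are monotone.\<close>
  define \<epsilon> where "\<epsilon> = min (d / 2) p"
  have eps: "0 < \<epsilon>" "\<epsilon> \<le> p" "k \<epsilon> < 1"
    using d p(1) by (auto simp: \<epsilon>_def intro!: d(2))
  obtain T0 :: nat where T0: "\<And>m t. 1 \<le> m \<Longrightarrow> real T0 * m \<le> real t \<Longrightarrow>
      ((\<lambda>x. x + (?\<phi> x - x) / m) ^^ t) 1 \<le> p + \<epsilon> \<and> p - \<epsilon> \<le> ((\<lambda>x. x + (?\<phi> x - x) / m) ^^ t) 0"
    using relaxation[OF cont mono less_imp_le[OF p(1)] less_imp_le[OF p1] p(2) above below eps(1)] by blast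
  have "0 \<le> k \<epsilon>"
    unfolding k_def Let_def using D_nonneg[of "p + \<epsilon>"] eps p(1)
    by (auto intro!: mult_nonneg_nonneg less_imp_le[OF logistic_pos] simp: logistic_less_1 less_imp_le)
  from that[OF eps(1,2,3) this _ T0] show ?thesis
    by (simp add: k_def)
qed

theorem theorem2p1:
  fixes s :: nat and G :: "nat \<Rightarrow> 'v graph" and \<beta> :: "nat \<Rightarrow> real"
  assumes "s \<ge> 1"
    and "\<And>i. i \<in> {1..s} \<Longrightarrow> finite_simple_graph (G i)"
    and "\<And>i. i \<in> {1..s} \<Longrightarrow> \<beta> i > 0"
    and "high_temperature s G \<beta>"
  shows "(\<exists>c1 c2. 0 < c1 \<and> c1 \<le> c2 \<and>
            (\<forall>\<^sub>F n in sequentially.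
               c1 / (real n)\<^sup>2 \<le> spectral_gap s G \<beta> n \<and>
               spectral_gap s G \<beta> n \<le> c2 / (real n)\<^sup>2))
       \<and> (\<exists>C>0. \<forall>\<^sub>F n in sequentially. \<forall>f :: nat set set \<Rightarrow> real.
            measure_pmf.variance (ergm s G \<beta> n) f
              \<le> C * (real n)\<^sup>2 * dirichlet_form s G \<beta> n f f)"
proof -
  obtain p \<epsilon> \<kappa> :: real and T0 :: nat where eps: "0 < \<epsilon>" "\<epsilon> \<le> p" and kappa: "\<kappa> < 1" "0 \<le> \<kappa>"
    "\<kappa> = (let a = max (mean_field_Psi s G \<beta> (p - \<epsilon>) - \<epsilon>) 0 in
       logistic a * (1 - logistic a) * (Psi_deriv s G \<beta> (p + \<epsilon>) + \<epsilon>))"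
    and relax: "\<And>m t. 1 \<le> m \<Longrightarrow> real T0 * m \<le> real t \<Longrightarrow>
      ((\<lambda>x. x + (mean_field_phi s G \<beta> x - x) / m) ^^ t) 1 \<le> p + \<epsilon> \<and>
      p - \<epsilon> \<le> ((\<lambda>x. x + (mean_field_phi s G \<beta> x - x) / m) ^^ t) 0"
    by (rule high_temperature_constants[OF _ assms(4)], erule assms(3), rule that)
  define C0 where "C0 = size_const s G \<beta>"
  define k where "k = real (max_edges s G)"
  define B where "B = real T0 * exp (2 * C0 * real T0) * C0\<^sup>2"
  define C1 where "C1 = k * (C0 + 1) + 1"
  \<comment> \<open>A closed form for the number of edges, so that the limits below can be computed;
    it is \<open>M\<close> in each interpreted model.\<close>
  define m where "m n = real n * (real n - 1) / 2" for n :: nat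
  define \<delta> where "\<delta> n = k * (2 * exp B / sqrt n + C0 / real n) + k\<^sup>2 / m n" for n :: nat
  obtain K1 :: nat where K1: "exp (- ((1 - \<kappa>) * real K1)) * exp (C0 * real T0) \<le> 1 / 4" "1 \<le> K1"
  proof -
    have lim: "((\<lambda>j::nat. exp (- ((1 - \<kappa>) * real j)) * exp (C0 * real T0)) \<longlongrightarrow> 0) at_top"
      using kappa(1) by real_asymp
    have "eventually (\<lambda>j::nat. exp (- ((1 - \<kappa>) * real j)) * exp (C0 * real T0) < 1 / 4 \<and> 1 \<le> j) at_top"
      by (intro eventually_conj eventually_ge_at_top order_tendstoD(2)[OF lim]) simp
    then show ?thesis
      using that by (metis (no_types, lifting) eventually_happens' less_imp_le sequentially_bot)
  qed
  have lim1: "eventually (\<lambda>n::nat. C0 * exp (C0 * real T0) \<le> sqrt n) at_top"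
  proof -
    have "filterlim (\<lambda>n::nat. sqrt n) at_top at_top"
      by real_asymp
    then show ?thesis
      by (simp add: filterlim_at_top)
  qed
  have lim2: "eventually (\<lambda>n::nat. C0 * (\<delta> n * exp (C1 * real T0) + 1 / real n) \<le> \<epsilon> / 2) at_top"
  proof -
    have l: "((\<lambda>n::nat. 1 / sqrt n) \<longlongrightarrow> 0) at_top" "((\<lambda>n::nat. 1 / real n) \<longlongrightarrow> 0) at_top"
        "((\<lambda>n::nat. 1 / m n) \<longlongrightarrow> 0) at_top"
      unfolding m_def by real_asymp+
    have "((\<lambda>n::nat. C0 * ((k * (2 * exp B * (1 / sqrt n) + C0 * (1 / real n)) + k\<^sup>2 * (1 / m n)) * exp (C1 * real T0) + 1 / real n))
        \<longlongrightarrow> C0 * ((k * (2 * exp B * 0 + C0 * 0) + k\<^sup>2 * 0) * exp (C1 * real T0) + 0)) at_top"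
      by (intro tendsto_intros l)
    then have lim: "((\<lambda>n::nat. C0 * (\<delta> n * exp (C1 * real T0) + 1 / real n)) \<longlongrightarrow> 0) at_top"
      by (simp add: \<delta>_def)
    have "eventually (\<lambda>n::nat. C0 * (\<delta> n * exp (C1 * real T0) + 1 / real n) < \<epsilon> / 2) at_top"
      using eps by (intro order_tendstoD(2)[OF lim]) simp
    then show ?thesis
      by eventually_elim simp
  qed
  \<comment> \<open>The factor exp (- sqrt n \<epsilon> / 2) beats (m n)^2, which is of order
    n^4.\<close>
  have lim3: "eventually (\<lambda>n::nat. 6 * (m n * (2 * exp (B - sqrt n * (\<epsilon> / 2)))) * m n / (1 - \<kappa>) \<le> 1 / 4) at_top"
  proof -
    have "((\<lambda>n::nat. (m n)\<^sup>2 * exp (- (sqrt n * (\<epsilon> / 2)))) \<longlongrightarrow> 0) at_top"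
      unfolding m_def using eps(1) by real_asymp
    then have lim: "((\<lambda>n::nat. (12 * exp B / (1 - \<kappa>)) * ((m n)\<^sup>2 * exp (- (sqrt n * (\<epsilon> / 2))))) \<longlongrightarrow> 0) at_top"
      by (rule tendsto_mult_right_zero)
    have eq: "(12 * exp B / (1 - \<kappa>)) * ((m n)\<^sup>2 * exp (- (sqrt n * (\<epsilon> / 2))))
        = 6 * (m n * (2 * exp (B - sqrt n * (\<epsilon> / 2)))) * m n / (1 - \<kappa>)" for n :: nat
    proof -
      have "exp (B - sqrt n * (\<epsilon> / 2)) = exp B * exp (- (sqrt n * (\<epsilon> / 2)))"
        by (simp add: exp_add[symmetric])
      then show ?thesis
        by (simp only: power2_eq_square) simp
    qed
    have "eventually (\<lambda>n::nat. 6 * (m n * (2 * exp (B - sqrt n * (\<epsilon> / 2)))) * m n / (1 - \<kappa>) < 1 / 4) at_top"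
      by (intro order_tendstoD(2)[OF lim[unfolded eq]]) simp
    then show ?thesis
      by eventually_elim simp
  qed
  \<comment> \<open>Number of blocks of \<open>M\<close> steps, independent of \<open>n\<close>; it
    serves as the Poincare constant and its inverse as \<open>c1\<close>.\<close>
  define K where "K = K1 + T0"
  have K: "1 \<le> K"
    using K1 by (simp add: K_def)
  have var: "\<forall>\<^sub>F n in sequentially. \<forall>f. measure_pmf.variance (ergm s G \<beta> n) f
      \<le> real K * (real n)\<^sup>2 * dirichlet_form s G \<beta> n f f"
    using lim1 lim2 lim3 eventually_ge_at_top[of "2::nat"]
  proof eventually_elim
    case (elim n)
    interpret ergm_model s G \<beta> n
      using assms elim by unfold_locales auto
    have M: "real (card (complete_edges n)) = m n"
      unfolding m_def by (rule card_complete_edges)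
    have eu: "euler = (\<lambda>x. x + (mean_field_phi s G \<beta> x - x) / m n)"
      unfolding euler_def M ..
    have rel: "(euler ^^ (T0 * card (complete_edges n))) 1 \<le> p + \<epsilon>"
        "p - \<epsilon> \<le> (euler ^^ (T0 * card (complete_edges n))) 0"
      using relax[of "m n" "T0 * card (complete_edges n)"] M_ge_1 unfolding eu by (simp_all add: M)
    have "iter (K * card (complete_edges n)) (\<lambda>x. real (card x)) (insert e x)
        - iter (K * card (complete_edges n)) (\<lambda>x. real (card x)) (x - {e}) \<le> 1 / 2"
      if "x \<subseteq> complete_edges n" "e \<in> complete_edges n" for x e
      unfolding K_def
      by (rule card_contraction[where B = B and ?C1.0 = C1 and \<delta> = "\<delta> n" and \<epsilon> = \<epsilon> and p = p and \<kappa> = \<kappa>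
            and a = "max (mean_field_Psi s G \<beta> (p - \<epsilon>) - \<epsilon>) 0" and w = "Psi_deriv s G \<beta> (p + \<epsilon>) + \<epsilon>"])
        (use that elim eps kappa rel K1(1) in
          \<open>simp_all add: B_def C0_def C1_def k_def \<delta>_def M Let_def\<close>)
    then show ?case
      using variance_le[OF K] by blast
  qed
  have lower: "\<forall>\<^sub>F n in sequentially. (1 / real K) / (real n)\<^sup>2 \<le> spectral_gap s G \<beta> n"
    using var eventually_ge_at_top[of "2::nat"]
  proof eventually_elim
    case (elim n)
    interpret ergm_model s G \<beta> n
      using assms elim by unfold_locales auto
    show ?case
      unfolding spectral_gap_def
    proof (rule cInf_greatest[OF spectral_gap_set_nonempty])
      fix y assume "y \<in> {dirichlet_form s G \<beta> n f f | f. measure_pmf.expectation (ergm s G \<beta> n) f = 0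
        \<and> measure_pmf.expectation (ergm s G \<beta> n) (\<lambda>x. (f x)\<^sup>2) = 1}"
      then obtain f where f: "y = dirichlet_form s G \<beta> n f f"
          "measure_pmf.expectation (ergm s G \<beta> n) f = 0"
          "measure_pmf.expectation (ergm s G \<beta> n) (\<lambda>x. (f x)\<^sup>2) = 1"
        by blast
      have "1 \<le> real K * (real n)\<^sup>2 * y"
        using elim(1)[rule_format, of f] f by simp
      then show "(1 / real K) / (real n)\<^sup>2 \<le> y"
        using K elim(2) by (simp add: field_simps)
    qed
  qed
  \<comment> \<open>The 8 is 4 times 2: from M \<ge> n^2 / 4 for n \<ge> 2, and from the 1/2 in the
    variance of an edge.\<close>
  define c2 where "c2 = 8 / (1 - logistic C0)"
  have upper: "\<forall>\<^sub>F n in sequentially. spectral_gap s G \<beta> n \<le> c2 / (real n)\<^sup>2"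
    using eventually_ge_at_top[of "2::nat"]
  proof eventually_elim
    case (elim n)
    interpret ergm_model s G \<beta> n
      using assms elim by unfold_locales auto
    have pos: "0 < 1 - logistic C0"
      using logistic_less_1[of C0] by simp
    have "(real n)\<^sup>2 / 4 \<le> real (card (complete_edges n))"
      unfolding card_complete_edges using elim mult_left_mono[of 2 "real n" "real n"]
      by (simp add: power2_eq_square field_simps)
    then have "1 / real (card (complete_edges n)) \<le> 1 / ((real n)\<^sup>2 / 4)"
      using elim by (intro divide_left_mono) (auto intro!: mult_pos_pos M_pos)
    then have "1 / real (card (complete_edges n)) / (1 / 2 * (1 - logistic C0))
        \<le> 1 / ((real n)\<^sup>2 / 4) / (1 / 2 * (1 - logistic C0))"
      using pos by (intro divide_right_mono) auto
    also have "\<dots> = c2 / (real n)\<^sup>2"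
      by (simp add: c2_def)
    finally show ?case
      using spectral_gap_le unfolding C0_def by linarith
  qed
  \<comment> \<open>The maximum secures c1 \<le> c2 without a comparison of the two
    constants.\<close>
  have "\<forall>\<^sub>F n in sequentially. (1 / real K) / (real n)\<^sup>2 \<le> spectral_gap s G \<beta> n \<and>
      spectral_gap s G \<beta> n \<le> max (1 / real K) c2 / (real n)\<^sup>2"
    using lower upper
  proof eventually_elim
    case (elim n)
    have "c2 / (real n)\<^sup>2 \<le> max (1 / real K) c2 / (real n)\<^sup>2"
      by (intro divide_right_mono) auto
    then show ?case
      using elim by linarith
  qed
  moreover have "0 < 1 / real K" "1 / real K \<le> max (1 / real K) c2" "0 < real K"
    using K by auto
  ultimately show ?thesis
    using var by blast
qed

end
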